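(* Consider a global $C^1$ solution $(f^\alpha, E_1,E_2,B)$, $t\ge 0$, of the relativistic Vlasov-Maxwell system described in the context, in the neutral case. Then there is a constant $C$ (independent of $t,x,v$) such that, for every $\alpha$, $$|v_1|\le C+Ct^{\frac12}\,(t-|x|+2C_0)^{\frac14}$$ for all $(t,x,v)$ in the support of $f^\alpha$ (with $t\ge 0$).
   Context: The system, for $\alpha=1,\dots,N$, $t\ge0$, $x\in\mathbb{R}$, $v=(v_1,v_2)\in\mathbb{R}^2$, is $$\partial_t f^\alpha+\hat v_1^\alpha\partial_x f^\alpha+e^\alpha(E_1+\hat v_2^\alpha B)\partial_{v_1}f^\alpha+e^\alpha(E_2-\hat v_1^\alpha B)\partial_{v_2}f^\alpha=0,$$ $$\rho(t,x)=\int\sum_\alpha e^\alpha f^\alpha(t,x,v)\,dv,\qquad j(t,x)=\int\sum_\alpha e^\alpha f^\alpha(t,x,v)\hat v^\alpha\,dv,$$ $$E_1(t,x)=\tfrac12\int_{-\infty}^x\rho(t,y)\,dy-\tfrac12\int_x^\infty\rho(t,y)\,dy,\qquad \partial_tE_2+\partial_xB=-j_2,\qquad \partial_tB+\partial_xE_2=0,$$ where $\hat v^\alpha=v/\sqrt{(m^\alpha)^2+|v|^2}$, $m^\alpha>0$ is the mass and $e^\alpha\in\mathbb{R}$ the charge of species $\alpha$; $v$-integrals are over $\mathbb{R}^2$. Initial data: $f^\alpha(0,x,v)=f_0^\alpha(x,v)\ge0$, $E_2(0,x)=E_{20}(x)$, $B(0,x)=B_0(x)$, where $f_0^\alpha\in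 C_0^1(\mathbb{R}^3)$ is nonnegative and compactly supported and $E_{20},B_0\in C^1_0(\mathbb{R})$ are compactly supported. $C_0>0$ is chosen so that $f_0^\alpha$ (for all $\alpha$), $E_{20}$ and $B_0$ vanish if $|x|\ge C_0$. The neutral case means $\iint\sum_\alpha e^\alpha f_0^\alpha\,dv\,dx=0$. The constant $C$ may depend on the initial data (and the fixed parameters of the system) but not on $t,x,v$. (Since particle speeds are less than $1$, $|x|\le C_0+t$ on the support of $f^\alpha$.) *)

theory Defs
  imports "HOL-Analysis.Analysis"
begin

text \<open>
  On the closed set \<open>{0..} \<times> UNIV\<close> this is differentiability up to the boundary \<open>t = 0\<close>
  (one-sided in time there), with a continuous derivative.
\<close>
definition C1_on :: "'a::real_normed_vector set \<Rightarrow> ('a \<Rightarrow> real) \<Rightarrow> bool" where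
  "C1_on S g \<longleftrightarrow>
     (\<exists>g'. (\<forall>z\<in>S. (g has_derivative blinfun_apply (g' z)) (at z within S)) \<and> continuous_on S g')"

text \<open>Momentum space \<open>\<real>\<^sup>2\<close> is \<open>real \<times> real\<close>, whose norm is the Euclidean one.\<close>
definition vhat :: "real \<Rightarrow> real \<times> real \<Rightarrow> real \<times> real" where
  "vhat m v = v /\<^sub>R sqrt (m\<^sup>2 + (norm v)\<^sup>2)"

text \<open>
  Throughout, species are indexed by \<open>\<alpha> \<in> {1..N}\<close>, with charges \<open>e \<alpha>\<close> and masses \<open>m \<alpha>\<close>;
  the distribution functions are \<open>f \<alpha> t x v\<close>, the initial ones \<open>f0 \<alpha> x v\<close>.
\<close>

definition charge_integrand ::
  "nat \<Rightarrow> (nat \<Rightarrow> real) \<Rightarrow> (nat \<Rightarrow> real \<times> real \<Rightarrow> real) \<Rightarrow> real \<times> real \<Rightarrow> real" where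
  "charge_integrand N e g v = (\<Sum>\<alpha>=1..N. e \<alpha> * g \<alpha> v)"

definition current_integrand ::
  "nat \<Rightarrow> (nat \<Rightarrow> real) \<Rightarrow> (nat \<Rightarrow> real) \<Rightarrow> (nat \<Rightarrow> real \<times> real \<Rightarrow> real)
     \<Rightarrow> real \<times> real \<Rightarrow> real \<times> real" where
  "current_integrand N e m g v = (\<Sum>\<alpha>=1..N. (e \<alpha> * g \<alpha> v) *\<^sub>R vhat (m \<alpha>) v)"

definition charge_density ::
  "nat \<Rightarrow> (nat \<Rightarrow> real) \<Rightarrow> (nat \<Rightarrow> real \<Rightarrow> real \<Rightarrow> real \<times> real \<Rightarrow> real)
     \<Rightarrow> real \<Rightarrow> real \<Rightarrow> real" where
  "charge_density N e f t x = (LINT v|lborel. charge_integrand N e (\<lambda>\<alpha>. f \<alpha> t x) v)"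

definition current_density ::
  "nat \<Rightarrow> (nat \<Rightarrow> real) \<Rightarrow> (nat \<Rightarrow> real) \<Rightarrow> (nat \<Rightarrow> real \<Rightarrow> real \<Rightarrow> real \<times> real \<Rightarrow> real)
     \<Rightarrow> real \<Rightarrow> real \<Rightarrow> real \<times> real" where
  "current_density N e m f t x = (LINT v|lborel. current_integrand N e m (\<lambda>\<alpha>. f \<alpha> t x) v)"

text \<open>\<open>C0\<close> is a spatial bound for the supports of all the initial data.\<close>
definition admissible_data ::
  "nat \<Rightarrow> real \<Rightarrow> (nat \<Rightarrow> real \<Rightarrow> real \<times> real \<Rightarrow> real) \<Rightarrow> (real \<Rightarrow> real) \<Rightarrow> (real \<Rightarrow> real) \<Rightarrow> bool" where
  "admissible_data N C0 f0 E20 B0 \<longleftrightarrow>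
     (\<forall>\<alpha>\<in>{1..N}. C1_on UNIV (\<lambda>(x, v). f0 \<alpha> x v) \<and>
        compact (closure {(x, v). f0 \<alpha> x v \<noteq> 0}) \<and>
        (\<forall>x v. f0 \<alpha> x v \<ge> 0)) \<and>
     C1_on UNIV E20 \<and> compact (closure {x. E20 x \<noteq> 0}) \<and>
     C1_on UNIV B0 \<and> compact (closure {x. B0 x \<noteq> 0}) \<and>
     C0 > 0 \<and>
     (\<forall>x. \<bar>x\<bar> \<ge> C0 \<longrightarrow> (\<forall>\<alpha>\<in>{1..N}. \<forall>v. f0 \<alpha> x v = 0) \<and> E20 x = 0 \<and> B0 x = 0)"

definition neutral ::
  "nat \<Rightarrow> (nat \<Rightarrow> real) \<Rightarrow> (nat \<Rightarrow> real \<Rightarrow> real \<times> real \<Rightarrow> real) \<Rightarrow> bool" where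
  "neutral N e f0 \<longleftrightarrow> (LINT x|lborel. LINT v|lborel. charge_integrand N e (\<lambda>\<alpha>. f0 \<alpha> x) v) = 0"

text \<open>
  The integrability clauses say that the integrals in the system converge; they are needed
  because the library integral of a non-integrable function is \<open>0\<close>.
\<close>
definition global_C1_solution ::
  "nat \<Rightarrow> (nat \<Rightarrow> real) \<Rightarrow> (nat \<Rightarrow> real) \<Rightarrow>
   (nat \<Rightarrow> real \<Rightarrow> real \<times> real \<Rightarrow> real) \<Rightarrow> (real \<Rightarrow> real) \<Rightarrow> (real \<Rightarrow> real) \<Rightarrow>
   (nat \<Rightarrow> real \<Rightarrow> real \<Rightarrow> real \<times> real \<Rightarrow> real) \<Rightarrow>
   (real \<Rightarrow> real \<Rightarrow> real) \<Rightarrow> (real \<Rightarrow> real \<Rightarrow> real) \<Rightarrow> (real \<Rightarrow> real \<Rightarrow> real) \<Rightarrow> bool" where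
  "global_C1_solution N e m f0 E20 B0 f E1 E2 B \<longleftrightarrow>
     (\<forall>\<alpha>\<in>{1..N}. C1_on ({0..} \<times> UNIV) (\<lambda>(t, x, v). f \<alpha> t x v)) \<and>
     C1_on ({0..} \<times> UNIV) (\<lambda>(t, x). E1 t x) \<and>
     C1_on ({0..} \<times> UNIV) (\<lambda>(t, x). E2 t x) \<and>
     C1_on ({0..} \<times> UNIV) (\<lambda>(t, x). B t x) \<and>
     (\<forall>\<alpha>\<in>{1..N}. \<forall>t\<ge>0. \<forall>x v1 v2.
        vector_derivative (\<lambda>s. f \<alpha> s x (v1, v2)) (at t within {0..})
        + fst (vhat (m \<alpha>) (v1, v2)) * deriv (\<lambda>y. f \<alpha> t y (v1, v2)) x
        + e \<alpha> * (E1 t x + snd (vhat (m \<alpha>) (v1, v2)) * B t x) * deriv (\<lambda>w. f \<alpha> t x (w, v2)) v1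
        + e \<alpha> * (E2 t x - fst (vhat (m \<alpha>) (v1, v2)) * B t x) * deriv (\<lambda>w. f \<alpha> t x (v1, w)) v2
        = 0) \<and>
     (\<forall>t\<ge>0. \<forall>x. integrable lborel (charge_integrand N e (\<lambda>\<alpha>. f \<alpha> t x)) \<and>
                 integrable lborel (current_integrand N e m (\<lambda>\<alpha>. f \<alpha> t x))) \<and>
     (\<forall>t\<ge>0. integrable lborel (charge_density N e f t)) \<and>
     (\<forall>t\<ge>0. \<forall>x. E1 t x = 1/2 * (LINT y:{..x}|lborel. charge_density N e f t y)
                        - 1/2 * (LINT y:{x..}|lborel. charge_density N e f t y)) \<and>
     (\<forall>t\<ge>0. \<forall>x. vector_derivative (\<lambda>s. E2 s x) (at t within {0..}) + deriv (B t) x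
                 = - snd (current_density N e m f t x)) \<and>
     (\<forall>t\<ge>0. \<forall>x. vector_derivative (\<lambda>s. B s x) (at t within {0..}) + deriv (E2 t) x = 0) \<and>
     (\<forall>\<alpha>\<in>{1..N}. \<forall>x v. f \<alpha> 0 x v = f0 \<alpha> x v) \<and>
     (\<forall>x. E2 0 x = E20 x) \<and>
     (\<forall>x. B 0 x = B0 x)"

definition phase_support ::
  "(real \<Rightarrow> real \<Rightarrow> real \<times> real \<Rightarrow> real) \<Rightarrow> (real \<times> real \<times> real \<times> real) set" where
  "phase_support g = closure {(t, x, v). t \<ge> 0 \<and> g t x v \<noteq> 0}"

end

theory Submission
  imports Defs
begin

text \<open>
  Write \<open>D = t - \<bar>x\<bar> + 2 * C0\<close> and \<open>R = sqrt t * sqrt (sqrt D)\<close>. While the momentum of a particle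
  in the direction \<open>\<sigma> \<in> {1, -1}\<close> exceeds \<open>R\<close>, the particle moves almost at the speed of light and
  therefore stays close to a light line \<open>x - \<sigma> * t = const\<close>. The bound holds because the fields
  can transfer only a momentum of order \<open>R\<close> to a particle that stays close to such a line.

  What is under control near a light line is energy. The energy density \<open>\<epsilon>\<close> and the momentum
  density \<open>\<mu>\<close> satisfy \<open>\<epsilon>_t + \<mu>_x = 0\<close>, so there is a stream function \<open>\<phi>\<close> with \<open>\<phi>_x = \<epsilon>\<close> and
  \<open>\<phi>_t = - \<mu>\<close>. In the neutral case \<open>E1\<close> vanishes outside the light cone of the data, hence \<open>\<epsilon>\<close> has
  compact support in \<open>x\<close> and \<open>\<phi>\<close> takes its values between \<open>0\<close> and the total energy
  (\<open>energy_potential\<close>). Along a light line \<open>\<sigma> * \<phi>\<close> has the derivative \<open>\<epsilon> - \<sigma> * \<mu>\<close>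
  (\<open>potential_along_light_line\<close>), so the integral of \<open>\<epsilon> - \<sigma> * \<mu>\<close> along any light line is at most
  the total energy, uniformly in time. This density is nonnegative; it dominates \<open>E1\<^sup>2 / 2\<close> and
  the particle flux \<open>\<integral> f * (v0 - \<sigma> * v1) dv\<close>, where \<open>v0\<close> is the relativistic energy.

  There are three consequences.

    \<^item> \<open>B\<close> is bounded: \<open>E2 + \<sigma> * B\<close> has the derivative \<open>- j2\<close> along a light line, and
      \<open>m * \<bar>v2\<bar> / v0 \<le> v0 - \<sigma> * v1\<close> makes \<open>j2\<close> integrable there (\<open>B_bound\<close>).

    \<^item> \<open>\<bar>v2\<bar>\<close> is \<open>O(sqrt D)\<close>: with a potential \<open>A\<close> such that \<open>A_x = B\<close> and \<open>A_t = - E2\<close>, the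
      canonical momentum \<open>v2 + e * A\<close> is constant on characteristics, and \<open>A\<close> differs from its
      constant value outside the cone by the integral of \<open>B\<close> over an interval of length \<open>O(D)\<close>,
      which is \<open>O(sqrt D)\<close> because \<open>B\<close> is square integrable in \<open>x\<close> (\<open>v2_bound\<close>).

    \<^item> \<open>E1\<close> is small on average near a light line. On the line itself it is square integrable in
      time, so its integral is \<open>O(sqrt t)\<close>. The difference between its values on the line and at a
      distance of at most \<open>w\<close> from it is the integral of the charge density over a window of width
      \<open>w\<close>; the number of particles in the window is interpolated between their energy and their
      flux by \<open>m \<le> l * v0 + (v0 - \<sigma> * v1) / l\<close>, so that its time integral is
      \<open>O(l * t + w / l)\<close>, that is \<open>O(sqrt (t * w))\<close> for the best \<open>l\<close> (\<open>E1_near_light_line\<close>,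
      \<open>window_potential\<close>).

  While \<open>\<sigma> * v1 \<ge> R\<close>, the bound on \<open>v2\<close> makes the deficit of the velocity to the speed of light
  \<open>O(D / R\<^sup>2) = O(sqrt D / t)\<close>, so the particle stays within \<open>w = O(sqrt D)\<close> of the light line
  through its final position. The time integral of \<open>E1\<close> along its path is then
  \<open>O(sqrt t + sqrt (t * w)) = O(R)\<close>, and that of the magnetic term is
  \<open>O(t * sqrt D / R) = O(R)\<close> (\<open>momentum_growth_along_light_line\<close>). Only the time after the last
  moment with \<open>\<sigma> * v1 \<le> R\<close> matters, whence the theorem.

  All of this rests on the method of characteristics: backward trajectories exist
  (\<open>characteristic_exists\<close>) and \<open>f\<close> is constant on them, so for bounded times \<open>f\<close> has compact
  support in \<open>(x, v)\<close>. That makes the velocity moments continuously differentiable and yields the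
  local conservation laws (\<open>moment_balance\<close>).
\<close>

section \<open>Calculus on intervals\<close>

lemma continuous_on_curried:
  assumes "continuous_on (S \<times> UNIV) (\<lambda>(s, y). F s y)"
    and "continuous_on A g" "continuous_on A h" "g ` A \<subseteq> S"
  shows "continuous_on A (\<lambda>r. F (g r) (h r))"
  using continuous_on_compose2[OF assms(1), of A "\<lambda>r. (g r, h r)"] assms(2-)
  by (simp add: continuous_on_Pair image_subset_iff)

lemma continuous_on_curried3:
  assumes "continuous_on (S \<times> UNIV) (\<lambda>(t, x, v). g t x v)"
    and "continuous_on A a" "continuous_on A b" "continuous_on A c" "a ` A \<subseteq> S"
  shows "continuous_on A (\<lambda>r. g (a r) (b r) (c r))"
  using continuous_on_compose2[OF assms(1), of A "\<lambda>r. (a r, b r, c r)"] assms(2-)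
  by (simp add: continuous_on_Pair image_subset_iff)

lemma at_within_Ici_neq_bot:
  fixes t :: real
  assumes "a \<le> t"
  shows "at t within {a..} \<noteq> bot"
proof -
  have "at_right t \<le> at t within {a..}" by (rule at_le) (use assms in auto)
  then show ?thesis by (metis bot.extremum_uniqueI trivial_limit_at_right_real)
qed

lemma real_derivative_nonneg_mono:
  fixes g :: "real \<Rightarrow> real"
  assumes "a \<le> b"
    and "\<And>s. s \<in> {a..b} \<Longrightarrow> (g has_real_derivative g' s) (at s within {a..b})"
    and "\<And>s. s \<in> {a..b} \<Longrightarrow> 0 \<le> g' s"
  shows "g a \<le> g b"
proof (cases "a = b")
  case False
  then have "a < b" using assms(1) by simp
  moreover have "(g has_derivative (\<lambda>h. g' s * h)) (at s within {a..b})" if "a \<le> s" "s \<le> b" for s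
    using assms(2)[of s] that by (simp add: has_field_derivative_def)
  ultimately obtain x where x: "x \<in> {a<..<b}" "g b - g a = g' x * (b - a)"
    using mvt_simple[of a b g "\<lambda>s h. g' s * h"] by blast
  have "0 \<le> g' x * (b - a)" using x(1) assms(3)[of x] by simp
  then show ?thesis using x(2) by simp
qed simp

text \<open>
  Bounds for integrals over time are stated in this form below: \<open>k\<close> is an antiderivative of the
  bound for \<open>h'\<close>, mostly obtained from a stream function, and the integrals are never formed.
\<close>
lemma real_derivative_comparison:
  fixes h k :: "real \<Rightarrow> real"
  assumes "a \<le> b"
    and h: "\<And>s. s \<in> {a..b} \<Longrightarrow> (h has_real_derivative h' s) (at s within {a..b})"
    and k: "\<And>s. s \<in> {a..b} \<Longrightarrow> (k has_real_derivative k' s) (at s within {a..b})"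
    and "\<And>s. s \<in> {a..b} \<Longrightarrow> \<bar>h' s\<bar> \<le> k' s"
  shows "\<bar>h b - h a\<bar> \<le> k b - k a"
proof -
  have "k a - h a \<le> k b - h b"
    by (rule real_derivative_nonneg_mono[OF assms(1) DERIV_diff[OF k h]]) (use assms(4) in \<open>auto simp: abs_le_iff\<close>)
  moreover have "k a + h a \<le> k b + h b"
    by (rule real_derivative_nonneg_mono[OF assms(1) DERIV_add[OF k h]])
      (use assms(4) in \<open>auto simp: abs_le_iff, smt\<close>)
  ultimately show ?thesis by linarith
qed

text \<open>
  The second alternative isolates the last stretch of time on which \<open>g\<close> stays above the level
  \<open>R\<close>; it starts at time \<open>0\<close> if \<open>g\<close> was never below \<open>R\<close>, whence the maximum with \<open>g 0\<close>.
\<close>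
lemma last_crossing:
  fixes g :: "real \<Rightarrow> real"
  assumes t: "t \<ge> 0" and cont: "continuous_on {0..t} g"
  obtains "g t \<le> R" | t1 where "t1 \<in> {0..t}" "g t1 \<le> max (g 0) R" "\<And>s. s \<in> {t1..t} \<Longrightarrow> R \<le> g s"
proof (cases "g t \<le> R \<or> (\<forall>s\<in>{0..t}. R \<le> g s)")
  case True
  then show thesis using that(1) that(2)[of 0] t by auto
next
  case False
  then obtain s0 where s0: "s0 \<in> {0..t}" "g s0 \<le> R" and gt: "g t > R" by force
  have "closed ({0..t} \<inter> g -` {..R})"
    by (intro continuous_closed_preimage cont) auto
  then have "compact ({0..t} \<inter> ({0..t} \<inter> g -` {..R}))"
    by (rule compact_Int_closed[OF compact_Icc])
  then have "compact ({0..t} \<inter> g -` {..R})" by simp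
  moreover have "s0 \<in> {0..t} \<inter> g -` {..R}" using s0 by simp
  ultimately obtain t1 where "t1 \<in> {0..t} \<inter> g -` {..R}" "\<forall>s\<in>{0..t} \<inter> g -` {..R}. s \<le> t1"
    using compact_attains_sup by (metis empty_iff)
  then have t1: "t1 \<in> {0..t}" "g t1 \<le> R" and last: "\<And>s. s \<in> {0..t} \<Longrightarrow> g s \<le> R \<Longrightarrow> s \<le> t1"
    by auto
  have eq: "g t1 = R"
  proof -
    have "continuous_on {t1..t} g" by (rule continuous_on_subset[OF cont]) (use t1 in auto)
    then obtain s where "t1 \<le> s" "s \<le> t" "g s = R"
      using IVT'[of g t1 R t] t1 gt by auto
    then show ?thesis using last[of s] t1 by auto
  qed
  have "R \<le> g s" if "s \<in> {t1..t}" for s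
    using last[of s] that t1 eq by force
  then show thesis using that(2)[of t1] t1 by auto
qed

section \<open>Differential equations with a Lipschitz right-hand side\<close>

text \<open>
  The Picard iterates converge on the whole interval at once: measured with the weight
  \<open>exp (2 * K * s)\<close>, the Picard map is a contraction with factor \<open>1/2\<close>.
\<close>
lemma global_picard:
  fixes F :: "real \<Rightarrow> 'a::banach \<Rightarrow> 'a"
  assumes T: "0 \<le> T"
    and cont: "continuous_on ({0..T} \<times> UNIV) (\<lambda>(s, y). F s y)"
    and lip: "\<And>s y z. s \<in> {0..T} \<Longrightarrow> norm (F s y - F s z) \<le> L * norm (y - z)"
  obtains y where "y 0 = y0"
    "\<And>s. s \<in> {0..T} \<Longrightarrow> (y has_vector_derivative F s (y s)) (at s within {0..T})"
proof -
  define K where "K = max L 1"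
  have K1: "K \<ge> 1" by (simp add: K_def)
  have lipK: "norm (F s y - F s z) \<le> K * norm (y - z)" if "s \<in> {0..T}" for s y z
    using lip[OF that, of y z] mult_right_mono[of L K "norm (y - z)"] by (simp add: K_def)
  define I where "I = (\<lambda>u s. y0 + integral {0..s} (\<lambda>r. F r (u r)))"
  define Y where "Y n = (I ^^ n) (\<lambda>_. y0)" for n
  have Y0: "Y 0 = (\<lambda>_. y0)" and YS: "Y (Suc n) = I (Y n)" for n
    by (simp_all add: Y_def)
  have contF: "continuous_on {0..T} (\<lambda>r. F r (u r))" if "continuous_on {0..T} u" for u
    using continuous_on_curried[OF cont, of "{0..T}" "\<lambda>r. r" u] that by (simp add: image_subset_iff)
  have contI: "continuous_on {0..T} (I u)" if "continuous_on {0..T} u" for u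
    unfolding I_def
    by (intro continuous_intros indefinite_integral_continuous_1 integrable_continuous_real contF that)
  have contY: "continuous_on {0..T} (Y n)" for n
    by (induction n) (auto simp: Y0 YS contI)
  have intF: "(\<lambda>r. F r (u r)) integrable_on {0..s}" if "continuous_on {0..T} u" "s \<in> {0..T}" for u s
    using integrable_continuous_real contF[OF that(1)] that(2)
    by (meson atLeastAtMost_iff atLeastatMost_subset_iff continuous_on_subset order_refl)
  have "bounded ((\<lambda>s. norm (Y 1 s - Y 0 s)) ` {0..T})"
    by (intro compact_imp_bounded compact_continuous_image continuous_intros contY) auto
  then obtain M where "\<forall>x\<in>(\<lambda>s. norm (Y 1 s - Y 0 s)) ` {0..T}. norm x \<le> M"
    unfolding bounded_iff by blast
  then have M: "\<And>s. s \<in> {0..T} \<Longrightarrow> norm (Y 1 s - Y 0 s) \<le> M"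
    by auto
  have M0: "0 \<le> M" using order_trans[OF norm_ge_zero M[of 0]] T by simp
  have step: "norm (Y (Suc n) s - Y n s) \<le> M * (1/2)^n * exp (2 * K * s)" if s: "s \<in> {0..T}" for n s
    using s
  proof (induction n arbitrary: s)
    case 0
    have "M * 1 \<le> M * exp (2 * K * s)"
      using M0 K1 0 by (intro mult_left_mono) auto
    then show ?case using M[OF 0] by simp
  next
    case (Suc n)
    let ?c = "M * (1/2)^n"
    have hi: "((\<lambda>r. K * (?c * exp (2 * K * r))) has_integral ?c * exp (2 * K * s) / 2 - ?c * exp (2 * K * 0) / 2) {0..s}"
    proof (rule fundamental_theorem_of_calculus)
      fix r
      have "((\<lambda>r. ?c * exp (2 * K * r) / 2) has_real_derivative K * (?c * exp (2 * K * r))) (at r within {0..s})"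
        by (auto intro!: derivative_eq_intros)
      then show "((\<lambda>r. ?c * exp (2 * K * r) / 2) has_vector_derivative K * (?c * exp (2 * K * r))) (at r within {0..s})"
        by (simp add: has_real_derivative_iff_has_vector_derivative)
    qed (use Suc.prems in auto)
    have "Y (Suc (Suc n)) s - Y (Suc n) s
        = integral {0..s} (\<lambda>r. F r (Y (Suc n) r) - F r (Y n r))"
      using integral_diff[OF intF[OF contY Suc.prems] intF[OF contY Suc.prems], of "Suc n" n]
      by (simp only: YS[of "Suc n"] YS[of n]) (simp add: I_def)
    also have "norm \<dots> \<le> integral {0..s} (\<lambda>r. K * (?c * exp (2 * K * r)))"
    proof (rule integral_norm_bound_integral)
      show "(\<lambda>r. F r (Y (Suc n) r) - F r (Y n r)) integrable_on {0..s}"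
        by (intro integrable_diff intF contY Suc.prems)
      show "(\<lambda>r. K * (?c * exp (2 * K * r))) integrable_on {0..s}"
        using hi by blast
      fix r assume "r \<in> {0..s}"
      then have r: "r \<in> {0..T}" using Suc.prems by auto
      have "norm (F r (Y (Suc n) r) - F r (Y n r)) \<le> K * norm (Y (Suc n) r - Y n r)"
        by (rule lipK[OF r])
      also have "\<dots> \<le> K * (?c * exp (2 * K * r))"
        using Suc.IH[OF r] K1 by (intro mult_left_mono) auto
      finally show "norm (F r (Y (Suc n) r) - F r (Y n r)) \<le> K * (?c * exp (2 * K * r))" .
    qed
    also have "\<dots> = ?c * exp (2 * K * s) / 2 - ?c * exp (2 * K * 0) / 2"
      using hi by (rule integral_unique)
    also have "\<dots> \<le> M * (1/2)^Suc n * exp (2 * K * s)"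
      using M0 by simp
    finally show ?case .
  qed
  have "uniform_limit {0..T} (\<lambda>n s. \<Sum>i<n. Y (Suc i) s - Y i s) (\<lambda>s. \<Sum>i. Y (Suc i) s - Y i s) sequentially"
  proof (rule Weierstrass_m_test)
    show "summable (\<lambda>n. (M * exp (2 * K * T)) * (1/2)^n)"
      by (intro summable_mult summable_geometric) simp
    fix n s assume s: "s \<in> {0..T}"
    have "M * (1/2)^n * exp (2 * K * s) \<le> M * (1/2)^n * exp (2 * K * T)"
      using M0 K1 s by (intro mult_left_mono) auto
    then show "norm (Y (Suc n) s - Y n s) \<le> (M * exp (2 * K * T)) * (1/2)^n"
      using step[OF s, of n] by (simp add: mult_ac)
  qed
  then have "uniform_limit {0..T} (\<lambda>n s. y0 + (Y n s - y0)) (\<lambda>s. y0 + (\<Sum>i. Y (Suc i) s - Y i s)) sequentially"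
    using sum_lessThan_telescope[of "\<lambda>i. Y i s" n for s n]
    by (intro uniform_limit_add uniform_limit_const) (simp add: Y0)
  then obtain y where y: "uniform_limit {0..T} Y y sequentially" by auto
  have conty: "continuous_on {0..T} y"
    by (rule uniform_limit_theorem[OF _ y]) (simp_all add: contY)
  have fix_y: "y s = I y s" if s: "s \<in> {0..T}" for s
  proof (rule LIMSEQ_unique)
    show "(\<lambda>n. Y (Suc n) s) \<longlonglongrightarrow> y s"
      using tendsto_uniform_limitI[OF y s] by (rule LIMSEQ_Suc)
    have "uniform_limit {0..s} (\<lambda>n r. F r (Y n r)) (\<lambda>r. F r (y r)) sequentially"
      unfolding uniform_limit_iff
    proof (intro allI impI)
      fix e :: real assume e: "e > 0"
      have "\<forall>\<^sub>F n in sequentially. \<forall>r\<in>{0..T}. dist (Y n r) (y r) < e / K"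
        using y[unfolded uniform_limit_iff, rule_format, of "e / K"] e K1 by simp
      then show "\<forall>\<^sub>F n in sequentially. \<forall>r\<in>{0..s}. dist (F r (Y n r)) (F r (y r)) < e"
      proof (eventually_elim, intro ballI)
        fix n r assume a: "\<forall>r\<in>{0..T}. dist (Y n r) (y r) < e / K" and "r \<in> {0..s}"
        then have r: "r \<in> {0..T}" using s by auto
        have "K * norm (Y n r - y r) < e"
          using a r K1 by (auto simp: dist_norm field_simps)
        then show "dist (F r (Y n r)) (F r (y r)) < e"
          using lipK[OF r, of "Y n r" "y r"] by (simp add: dist_norm)
      qed
    qed
    then obtain J j where J: "\<And>n. ((\<lambda>r. F r (Y n r)) has_integral J n) {0..s}"
      "((\<lambda>r. F r (y r)) has_integral j) {0..s}" "J \<longlonglongrightarrow> j"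
      by (rule uniform_limit_integral) (use s in \<open>auto intro!: continuous_on_subset[OF contF[OF contY]]\<close>)
    then have "(\<lambda>n. y0 + integral {0..s} (\<lambda>r. F r (Y n r))) \<longlonglongrightarrow> y0 + integral {0..s} (\<lambda>r. F r (y r))"
      using integral_unique[OF J(1)] integral_unique[OF J(2)] by (auto intro!: tendsto_intros)
    then show "(\<lambda>n. Y (Suc n) s) \<longlonglongrightarrow> I y s"
      by (simp add: YS I_def)
  qed
  show thesis
  proof
    show "y 0 = y0" using fix_y[of 0] T by (simp add: I_def)
    fix s assume s: "s \<in> {0..T}"
    have "((\<lambda>s. y0 + integral {0..s} (\<lambda>r. F r (y r))) has_vector_derivative (0 + F s (y s))) (at s within {0..T})"
      by (intro has_vector_derivative_add has_vector_derivative_const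
          integral_has_vector_derivative contF conty s)
    then have "(I y has_vector_derivative F s (y s)) (at s within {0..T})"
      by (simp add: I_def)
    then show "(y has_vector_derivative F s (y s)) (at s within {0..T})"
      by (rule has_vector_derivative_transform[OF s, rotated]) (simp add: fix_y)
  qed
qed

section \<open>Continuously differentiable functions on the half-plane\<close>

text \<open>
  The partial derivatives are parameters, so that differential equations become equations
  between functions, valid up to the boundary \<open>t = 0\<close>.
\<close>
definition C1_halfplane :: "(real \<Rightarrow> real \<Rightarrow> real) \<Rightarrow> (real \<Rightarrow> real \<Rightarrow> real) \<Rightarrow> (real \<Rightarrow> real \<Rightarrow> real) \<Rightarrow> bool" where
  "C1_halfplane u ut ux \<longleftrightarrow>
     (\<forall>t\<ge>0. \<forall>x. ((\<lambda>(t, x). u t x) has_derivative (\<lambda>(dt, dx). dt * ut t x + dx * ux t x)) (at (t, x) within {0..} \<times> UNIV)) \<and>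
     continuous_on ({0..} \<times> UNIV) (\<lambda>(t, x). ut t x) \<and> continuous_on ({0..} \<times> UNIV) (\<lambda>(t, x). ux t x)"

lemma C1_halfplane_cont:
  assumes "C1_halfplane u ut ux"
  shows "continuous_on ({0..} \<times> UNIV) (\<lambda>(t, x). u t x)"
  unfolding continuous_on_eq_continuous_within
proof (intro ballI)
  fix z :: "real \<times> real" assume "z \<in> {0..} \<times> UNIV"
  then show "continuous (at z within {0..} \<times> UNIV) (\<lambda>(t, x). u t x)"
    using assms unfolding C1_halfplane_def by (cases z) (auto intro: has_derivative_continuous)
qed

lemma C1_halfplane_along_curve:
  assumes u: "C1_halfplane u ut ux" and X: "(X has_real_derivative X') (at s within A)"
    and A: "A \<subseteq> {0..}" "s \<in> A"
  shows "((\<lambda>s. u s (X s)) has_real_derivative ut s (X s) + X' * ux s (X s)) (at s within A)"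
proof -
  have "((\<lambda>s. (s, X s)) has_derivative (\<lambda>h. (h, X' * h))) (at s within A)"
    using X unfolding has_field_derivative_def by (intro has_derivative_Pair has_derivative_ident)
  moreover have "((\<lambda>(t, x). u t x) has_derivative (\<lambda>(dt, dx). dt * ut s (X s) + dx * ux s (X s)))
      (at (s, X s) within (\<lambda>s. (s, X s)) ` A)"
    using u A unfolding C1_halfplane_def by (auto intro: has_derivative_subset)
  ultimately have "((\<lambda>s. u s (X s)) has_derivative (\<lambda>h. h * ut s (X s) + X' * h * ux s (X s))) (at s within A)"
    using has_derivative_in_compose by fastforce
  then show ?thesis
    unfolding has_field_derivative_def by (rule has_derivative_eq_rhs) (auto simp: algebra_simps)
qed

lemma C1_halfplane_diff_const:
  assumes "C1_halfplane u ut ux" and "\<And>t x. t \<ge> 0 \<Longrightarrow> w t x = u t x - c"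
  shows "C1_halfplane w ut ux"
proof -
  have "((\<lambda>(t, x). w t x) has_derivative (\<lambda>(dt, dx). dt * ut t x + dx * ux t x)) (at (t, x) within {0..} \<times> UNIV)"
    if t: "t \<ge> 0" for t x
  proof -
    have "((\<lambda>(t, x). u t x) has_derivative (\<lambda>(dt, dx). dt * ut t x + dx * ux t x)) (at (t, x) within {0..} \<times> UNIV)"
      using assms(1) t unfolding C1_halfplane_def by blast
    from has_derivative_diff[OF this has_derivative_const[of c]]
    have "((\<lambda>z. (\<lambda>(t, x). u t x) z - c) has_derivative (\<lambda>(dt, dx). dt * ut t x + dx * ux t x))
        (at (t, x) within {0..} \<times> UNIV)"
      by simp
    then show ?thesis
      by (rule has_derivative_transform[rotated 2]) (use t assms(2) in auto)
  qed
  then show ?thesis using assms(1) by (simp add: C1_halfplane_def)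
qed

lemma C1_halfplane_t:
  assumes "C1_halfplane u ut ux" "t \<ge> 0"
  shows "((\<lambda>s. u s x) has_real_derivative ut t x) (at t within {0..})"
  using C1_halfplane_along_curve[OF assms(1), of "\<lambda>_. x" 0 t "{0..}"] assms(2) by simp

lemma C1_halfplane_x:
  assumes "C1_halfplane u ut ux" "t \<ge> 0"
  shows "(u t has_real_derivative ux t x) (at x)"
proof -
  have "((\<lambda>y. (t, y)) has_derivative (\<lambda>h. (0, h))) (at x)"
    by (auto intro!: derivative_eq_intros)
  moreover have "((\<lambda>(t, x). u t x) has_derivative (\<lambda>(dt, dx). dt * ut t x + dx * ux t x))
      (at (t, x) within range (\<lambda>y. (t, y)))"
    using assms unfolding C1_halfplane_def by (auto intro: has_derivative_subset)
  ultimately have "((\<lambda>y. u t y) has_derivative (\<lambda>h. h * ux t x)) (at x)"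
    using has_derivative_in_compose by fastforce
  then show ?thesis by (simp add: has_field_derivative_def mult_commute_abs)
qed

text \<open>
  The continuity equation \<open>p_t + q_x = 0\<close> says that the form \<open>p dx - q dt\<close> is closed, and on the
  half-plane a closed form is exact. A stream function turns integrals of the density over
  space, and of the flux along any curve, into differences of its values.
\<close>
lemma stream_function:
  fixes p q pt :: "real \<Rightarrow> real \<Rightarrow> real"
  assumes cp: "continuous_on ({0..} \<times> UNIV) (\<lambda>(t, x). p t x)"
    and cq: "continuous_on ({0..} \<times> UNIV) (\<lambda>(t, x). q t x)"
    and cpt: "continuous_on ({0..} \<times> UNIV) (\<lambda>(t, x). pt t x)"
    and dp: "\<And>t x. t \<ge> 0 \<Longrightarrow> ((\<lambda>s. p s x) has_real_derivative pt t x) (at t within {0..})"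
    and dq: "\<And>t x. t \<ge> 0 \<Longrightarrow> ((\<lambda>y. q t y) has_real_derivative - pt t x) (at x)"
  obtains \<phi> where "C1_halfplane \<phi> (\<lambda>t x. - q t x) p"
proof -
  \<comment> \<open>the integral of \<open>p t\<close> from \<open>0\<close> to \<open>x\<close>, with its sign\<close>
  define J where "J t x = integral {0..x} (p t) - integral {x..0} (p t)" for t x
  define \<phi> where "\<phi> t x = J t x - integral {0..t} (\<lambda>s. q s 0)" for t x
  have cpx: "continuous_on A (p t)" if "t \<ge> 0" for t A
    using continuous_on_curried[OF cp, of A "\<lambda>_. t" "\<lambda>y. y"] that by (simp add: image_subset_iff)
  have cq0: "continuous_on A (\<lambda>s. q s 0)" if "A \<subseteq> {0..}" for A
    using continuous_on_curried[OF cq, of A "\<lambda>y. y" "\<lambda>_. 0"] that by (simp add: subset_iff)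
  have Jx: "(J t has_real_derivative p t x) (at x)" if t: "t \<ge> 0" for t x
  proof -
    define R where "R = \<bar>x\<bar> + 1"
    have eq: "J t y = integral {-R..y} (p t) - integral {-R..0} (p t)" if "y \<in> {-R<..<R}" for y
    proof (cases "y \<ge> 0")
      case True
      have "integral {-R..0} (p t) + integral {0..y} (p t) = integral {-R..y} (p t)"
        using True by (intro Henstock_Kurzweil_Integration.integral_combine integrable_continuous_real cpx t)
          (auto simp: R_def)
      then show ?thesis using True unfolding J_def by (cases "y = 0") auto
    next
      case False
      have "integral {-R..y} (p t) + integral {y..0} (p t) = integral {-R..0} (p t)"
        using False that by (intro Henstock_Kurzweil_Integration.integral_combine integrable_continuous_real cpx t) auto
      then show ?thesis using False unfolding J_def by auto
    qed
    have xin: "x \<in> {-R<..<R}" by (auto simp: R_def)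
    have "((\<lambda>y. integral {-R..y} (p t)) has_real_derivative p t x) (at x within {-R..R})"
      using xin by (intro integral_has_real_derivative cpx t) auto
    then have "((\<lambda>y. integral {-R..y} (p t)) has_real_derivative p t x) (at x)"
      using at_within_Icc_at[of "-R" x R] xin by auto
    then have "((\<lambda>y. integral {-R..y} (p t) - integral {-R..0} (p t)) has_real_derivative p t x) (at x)"
      by (auto intro!: derivative_eq_intros)
    then show ?thesis
      by (rule has_field_derivative_transform_within_open[OF _ _ xin]) (auto simp: eq)
  qed
  have FTC: "integral {a..b} (pt t) = q t a - q t b" if "t \<ge> 0" "a \<le> b" for a b t
  proof -
    have "(pt t has_integral (- q t b) - (- q t a)) {a..b}"
    proof (rule fundamental_theorem_of_calculus[OF that(2)])
      fix x assume "x \<in> {a..b}"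
      have "((\<lambda>y. - q t y) has_real_derivative pt t x) (at x)"
        using DERIV_minus[OF dq[OF that(1), of x]] by simp
      then show "((\<lambda>y. - q t y) has_vector_derivative pt t x) (at x within {a..b})"
        by (metis has_real_derivative_iff_has_vector_derivative has_vector_derivative_at_within)
    qed
    then show ?thesis by (simp add: integral_unique)
  qed
  have It: "((\<lambda>s. integral {a..b} (p s)) has_real_derivative integral {a..b} (pt t)) (at t within {0..})"
    if "t \<ge> 0" for a b t
    unfolding interval_cbox
  proof (rule leibniz_rule_field_derivative)
    show "continuous_on ({0..} \<times> cbox a b) (\<lambda>(x, t). pt x t)"
      by (rule continuous_on_subset[OF cpt]) auto
    show "p s integrable_on cbox a b" if "s \<in> {0..}" for s
      using that by (intro integrable_continuous cpx) auto
  qed (use that in \<open>auto simp: dp\<close>)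
  have Jt: "((\<lambda>s. J s x) has_real_derivative (q t 0 - q t x)) (at t within {0..})" if t: "t \<ge> 0" for t x
  proof -
    have "integral {0..x} (pt t) - integral {x..0} (pt t) = q t 0 - q t x"
    proof (cases "x \<ge> 0")
      case True
      then show ?thesis using FTC[OF t, of 0 x] by (cases "x = 0") auto
    next
      case False
      then show ?thesis using FTC[OF t, of x 0] by auto
    qed
    then show ?thesis
      unfolding J_def using DERIV_diff[OF It[OF t, of 0 x] It[OF t, of x 0]] by simp
  qed
  have Q: "((\<lambda>s. integral {0..s} (\<lambda>s. q s 0)) has_real_derivative q t 0) (at t within {0..})" if t: "t \<ge> 0" for t
  proof -
    have "((\<lambda>s. integral {0..s} (\<lambda>s. q s 0)) has_real_derivative q t 0) (at t within {0..t+1})"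
      using t by (intro integral_has_real_derivative cq0) auto
    moreover have "at t within {0..t+1} = at t within {0..}"
      by (rule at_within_nhd[of _ "{..<t+1}"]) auto
    ultimately show ?thesis by simp
  qed
  have \<phi>t: "((\<lambda>s. \<phi> s x) has_real_derivative - q t x) (at t within {0..})" if "t \<ge> 0" for t x
    using DERIV_diff[OF Jt[OF that, of x] Q[OF that]] unfolding \<phi>_def by simp
  have \<phi>x: "(\<phi> t has_real_derivative p t x) (at x)" if "t \<ge> 0" for t x
    using DERIV_diff[OF Jx[OF that, of x] DERIV_const] unfolding \<phi>_def by simp
  have "((\<lambda>(t, x). \<phi> t x) has_derivative (\<lambda>(dt, dx). dt * - q t x + dx * p t x)) (at (t, x) within {0..} \<times> UNIV)"
    if "t \<ge> 0" for t x
  proof -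
    have "((\<lambda>(x, y). \<phi> x y) has_derivative (\<lambda>(tx, ty). (- q t x) * tx + blinfun_mult_right (p t x) ty))
        (at (t, x) within {0..} \<times> UNIV)"
    proof (rule has_derivative_partialsI)
      show "((\<lambda>s. \<phi> s x) has_derivative (*) (- q t x)) (at t within {0..})"
        using \<phi>t[OF that] by (simp add: has_field_derivative_def)
      show "(\<phi> s has_derivative blinfun_mult_right (p s y)) (at y within UNIV)" if "s \<in> {0..}" for s y
        using \<phi>x[of s y] that by (auto simp: has_field_derivative_def mult_commute_abs)
      have "continuous_on ({0..} \<times> UNIV) (\<lambda>(x, y). blinfun_mult_right (p x y))"
        using cp unfolding split_beta by (intro continuous_intros)
      then show "continuous (at (t, x) within {0..} \<times> UNIV) (\<lambda>(x, y). blinfun_mult_right (p x y))"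
        using that by (auto simp: continuous_on_eq_continuous_within)
    qed auto
    then show ?thesis by (simp add: split_beta mult.commute)
  qed
  moreover have "continuous_on ({0..} \<times> UNIV) (\<lambda>(t, x). - q t x)"
    using cq unfolding split_beta by (intro continuous_intros)
  ultimately have "C1_halfplane \<phi> (\<lambda>t x. - q t x) p"
    using cp unfolding C1_halfplane_def by blast
  then show thesis by (rule that)
qed

text \<open>
  A vertical and a horizontal segment, along which the form vanishes, join a point outside the
  cone to \<open>(0, C)\<close> or to \<open>(0, - C)\<close>.
\<close>
lemma stream_function_outside_cone:
  assumes \<phi>: "C1_halfplane \<phi> (\<lambda>t x. - q t x) p"
    and zero: "\<And>t x. t \<ge> 0 \<Longrightarrow> \<bar>x\<bar> \<ge> C + t \<Longrightarrow> p t x = 0 \<and> q t x = 0"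
    and t: "t \<ge> 0"
  shows "x \<ge> C + t \<Longrightarrow> \<phi> t x = \<phi> 0 C" "x \<le> - (C + t) \<Longrightarrow> \<phi> t x = \<phi> 0 (- C)"
proof -
  have vert: "\<phi> t x = \<phi> 0 x" if "\<bar>x\<bar> \<ge> C + t"
  proof -
    have "\<bar>\<phi> t x - \<phi> 0 x\<bar> \<le> 0 - 0"
    proof (rule real_derivative_comparison[of 0 t "\<lambda>s. \<phi> s x" _ "\<lambda>_. 0" "\<lambda>_. 0"])
      show "((\<lambda>s. \<phi> s x) has_real_derivative - q s x) (at s within {0..t})" if "s \<in> {0..t}" for s
        using C1_halfplane_along_curve[OF \<phi>, of "\<lambda>_. x" 0 s "{0..t}"] that by simp
    qed (use t that zero[of _ x] in auto)
    then show ?thesis by simp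
  qed
  have horiz: "\<phi> 0 a = \<phi> 0 b" if "a \<le> b" "\<And>y. y \<in> {a..b} \<Longrightarrow> \<bar>y\<bar> \<ge> C" for a b
  proof -
    have "\<bar>\<phi> 0 b - \<phi> 0 a\<bar> \<le> 0 - 0"
    proof (rule real_derivative_comparison[of a b "\<phi> 0" "p 0" "\<lambda>_. 0" "\<lambda>_. 0"])
      show "(\<phi> 0 has_real_derivative p 0 y) (at y within {a..b})" for y
        using C1_halfplane_x[OF \<phi>] has_field_derivative_at_within by force
    qed (use that zero[of 0] in auto)
    then show ?thesis by simp
  qed
  have abs: "C \<le> y \<Longrightarrow> C \<le> \<bar>y\<bar>" "y \<le> - C \<Longrightarrow> C \<le> \<bar>y\<bar>" for y :: real by linarith+
  show "\<phi> t x = \<phi> 0 C" if "x \<ge> C + t"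
    using vert horiz[of C x] abs(1) that t by force
  show "\<phi> t x = \<phi> 0 (- C)" if "x \<le> - (C + t)"
    using vert horiz[of x "- C"] abs(2) that t by force
qed

section \<open>Integrals over velocity space\<close>

lemma abs_component_le_norm:
  fixes u :: "real \<times> real"
  shows "\<bar>fst u\<bar> \<le> norm u" "\<bar>snd u\<bar> \<le> norm u"
  using norm_fst_le[of "fst u" "snd u"] norm_snd_le[of "snd u" "fst u"] by simp_all

lemma norm_gt_if_notin_box:
  fixes v :: "real \<times> real"
  assumes "v \<notin> cbox (-P, -P) (P, P)"
  shows "norm v > P"
proof -
  obtain a b where v: "v = (a, b)" by force
  then have "\<bar>a\<bar> > P \<or> \<bar>b\<bar> > P" using assms by (auto simp: cbox_Pair_eq)
  then show ?thesis using norm_fst_le[of a b] norm_snd_le[of b a] v by auto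
qed

lemma integral_eq_box:
  fixes g :: "real \<times> real \<Rightarrow> real"
  assumes "\<And>v. norm v > P \<Longrightarrow> g v = 0"
  shows "integral UNIV g = integral (cbox (-P, -P) (P, P)) g"
proof -
  have "integral (cbox (-P, -P) (P, P)) g = integral UNIV (\<lambda>v. if v \<in> cbox (-P, -P) (P, P) then g v else 0)"
    by (rule Henstock_Kurzweil_Integration.integral_restrict_UNIV[symmetric])
  also have "(\<lambda>v. if v \<in> cbox (-P, -P) (P, P) then g v else 0) = g"
    using assms norm_gt_if_notin_box by fastforce
  finally show ?thesis by simp
qed

lemma integrable_compact_support:
  fixes g :: "real \<times> real \<Rightarrow> real"
  assumes "continuous_on UNIV g" "\<And>v. norm v > P \<Longrightarrow> g v = 0"
  shows "g integrable_on UNIV"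
proof -
  have "g integrable_on cbox (-P, -P) (P, P)"
    by (rule integrable_continuous) (rule continuous_on_subset[OF assms(1)], simp)
  then show ?thesis
    by (rule integrable_on_superset) (use assms(2) norm_gt_if_notin_box in auto)
qed

lemma continuous_on_velocity_integral:
  fixes g :: "'a::t2_space \<Rightarrow> real \<times> real \<Rightarrow> real"
  assumes cont: "continuous_on (S \<times> UNIV) (\<lambda>(z, v). g z v)"
    and supp: "\<And>z. z \<in> S \<Longrightarrow> \<exists>U P. open U \<and> z \<in> U \<and> (\<forall>y\<in>S \<inter> U. \<forall>v. norm v > P \<longrightarrow> g y v = 0)"
  shows "continuous_on S (\<lambda>z. integral UNIV (g z))"
  unfolding continuous_on_eq_continuous_within
proof (intro ballI)
  fix z assume z: "z \<in> S"
  obtain U P where U: "open U" "z \<in> U" "\<forall>y\<in>S \<inter> U. \<forall>v. norm v > P \<longrightarrow> g y v = 0"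
    using supp[OF z] by blast
  have "continuous_on (S \<inter> U) (\<lambda>z. integral (cbox (-P, -P) (P, P)) (g z))"
    by (rule integral_continuous_on_param) (rule continuous_on_subset[OF cont], auto)
  then have "continuous_on (S \<inter> U) (\<lambda>z. integral UNIV (g z))"
    by (rule continuous_on_cong[THEN iffD1, OF refl, rotated]) (use U(3) integral_eq_box in metis)
  then have "continuous (at z within S \<inter> U) (\<lambda>z. integral UNIV (g z))"
    using z U(2) by (auto simp: continuous_on_eq_continuous_within)
  moreover have "at z within S \<inter> U = at z within S"
    by (rule at_within_nhd[OF U(2,1)]) auto
  ultimately show "continuous (at z within S) (\<lambda>z. integral UNIV (g z))"
    by simp
qed

lemma velocity_integral_has_derivative:
  fixes g g' :: "real \<Rightarrow> real \<times> real \<Rightarrow> real"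
  assumes U: "z0 \<in> U" "convex U"
    and d: "\<And>z v. z \<in> U \<Longrightarrow> ((\<lambda>z. g z v) has_real_derivative g' z v) (at z within U)"
    and cont: "\<And>z. z \<in> U \<Longrightarrow> continuous_on UNIV (g z)"
    and cont': "continuous_on (U \<times> UNIV) (\<lambda>(z, v). g' z v)"
    and supp: "\<And>z v. z \<in> U \<Longrightarrow> norm v > P \<Longrightarrow> g z v = 0"
    and supp': "\<And>v. norm v > P \<Longrightarrow> g' z0 v = 0"
  shows "((\<lambda>z. integral UNIV (g z)) has_real_derivative integral UNIV (g' z0)) (at z0 within U)"
proof -
  have "((\<lambda>z. integral (cbox (-P, -P) (P, P)) (g z)) has_real_derivative
      integral (cbox (-P, -P) (P, P)) (g' z0)) (at z0 within U)"
    by (rule leibniz_rule_field_derivative[OF d _ _ U])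
      (auto intro!: integrable_continuous continuous_on_subset[OF cont] continuous_on_subset[OF cont'])
  then have "((\<lambda>z. integral (cbox (-P, -P) (P, P)) (g z)) has_real_derivative
      integral UNIV (g' z0)) (at z0 within U)"
    by (simp add: integral_eq_box[OF supp'])
  then show ?thesis
    by (rule has_field_derivative_transform_within[OF _ zero_less_one U(1)])
      (simp add: integral_eq_box[OF supp])
qed

text \<open>
  Integration by parts in the velocity has no boundary terms.
\<close>
lemma integral_partial1_zero:
  fixes u u' :: "real \<times> real \<Rightarrow> real"
  assumes d: "\<And>a b. ((\<lambda>a. u (a, b)) has_real_derivative u' (a, b)) (at a)"
    and c: "continuous_on UNIV u'"
    and supp: "\<And>v. norm v > P \<Longrightarrow> u v = 0"
  shows "(u' has_integral 0) UNIV"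
proof -
  have s: "u' (a, b) = 0" if "norm (a, b) > P" for a b
  proof -
    have "open {a. norm (a, b) > P}" by (intro open_Collect_less continuous_intros)
    from has_field_derivative_transform_within_open[OF DERIV_const[of 0] this, of a "\<lambda>a. u (a, b)"]
    have "((\<lambda>a. u (a, b)) has_real_derivative 0) (at a)"
      using that by (auto simp: supp)
    then show ?thesis using DERIV_unique[OF d] by auto
  qed
  define Q where "Q = max P 0 + 1"
  have Q: "Q > P" "Q > 0" by (auto simp: Q_def)
  have big: "u (a, b) = 0" if "\<bar>a\<bar> = Q \<or> \<bar>b\<bar> = Q" for a b
  proof (rule supp)
    show "norm (a, b) > P"
      using that Q norm_fst_le[of a b] norm_snd_le[of b a] by auto
  qed
  have i: "integral (cbox (-Q) Q) (\<lambda>a. u' (a, b)) = 0" for b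
  proof -
    have "((\<lambda>a. u' (a, b)) has_integral u (Q, b) - u (-Q, b)) {-Q..Q}"
      by (rule fundamental_theorem_of_calculus)
        (use Q d in \<open>auto simp: has_real_derivative_iff_has_vector_derivative[symmetric]
          intro: has_field_derivative_at_within\<close>)
    then show ?thesis using big[of Q b] big[of "-Q" b] Q by (simp add: integral_unique)
  qed
  have sQ: "u' v = 0" if "norm v > Q" for v
    using s[of "fst v" "snd v"] that Q(1) by auto
  have "integral UNIV u' = integral (cbox (-Q, -Q) (Q, Q)) u'"
    by (rule integral_eq_box[OF sQ])
  also have "\<dots> = integral (cbox (-Q) Q) (\<lambda>a. integral (cbox (-Q) Q) (\<lambda>b. u' (a, b)))"
    by (rule integral_prod_continuous) (rule continuous_on_subset[OF c], simp)
  also have "\<dots> = integral (cbox (-Q) Q) (\<lambda>b. integral (cbox (-Q) Q) (\<lambda>a. u' (a, b)))"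
    by (rule integral_swap_continuous) (auto intro: continuous_on_subset[OF c])
  finally have "integral UNIV u' = 0" by (simp only: i integral_0)
  then show ?thesis
    using integrable_integral[OF integrable_compact_support[OF c sQ]] by simp
qed

lemma integral_partial2_zero:
  fixes u u' :: "real \<times> real \<Rightarrow> real"
  assumes d: "\<And>a b. ((\<lambda>b. u (a, b)) has_real_derivative u' (a, b)) (at b)"
    and c: "continuous_on UNIV u'"
    and supp: "\<And>v. norm v > P \<Longrightarrow> u v = 0"
  shows "(u' has_integral 0) UNIV"
proof -
  have s: "u' (a, b) = 0" if "norm (a, b) > P" for a b
  proof -
    have "open {b. norm (a, b) > P}" by (intro open_Collect_less continuous_intros)
    from has_field_derivative_transform_within_open[OF DERIV_const[of 0] this, of b "\<lambda>b. u (a, b)"]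
    have "((\<lambda>b. u (a, b)) has_real_derivative 0) (at b)"
      using that by (auto simp: supp)
    then show ?thesis using DERIV_unique[OF d] by auto
  qed
  define Q where "Q = max P 0 + 1"
  have Q: "Q > P" "Q > 0" by (auto simp: Q_def)
  have big: "u (a, b) = 0" if "\<bar>a\<bar> = Q \<or> \<bar>b\<bar> = Q" for a b
  proof (rule supp)
    show "norm (a, b) > P"
      using that Q norm_fst_le[of a b] norm_snd_le[of b a] by auto
  qed
  have i: "integral (cbox (-Q) Q) (\<lambda>b. u' (a, b)) = 0" for a
  proof -
    have "((\<lambda>b. u' (a, b)) has_integral u (a, Q) - u (a, -Q)) {-Q..Q}"
      by (rule fundamental_theorem_of_calculus)
        (use Q d in \<open>auto simp: has_real_derivative_iff_has_vector_derivative[symmetric]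
          intro: has_field_derivative_at_within\<close>)
    then show ?thesis using big[of a Q] big[of a "-Q"] Q by (simp add: integral_unique)
  qed
  have sQ: "u' v = 0" if "norm v > Q" for v
    using s[of "fst v" "snd v"] that Q(1) by auto
  have "integral UNIV u' = integral (cbox (-Q, -Q) (Q, Q)) u'"
    by (rule integral_eq_box[OF sQ])
  also have "\<dots> = integral (cbox (-Q) Q) (\<lambda>a. integral (cbox (-Q) Q) (\<lambda>b. u' (a, b)))"
    by (rule integral_prod_continuous) (rule continuous_on_subset[OF c], simp)
  finally have "integral UNIV u' = 0" by (simp only: i integral_0)
  then show ?thesis
    using integrable_integral[OF integrable_compact_support[OF c sQ]] by simp
qed

section \<open>Relativistic kinematics\<close>

text \<open>
  The energy of a particle of mass \<open>m\<close> and momentum \<open>v\<close>, in units in which the speed of light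
  is \<open>1\<close>.
\<close>
definition v0 :: "real \<Rightarrow> real \<times> real \<Rightarrow> real" where
  "v0 m v = sqrt (m\<^sup>2 + (norm v)\<^sup>2)"

lemma v0_eq: "v0 m (a, b) = sqrt (m\<^sup>2 + a\<^sup>2 + b\<^sup>2)"
  by (simp add: v0_def norm_Pair add.assoc)

lemma vhat_eq: "fst (vhat m v) = fst v / v0 m v" "snd (vhat m v) = snd v / v0 m v"
  by (simp_all add: vhat_def v0_def divide_inverse mult.commute)

lemma v0_eq_norm: "v0 m v = norm (m, v)"
  by (simp add: v0_def norm_Pair)

lemma continuous_on_v0: "continuous_on S (v0 m)"
  unfolding v0_def by (intro continuous_intros)

lemma v0_ge: "m > 0 \<Longrightarrow> v0 m v \<ge> m"
  using norm_fst_le[of m v] by (simp add: v0_eq_norm)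

lemma v0_pos: "m > 0 \<Longrightarrow> v0 m v > 0"
  using v0_ge[of m v] by simp

lemma v0_sq: "(v0 m (a, b))\<^sup>2 = m\<^sup>2 + a\<^sup>2 + b\<^sup>2"
  by (simp add: v0_eq)

lemma abs_fst_less_v0: "m > 0 \<Longrightarrow> \<bar>a\<bar> < v0 m (a, b)"
  unfolding v0_eq by (rule real_less_rsqrt) (auto simp: add_pos_nonneg)

lemma abs_vhat_less_1:
  assumes "m > 0" shows "\<bar>fst (vhat m v)\<bar> < 1" "\<bar>snd (vhat m v)\<bar> < 1"
proof -
  obtain a b where v: "v = (a, b)" by force
  have "\<bar>b\<bar> < v0 m v"
    unfolding v v0_eq using assms by (intro real_less_rsqrt) (auto simp: add_pos_nonneg)
  then show "\<bar>fst (vhat m v)\<bar> < 1" "\<bar>snd (vhat m v)\<bar> < 1"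
    using abs_fst_less_v0[OF assms, of a b] v0_pos[OF assms, of v]
    by (simp_all add: vhat_eq v)
qed

text \<open>
  The quantity \<open>v0 - \<sigma> * v1\<close> is the weight with which a particle contributes to the energy flux
  through light lines of direction \<open>\<sigma>\<close>. Since \<open>(v0 - \<sigma> * v1) * (v0 + \<sigma> * v1) = m\<^sup>2 + v2\<^sup>2\<close>, it is
  small for particles that travel nearly along the line, but not smaller than this bound.
\<close>
lemma light_cone_momentum_ge:
  assumes "m > 0" and s: "\<bar>\<sigma>\<bar> = 1"
  shows "v0 m (a, b) - \<sigma> * a \<ge> (m\<^sup>2 + b\<^sup>2) / (2 * v0 m (a, b))"
proof -
  let ?w = "v0 m (a, b)"
  have s2: "\<sigma> * \<sigma> = 1" using s by (metis abs_mult_self_eq mult_1)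
  have "(?w - \<sigma> * a) * (?w + \<sigma> * a) = m\<^sup>2 + b\<^sup>2"
    using v0_sq[of m a b] s2 by (simp add: algebra_simps power2_eq_square)
  moreover have sa: "\<bar>\<sigma> * a\<bar> < ?w" using abs_fst_less_v0[OF assms(1), of a b] s by (simp add: abs_mult)
  then have "(?w - \<sigma> * a) * (?w + \<sigma> * a) \<le> (?w - \<sigma> * a) * (2 * ?w)"
    by (intro mult_left_mono) auto
  ultimately have "m\<^sup>2 + b\<^sup>2 \<le> (?w - \<sigma> * a) * (2 * ?w)" by simp
  then show ?thesis using v0_pos[OF assms(1), of "(a, b)"] by (subst pos_divide_le_eq) auto
qed

lemma light_cone_momentum_pos:
  assumes "m > 0" and "\<bar>\<sigma>\<bar> = 1"
  shows "v0 m (a, b) - \<sigma> * a > 0"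
  using abs_fst_less_v0[OF assms(1), of a b] assms(2) abs_le_D1[of "\<sigma> * a" "\<bar>a\<bar>"]
  by (simp add: abs_mult)

text \<open>
  The transverse current is controlled by the energy flux through light lines of either
  direction, because \<open>2 * m * \<bar>v2\<bar> \<le> m\<^sup>2 + v2\<^sup>2\<close>.
\<close>
lemma abs_vhat2_le_light_cone_momentum:
  assumes "m > 0" and "\<bar>\<sigma>\<bar> = 1"
  shows "\<bar>snd (vhat m (a, b))\<bar> \<le> (v0 m (a, b) - \<sigma> * a) / m"
proof -
  let ?w = "v0 m (a, b)"
  have w: "?w > 0" by (rule v0_pos[OF assms(1)])
  have "2 * m * \<bar>b\<bar> \<le> m\<^sup>2 + b\<^sup>2" using sum_squares_bound[of m "\<bar>b\<bar>"] by simp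
  then have "m * (\<bar>b\<bar> / ?w) \<le> (m\<^sup>2 + b\<^sup>2) / (2 * ?w)" using w by (simp add: field_simps)
  also have "\<dots> \<le> ?w - \<sigma> * a" by (rule light_cone_momentum_ge[OF assms])
  finally show ?thesis using w assms(1) by (simp add: vhat_eq field_simps)
qed

text \<open>
  The product of \<open>v0\<close> and \<open>v0 - \<sigma> * v1\<close> is at least \<open>m\<^sup>2 / 2\<close>, so by the inequality between
  arithmetic and geometric means their weighted sum is bounded below for every weight \<open>l\<close>.
\<close>
lemma one_le_energy_light_cone_momentum:
  assumes "m > 0" and "\<bar>\<sigma>\<bar> = 1" and "l > 0"
  shows "1 \<le> (l * v0 m (a, b) + (v0 m (a, b) - \<sigma> * a) / l) / m"
proof -
  let ?w = "v0 m (a, b)" and ?d = "v0 m (a, b) - \<sigma> * a"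
  have w: "?w > 0" by (rule v0_pos[OF assms(1)])
  have d: "?d > 0" by (rule light_cone_momentum_pos[OF assms(1,2)])
  have "m\<^sup>2 \<le> m\<^sup>2 + b\<^sup>2" by simp
  also have "\<dots> \<le> 2 * ?w * ?d"
    using light_cone_momentum_ge[OF assms(1,2), of b a] w by (simp add: field_simps)
  also have "\<dots> \<le> 4 * ((l * ?w) * (?d / l))" using w d assms(3) by simp
  also have "\<dots> \<le> (l * ?w + ?d / l)\<^sup>2"
    using sum_squares_bound[of "l * ?w" "?d / l"] assms(3) by (simp add: power2_sum)
  finally have "m \<le> l * ?w + ?d / l"
    by (rule power2_le_imp_le) (use w d assms(3) in simp)
  then show ?thesis using assms(1) by simp
qed

text \<open>
  The energy is the norm of the vector \<open>(m, v)\<close>, so it is Lipschitz with constant \<open>1\<close> in \<open>v\<close>.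
\<close>
lemma vhat_lipschitz:
  assumes "m > 0" shows "norm (vhat m v - vhat m w) \<le> 2 / m * norm (v - w)"
proof -
  have a: "v0 m v \<ge> m" "v0 m w \<ge> m" "v0 m v > 0" "v0 m w > 0"
    using v0_ge v0_pos assms by auto
  have diff: "\<bar>v0 m w - v0 m v\<bar> \<le> norm (v - w)"
    using norm_triangle_ineq3[of "(m, w)" "(m, v)"] by (simp add: v0_eq_norm norm_Pair norm_minus_commute)
  have wle: "norm w \<le> v0 m w" using norm_snd_le[of w m] by (simp add: v0_eq_norm)
  have "vhat m v - vhat m w = (v - w) /\<^sub>R v0 m v + ((v0 m w - v0 m v) / (v0 m v * v0 m w)) *\<^sub>R w"
    using a by (simp add: vhat_def v0_def[symmetric] algebra_simps divide_simps scaleR_left_diff_distrib[symmetric])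
      (simp add: diff_divide_distrib algebra_simps)
  also have "norm \<dots> \<le> norm ((v - w) /\<^sub>R v0 m v) + norm (((v0 m w - v0 m v) / (v0 m v * v0 m w)) *\<^sub>R w)"
    by (rule norm_triangle_ineq)
  also have "norm ((v - w) /\<^sub>R v0 m v) \<le> norm (v - w) / m"
    using frac_le[of "norm (v - w)" "norm (v - w)" m "v0 m v"] a assms by (simp add: divide_inverse mult.commute)
  also have "norm (((v0 m w - v0 m v) / (v0 m v * v0 m w)) *\<^sub>R w) = \<bar>v0 m w - v0 m v\<bar> / v0 m v * (norm w / v0 m w)"
    using a by (simp add: abs_mult)
  also have "\<dots> \<le> norm (v - w) / m * 1"
    using a assms diff wle by (intro mult_mono frac_le) auto
  finally show ?thesis by simp
qed

lemma continuous_on_vhat: "m > 0 \<Longrightarrow> continuous_on S (vhat m)"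
  unfolding vhat_def v0_def[symmetric]
  by (intro continuous_intros continuous_on_v0) (metis less_irrefl v0_pos)

lemma v0_partials:
  assumes "m > 0"
  shows "((\<lambda>a. v0 m (a, b)) has_real_derivative fst (vhat m (a, b))) (at a)"
    "((\<lambda>b. v0 m (a, b)) has_real_derivative snd (vhat m (a, b))) (at b)"
proof -
  have "0 < m\<^sup>2 + a\<^sup>2 + b\<^sup>2" using assms by (simp add: add_pos_nonneg)
  then show "((\<lambda>a. v0 m (a, b)) has_real_derivative fst (vhat m (a, b))) (at a)"
    "((\<lambda>b. v0 m (a, b)) has_real_derivative snd (vhat m (a, b))) (at b)"
    unfolding v0_eq vhat_eq by (auto intro!: derivative_eq_intros simp: v0_eq field_simps)
qed

lemma vhat_partials:
  assumes "m > 0"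
  shows "((\<lambda>a. snd (vhat m (a, b))) has_real_derivative - (a * b / v0 m (a, b) ^ 3)) (at a)"
    "((\<lambda>b. fst (vhat m (a, b))) has_real_derivative - (a * b / v0 m (a, b) ^ 3)) (at b)"
proof -
  have "v0 m (a, b) \<noteq> 0" using v0_pos[OF assms] by (metis less_irrefl)
  then show "((\<lambda>a. snd (vhat m (a, b))) has_real_derivative - (a * b / v0 m (a, b) ^ 3)) (at a)"
    "((\<lambda>b. fst (vhat m (a, b))) has_real_derivative - (a * b / v0 m (a, b) ^ 3)) (at b)"
    unfolding vhat_eq
    by (auto intro!: derivative_eq_intros v0_partials assms simp: vhat_eq power3_eq_cube power2_eq_square field_simps)
qed

text \<open>
  Large momentum in the direction \<open>\<sigma>\<close> means a velocity close to \<open>\<sigma>\<close>, with an error that is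
  quadratic in \<open>1 / R\<close>, and a small transverse velocity.
\<close>
lemma light_speed_deficit:
  assumes m: "m > 0" and s: "\<bar>\<sigma>\<bar> = 1" and R: "R > 0" "R \<le> \<sigma> * a"
  shows "1 - \<sigma> * fst (vhat m (a, b)) \<le> (m\<^sup>2 + b\<^sup>2) / (R * R)"
    "\<bar>snd (vhat m (a, b))\<bar> \<le> \<bar>b\<bar> / R"
proof -
  let ?w = "v0 m (a, b)"
  have s2: "\<sigma> * \<sigma> = 1" using s by (metis abs_mult_self_eq mult_1)
  have w: "?w > 0" by (rule v0_pos[OF m])
  have wa: "R \<le> ?w"
    using light_cone_momentum_pos[OF m s, of a b] R by simp
  have "(?w - \<sigma> * a) * (?w + \<sigma> * a) = m\<^sup>2 + b\<^sup>2"
    using v0_sq[of m a b] s2 by (simp add: algebra_simps power2_eq_square)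
  moreover have "1 - \<sigma> * fst (vhat m (a, b)) = (?w - \<sigma> * a) / ?w"
    using w by (simp add: vhat_eq diff_divide_distrib)
  then have "1 - \<sigma> * fst (vhat m (a, b)) = ((?w - \<sigma> * a) * (?w + \<sigma> * a)) / (?w * (?w + \<sigma> * a))"
    using w R by simp
  ultimately have "1 - \<sigma> * fst (vhat m (a, b)) = (m\<^sup>2 + b\<^sup>2) / (?w * (?w + \<sigma> * a))" by simp
  also have "\<dots> \<le> (m\<^sup>2 + b\<^sup>2) / (R * R)"
    using wa w R by (intro divide_left_mono mult_mono) auto
  finally show "1 - \<sigma> * fst (vhat m (a, b)) \<le> (m\<^sup>2 + b\<^sup>2) / (R * R)" .
  show "\<bar>snd (vhat m (a, b))\<bar> \<le> \<bar>b\<bar> / R"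
    using wa w R by (simp add: vhat_eq frac_le)
qed

section \<open>One species in given fields: characteristics\<close>

text \<open>
  The analogue of \<open>C1_halfplane\<close> on phase space.
\<close>
definition C1_phase :: "(real \<Rightarrow> real \<Rightarrow> real \<times> real \<Rightarrow> real) \<Rightarrow> (real \<Rightarrow> real \<Rightarrow> real \<times> real \<Rightarrow> real) \<Rightarrow>
    (real \<Rightarrow> real \<Rightarrow> real \<times> real \<Rightarrow> real) \<Rightarrow> (real \<Rightarrow> real \<Rightarrow> real \<times> real \<Rightarrow> real) \<Rightarrow>
    (real \<Rightarrow> real \<Rightarrow> real \<times> real \<Rightarrow> real) \<Rightarrow> bool" where
  "C1_phase f ft fx f1 f2 \<longleftrightarrow>
     (\<forall>t\<ge>0. \<forall>x a b. ((\<lambda>(t, x, v). f t x v) has_derivative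
        (\<lambda>(dt, dx, da, db). dt * ft t x (a, b) + dx * fx t x (a, b) + da * f1 t x (a, b) + db * f2 t x (a, b)))
        (at (t, x, a, b) within {0..} \<times> UNIV)) \<and>
     continuous_on ({0..} \<times> UNIV) (\<lambda>(t, x, v). ft t x v) \<and>
     continuous_on ({0..} \<times> UNIV) (\<lambda>(t, x, v). fx t x v) \<and>
     continuous_on ({0..} \<times> UNIV) (\<lambda>(t, x, v). f1 t x v) \<and>
     continuous_on ({0..} \<times> UNIV) (\<lambda>(t, x, v). f2 t x v)"

lemma C1_phase_derivative:
  assumes "C1_phase f ft fx f1 f2" "t \<ge> 0"
  shows "((\<lambda>(t, x, v). f t x v) has_derivative
        (\<lambda>(dt, dx, da, db). dt * ft t x (a, b) + dx * fx t x (a, b) + da * f1 t x (a, b) + db * f2 t x (a, b)))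
        (at (t, x, a, b) within {0..} \<times> UNIV)"
  using assms unfolding C1_phase_def by blast

lemma C1_phase_cont:
  assumes "C1_phase f ft fx f1 f2"
  shows "continuous_on ({0..} \<times> UNIV) (\<lambda>(t, x, v). f t x v)"
    "continuous_on ({0..} \<times> UNIV) (\<lambda>(t, x, v). ft t x v)"
    "continuous_on ({0..} \<times> UNIV) (\<lambda>(t, x, v). fx t x v)"
    "continuous_on ({0..} \<times> UNIV) (\<lambda>(t, x, v). f1 t x v)"
    "continuous_on ({0..} \<times> UNIV) (\<lambda>(t, x, v). f2 t x v)"
proof -
  show "continuous_on ({0..} \<times> UNIV) (\<lambda>(t, x, v). f t x v)"
    unfolding continuous_on_eq_continuous_within
  proof (intro ballI)
    fix z :: "real \<times> real \<times> real \<times> real" assume "z \<in> {0..} \<times> UNIV"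
    then show "continuous (at z within {0..} \<times> UNIV) (\<lambda>(t, x, v). f t x v)"
      using has_derivative_continuous[OF C1_phase_derivative[OF assms]] by (cases z) auto
  qed
qed (use assms in \<open>simp_all add: C1_phase_def\<close>)

lemma C1_phase_t:
  assumes "C1_phase f ft fx f1 f2" "t \<ge> 0"
  shows "((\<lambda>s. f s x v) has_real_derivative ft t x v) (at t within {0..})"
proof -
  obtain a b where v: "v = (a, b)" by force
  have "((\<lambda>s. (s, x, a, b)) has_derivative (\<lambda>h. (h, 0, 0, 0))) (at t within {0..})"
    by (auto intro!: derivative_eq_intros simp: zero_prod_def)
  from has_derivative_in_compose[OF this has_derivative_subset[OF C1_phase_derivative[OF assms]]]
  show ?thesis by (auto simp: v has_field_derivative_def mult_commute_abs)
qed

lemma C1_phase_x: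
  assumes "C1_phase f ft fx f1 f2" "t \<ge> 0"
  shows "((\<lambda>y. f t y v) has_real_derivative fx t x v) (at x)"
proof -
  obtain a b where v: "v = (a, b)" by force
  have "((\<lambda>y. (t, y, a, b)) has_derivative (\<lambda>h. (0, h, 0, 0))) (at x)"
    by (auto intro!: derivative_eq_intros simp: zero_prod_def)
  from has_derivative_in_compose[OF this has_derivative_subset[OF C1_phase_derivative[OF assms]]] assms(2)
  show ?thesis by (auto simp: v has_field_derivative_def mult_commute_abs)
qed

lemma C1_phase_1:
  assumes "C1_phase f ft fx f1 f2" "t \<ge> 0"
  shows "((\<lambda>a. f t x (a, b)) has_real_derivative f1 t x (a, b)) (at a)"
proof -
  have "((\<lambda>a. (t, x, a, b)) has_derivative (\<lambda>h. (0, 0, h, 0))) (at a)"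
    by (auto intro!: derivative_eq_intros simp: zero_prod_def)
  from has_derivative_in_compose[OF this has_derivative_subset[OF C1_phase_derivative[OF assms]]] assms(2)
  show ?thesis by (auto simp: has_field_derivative_def mult_commute_abs)
qed

lemma C1_phase_2:
  assumes "C1_phase f ft fx f1 f2" "t \<ge> 0"
  shows "((\<lambda>b. f t x (a, b)) has_real_derivative f2 t x (a, b)) (at b)"
proof -
  have "((\<lambda>b. (t, x, a, b)) has_derivative (\<lambda>h. (0, 0, 0, h))) (at b)"
    by (auto intro!: derivative_eq_intros simp: zero_prod_def)
  from has_derivative_in_compose[OF this has_derivative_subset[OF C1_phase_derivative[OF assms]]] assms(2)
  show ?thesis by (auto simp: has_field_derivative_def mult_commute_abs)
qed

text \<open>
  The fields are arbitrary continuously differentiable functions here: characteristics, supports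
  and the balance laws of the moments do not depend on how the fields are generated.
\<close>
locale vlasov =
  fixes e m C0 P0 :: real
    and f0 :: "real \<Rightarrow> real \<times> real \<Rightarrow> real"
    and f ft fx f1 f2 :: "real \<Rightarrow> real \<Rightarrow> real \<times> real \<Rightarrow> real"
    and E1 E2 B E1t E1x E2t E2x Bt Bx :: "real \<Rightarrow> real \<Rightarrow> real"
  assumes m_pos: "m > 0"
    and f_C1: "C1_phase f ft fx f1 f2"
    and E1_C1: "C1_halfplane E1 E1t E1x"
    and E2_C1: "C1_halfplane E2 E2t E2x"
    and B_C1: "C1_halfplane B Bt Bx"
    and vlasov_eq: "\<And>t x v. t \<ge> 0 \<Longrightarrow>
      ft t x v + fst (vhat m v) * fx t x v
        + e * (E1 t x + snd (vhat m v) * B t x) * f1 t x v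
        + e * (E2 t x - fst (vhat m v) * B t x) * f2 t x v = 0"
    and f_initial: "\<And>x v. f 0 x v = f0 x v"
    and f0_nonneg: "\<And>x v. f0 x v \<ge> 0"
    and f0_support: "\<And>x v. f0 x v \<noteq> 0 \<Longrightarrow> \<bar>x\<bar> < C0 \<and> norm v \<le> P0"
begin

lemmas f_deriv = C1_phase_derivative[OF f_C1]

lemmas f_cont = C1_phase_cont[OF f_C1]

definition force1 :: "real \<Rightarrow> real \<Rightarrow> real \<times> real \<Rightarrow> real" where
  "force1 t x v = e * (E1 t x + snd (vhat m v) * B t x)"

definition force2 :: "real \<Rightarrow> real \<Rightarrow> real \<times> real \<Rightarrow> real" where
  "force2 t x v = e * (E2 t x - fst (vhat m v) * B t x)"

definition characteristic :: "real \<Rightarrow> (real \<Rightarrow> real) \<Rightarrow> (real \<Rightarrow> real \<times> real) \<Rightarrow> bool" where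
  "characteristic T X V \<longleftrightarrow> (\<forall>s\<in>{0..T}.
     (X has_real_derivative fst (vhat m (V s))) (at s within {0..T}) \<and>
     ((\<lambda>s. fst (V s)) has_real_derivative force1 s (X s) (V s)) (at s within {0..T}) \<and>
     ((\<lambda>s. snd (V s)) has_real_derivative force2 s (X s) (V s)) (at s within {0..T}))"

lemma bounded_on_strip:
  fixes g :: "real \<Rightarrow> real \<Rightarrow> real"
  assumes "continuous_on ({0..} \<times> UNIV) (\<lambda>(t, x). g t x)"
  obtains M where "M \<ge> 0" "\<And>t x. t \<in> {0..T} \<Longrightarrow> \<bar>x\<bar> \<le> R \<Longrightarrow> \<bar>g t x\<bar> \<le> M"
proof -
  have "bounded ((\<lambda>(t, x). g t x) ` ({0..T} \<times> {-R..R}))"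
    by (intro compact_imp_bounded compact_continuous_image continuous_on_subset[OF assms] compact_Times) auto
  then obtain M where "\<forall>z\<in>(\<lambda>(t, x). g t x) ` ({0..T} \<times> {-R..R}). norm z \<le> M"
    unfolding bounded_iff by blast
  note M = bspec[OF this]
  show thesis
  proof
    fix t x assume "t \<in> {0..T}" "\<bar>x\<bar> \<le> R"
    then have "(t, x) \<in> {0..T} \<times> {-R..R}" by auto
    from M[OF imageI[OF this]] show "\<bar>g t x\<bar> \<le> max M 0" by simp
  qed simp
qed

text \<open>
  Truncating the position outside the part of space that is reachable makes the characteristic
  vector field globally Lipschitz without changing it along the trajectory.
\<close>
lemma truncated_field_lipschitz:
  fixes g gt gx :: "real \<Rightarrow> real \<Rightarrow> real"
  assumes g: "C1_halfplane g gt gx" and R: "R \<ge> 0"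
  obtains L where "L \<ge> 0" "\<And>t x y. t \<in> {0..T} \<Longrightarrow>
    \<bar>g t (max (-R) (min R x)) - g t (max (-R) (min R y))\<bar> \<le> L * \<bar>x - y\<bar>"
proof -
  obtain L where L: "L \<ge> 0" "\<And>t x. t \<in> {0..T} \<Longrightarrow> \<bar>x\<bar> \<le> R \<Longrightarrow> \<bar>gx t x\<bar> \<le> L"
    using bounded_on_strip[of gx T R] g unfolding C1_halfplane_def by metis
  show thesis
  proof
    fix t x y assume t: "t \<in> {0..T}"
    let ?x = "max (-R) (min R x)" and ?y = "max (-R) (min R y)"
    have "norm (g t ?x - g t ?y) \<le> L * norm (?x - ?y)"
    proof (rule field_differentiable_bound[of "{-R..R}"])
      show "(g t has_field_derivative gx t z) (at z within {-R..R})" if "z \<in> {-R..R}" for z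
        using C1_halfplane_x[OF g, of t z] t by (auto intro: has_field_derivative_at_within)
      show "norm (gx t z) \<le> L" if "z \<in> {-R..R}" for z
        using L(2)[OF t, of z] that by auto
    qed (use R in auto)
    also have "\<dots> \<le> L * \<bar>x - y\<bar>" by (rule mult_left_mono[OF _ L(1)]) auto
    finally show "\<bar>g t ?x - g t ?y\<bar> \<le> L * \<bar>x - y\<bar>" by simp
  qed (rule L(1))
qed

text \<open>
  The position can move by at most \<open>T\<close> in the time \<open>T\<close>, so a truncation of the fields at
  \<open>R = \<bar>x\<bar> + T\<close> is not felt. The characteristic is solved for backward from its end point.
\<close>
lemma characteristic_exists:
  assumes T: "T \<ge> 0"
  obtains X V where "characteristic T X V" "X T = x" "V T = v"
proof -
  define R where "R = \<bar>x\<bar> + T"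
  have R: "R \<ge> 0" using T by (simp add: R_def)
  define cl where "cl y = max (-R) (min R y)" for y
  have cl: "\<bar>cl y\<bar> \<le> R" for y using R by (auto simp: cl_def)
  define G1 where "G1 s y w = e * (E1 s (cl y) + snd (vhat m w) * B s (cl y))" for s y w
  define G2 where "G2 s y w = e * (E2 s (cl y) - fst (vhat m w) * B s (cl y))" for s y w
  \<comment> \<open>the field of the system reversed in time, \<open>r = T - s\<close>\<close>
  define F where "F r z = - (case z of (y, w) \<Rightarrow>
      (fst (vhat m w), G1 (T - r) y w, G2 (T - r) y w))" for r and z :: "real \<times> real \<times> real"
  obtain LE1 where LE1: "LE1 \<ge> 0" "\<And>t x y. t \<in> {0..T} \<Longrightarrow> \<bar>E1 t (cl x) - E1 t (cl y)\<bar> \<le> LE1 * \<bar>x - y\<bar>"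
    using truncated_field_lipschitz[OF E1_C1 R, of T] unfolding cl_def by metis
  obtain LE2 where LE2: "LE2 \<ge> 0" "\<And>t x y. t \<in> {0..T} \<Longrightarrow> \<bar>E2 t (cl x) - E2 t (cl y)\<bar> \<le> LE2 * \<bar>x - y\<bar>"
    using truncated_field_lipschitz[OF E2_C1 R, of T] unfolding cl_def by metis
  obtain LB where LB: "LB \<ge> 0" "\<And>t x y. t \<in> {0..T} \<Longrightarrow> \<bar>B t (cl x) - B t (cl y)\<bar> \<le> LB * \<bar>x - y\<bar>"
    using truncated_field_lipschitz[OF B_C1 R, of T] unfolding cl_def by metis
  obtain MB where MB: "MB \<ge> 0" "\<And>t x. t \<in> {0..T} \<Longrightarrow> \<bar>B t (cl x)\<bar> \<le> MB"
    using bounded_on_strip[OF C1_halfplane_cont[OF B_C1], of T R] cl by metis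
  define Lv where "Lv = 2 / m"
  have Lv: "Lv \<ge> 0" using m_pos by (simp add: Lv_def)
  have vl: "\<bar>fst (vhat m w) - fst (vhat m w')\<bar> \<le> Lv * norm (w - w')"
    "\<bar>snd (vhat m w) - snd (vhat m w')\<bar> \<le> Lv * norm (w - w')" for w w'
    using vhat_lipschitz[OF m_pos, of w w'] abs_component_le_norm[of "vhat m w - vhat m w'"]
    by (simp_all add: Lv_def)
  have prod: "\<bar>a * b - a' * b'\<bar> \<le> LB * p + Lv * q * MB"
    if "\<bar>b - b'\<bar> \<le> LB * p" "\<bar>a - a'\<bar> \<le> Lv * q" "\<bar>a\<bar> \<le> 1" "\<bar>b'\<bar> \<le> MB" "q \<ge> 0" for a b a' b' p q :: real
  proof -
    have "a * b - a' * b' = a * (b - b') + (a - a') * b'" by (simp add: algebra_simps)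
    also have "\<bar>\<dots>\<bar> \<le> \<bar>a\<bar> * \<bar>b - b'\<bar> + \<bar>a - a'\<bar> * \<bar>b'\<bar>" by (metis abs_mult abs_triangle_ineq)
    also have "\<dots> \<le> 1 * (LB * p) + (Lv * q) * MB"
      using that Lv by (intro add_mono mult_mono) auto
    finally show ?thesis by simp
  qed
  define L where "L = Lv + \<bar>e\<bar> * (LE1 + LB + Lv * MB) + \<bar>e\<bar> * (LE2 + LB + Lv * MB)"
  have v1: "\<bar>fst (vhat m w)\<bar> \<le> 1" "\<bar>snd (vhat m w)\<bar> \<le> 1" for w
    using abs_vhat_less_1[OF m_pos, of w] by auto
  have lip: "norm (F r z - F r z') \<le> L * norm (z - z')" if r: "r \<in> {0..T}" for r z z'
  proof -
    obtain y w y' w' where z: "z = (y, w)" "z' = (y', w')" by (metis surj_pair)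
    let ?n = "norm (z - z')"
    have ny: "\<bar>y - y'\<bar> \<le> ?n" and nw: "norm (w - w') \<le> ?n"
      using norm_fst_le[of "y - y'" "w - w'"] norm_snd_le[of "w - w'" "y - y'"] by (auto simp: z)
    have s: "T - r \<in> {0..T}" using r by auto
    have mono: "c * a \<le> c * ?n" if "c \<ge> 0" "a \<le> ?n" for c a using that by (rule mult_left_mono[rotated])
    have d0: "\<bar>fst (vhat m w) - fst (vhat m w')\<bar> \<le> Lv * ?n"
      using vl(1)[of w w'] mono[OF Lv nw] by linarith
    have dB2: "\<bar>snd (vhat m w) * B (T - r) (cl y) - snd (vhat m w') * B (T - r) (cl y')\<bar> \<le> LB * ?n + Lv * ?n * MB"
      using prod[OF LB(2)[OF s, of y y'] vl(2)[of w w'] v1(2) MB(2)[OF s, of y']] mono[OF LB(1) ny]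
        mult_right_mono[OF mono[OF Lv nw] MB(1)] by simp
    have dB1: "\<bar>fst (vhat m w) * B (T - r) (cl y) - fst (vhat m w') * B (T - r) (cl y')\<bar> \<le> LB * ?n + Lv * ?n * MB"
      using prod[OF LB(2)[OF s, of y y'] vl(1)[of w w'] v1(1) MB(2)[OF s, of y']] mono[OF LB(1) ny]
        mult_right_mono[OF mono[OF Lv nw] MB(1)] by simp
    have "\<bar>G1 (T - r) y w - G1 (T - r) y' w'\<bar> = \<bar>e\<bar> * \<bar>(E1 (T - r) (cl y) - E1 (T - r) (cl y')) +
       (snd (vhat m w) * B (T - r) (cl y) - snd (vhat m w') * B (T - r) (cl y'))\<bar>"
      by (simp add: G1_def abs_mult[symmetric] algebra_simps)
    also have "\<dots> \<le> \<bar>e\<bar> * (LE1 * ?n + (LB * ?n + Lv * ?n * MB))"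
      using LE1(2)[OF s, of y y'] mono[OF LE1(1) ny] dB2 by (intro mult_left_mono) linarith+
    finally have d1: "\<bar>G1 (T - r) y w - G1 (T - r) y' w'\<bar> \<le> \<bar>e\<bar> * (LE1 + LB + Lv * MB) * ?n"
      by (simp add: algebra_simps)
    have "\<bar>G2 (T - r) y w - G2 (T - r) y' w'\<bar> = \<bar>e\<bar> * \<bar>(E2 (T - r) (cl y) - E2 (T - r) (cl y')) -
       (fst (vhat m w) * B (T - r) (cl y) - fst (vhat m w') * B (T - r) (cl y'))\<bar>"
      by (simp add: G2_def abs_mult[symmetric] algebra_simps)
    also have "\<dots> \<le> \<bar>e\<bar> * (LE2 * ?n + (LB * ?n + Lv * ?n * MB))"
      using LE2(2)[OF s, of y y'] mono[OF LE2(1) ny] dB1 by (intro mult_left_mono) linarith+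
    finally have d2: "\<bar>G2 (T - r) y w - G2 (T - r) y' w'\<bar> \<le> \<bar>e\<bar> * (LE2 + LB + Lv * MB) * ?n"
      by (simp add: algebra_simps)
    have n3: "norm (a, b, c) \<le> \<bar>a\<bar> + \<bar>b\<bar> + \<bar>c\<bar>" for a b c :: real
      using norm_Pair_le[of a "(b, c)"] norm_Pair_le[of b c] by simp
    have "F r z - F r z' = (- (fst (vhat m w) - fst (vhat m w')), - (G1 (T - r) y w - G1 (T - r) y' w'),
        - (G2 (T - r) y w - G2 (T - r) y' w'))"
      by (simp add: F_def z)
    then have "norm (F r z - F r z') \<le> \<bar>fst (vhat m w) - fst (vhat m w')\<bar> + \<bar>G1 (T - r) y w - G1 (T - r) y' w'\<bar>
       + \<bar>G2 (T - r) y w - G2 (T - r) y' w'\<bar>"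
      using n3 by (metis abs_minus_cancel)
    also have "\<dots> \<le> L * ?n" using d0 d1 d2 unfolding L_def by (simp add: distrib_right)
    finally show ?thesis .
  qed
  have contF: "continuous_on ({0..T} \<times> UNIV) (\<lambda>(r, z). F r z)"
  proof -
    have clc: "continuous_on A (\<lambda>p. cl (fst (snd p)))" for A :: "(real \<times> real \<times> real \<times> real) set"
      unfolding cl_def by (intro continuous_intros)
    have g: "continuous_on ({0..T} \<times> (UNIV :: (real \<times> real \<times> real) set)) (\<lambda>p. g (T - fst p) (cl (fst (snd p))))"
      if "continuous_on ({0..} \<times> UNIV) (\<lambda>(t, x). g t x)" for g :: "real \<Rightarrow> real \<Rightarrow> real"
      by (rule continuous_on_curried[OF that _ clc]) (auto intro!: continuous_intros)
    have vh: "continuous_on ({0..T} \<times> (UNIV :: (real \<times> real \<times> real) set)) (\<lambda>p. vhat m (snd (snd p)))"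
      by (rule continuous_on_compose2[OF continuous_on_vhat[OF m_pos, of UNIV]]) (auto intro!: continuous_intros)
    show ?thesis
      unfolding F_def G1_def G2_def split_beta
      by (intro continuous_intros g C1_halfplane_cont[OF E1_C1] C1_halfplane_cont[OF E2_C1] C1_halfplane_cont[OF B_C1] vh)
  qed
  obtain z where z: "z 0 = (x, v)"
    "\<And>r. r \<in> {0..T} \<Longrightarrow> (z has_vector_derivative F r (z r)) (at r within {0..T})"
    using global_picard[OF T contF lip, of "(x, v)"] by blast
  define X where "X s = fst (z (T - s))" for s
  define V where "V s = snd (z (T - s))" for s
  have dz: "((\<lambda>s. z (T - s)) has_vector_derivative - F (T - s) (z (T - s))) (at s within {0..T})"
    if s: "s \<in> {0..T}" for s
  proof -
    have "((\<lambda>s. T - s) has_vector_derivative -1) (at s within {0..T})"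
      by (auto intro!: derivative_eq_intros)
    moreover have "(z has_vector_derivative F (T - s) (z (T - s))) (at (T - s) within (\<lambda>s. T - s) ` {0..T})"
    proof -
      have "(\<lambda>s. T - s) ` {0..T} = {0..T}" by (auto simp: image_iff intro!: bexI[of _ "T - _"])
      then show ?thesis using z(2)[of "T - s"] s by simp
    qed
    ultimately show ?thesis
      using vector_diff_chain_within[of "\<lambda>s. T - s" "-1" s "{0..T}" z] by (simp add: o_def)
  qed
  have dX: "(X has_real_derivative fst (vhat m (V s))) (at s within {0..T})"
    and dV1: "((\<lambda>s. fst (V s)) has_real_derivative G1 s (X s) (V s)) (at s within {0..T})"
    and dV2: "((\<lambda>s. snd (V s)) has_real_derivative G2 s (X s) (V s)) (at s within {0..T})"
    if s: "s \<in> {0..T}" for s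
  proof -
    have F: "- F (T - s) (z (T - s)) = (fst (vhat m (V s)), G1 s (X s) (V s), G2 s (X s) (V s))"
      by (simp add: F_def X_def V_def split_beta)
    note bl = bounded_linear.has_vector_derivative[OF _ dz[OF s, unfolded F]]
    show "(X has_real_derivative fst (vhat m (V s))) (at s within {0..T})"
      using bl[OF bounded_linear_fst] by (simp add: X_def[abs_def] has_real_derivative_iff_has_vector_derivative)
    show "((\<lambda>s. fst (V s)) has_real_derivative G1 s (X s) (V s)) (at s within {0..T})"
      using bl[OF bounded_linear_compose[OF bounded_linear_fst bounded_linear_snd]]
      by (simp add: V_def has_real_derivative_iff_has_vector_derivative)
    show "((\<lambda>s. snd (V s)) has_real_derivative G2 s (X s) (V s)) (at s within {0..T})"
      using bl[OF bounded_linear_compose[OF bounded_linear_snd bounded_linear_snd]]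
      by (simp add: V_def has_real_derivative_iff_has_vector_derivative)
  qed
  have XT: "X T = x" "V T = v" by (simp_all add: X_def V_def z(1))
  have X_in: "\<bar>X s\<bar> \<le> R" if s: "s \<in> {0..T}" for s
  proof -
    have "\<bar>X T - X s\<bar> \<le> T - s"
    proof (rule real_derivative_comparison[of s T X _ "\<lambda>s. s" "\<lambda>_. 1"])
      show "(X has_real_derivative fst (vhat m (V r))) (at r within {s..T})" if "r \<in> {s..T}" for r
        by (rule has_field_derivative_subset[OF dX]) (use that s in auto)
    qed (use s v1 in \<open>auto intro: derivative_eq_intros\<close>)
    then show ?thesis using s XT by (auto simp: R_def)
  qed
  have clX: "cl (X s) = X s" if "s \<in> {0..T}" for s
    using X_in[OF that] by (auto simp: cl_def)
  have "characteristic T X V"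
    unfolding characteristic_def force1_def force2_def
    using dX dV1 dV2 unfolding G1_def G2_def by (auto simp: clX)
  with XT show thesis by (rule that[rotated 1])
qed

lemma constant_along_characteristic:
  assumes "characteristic T X V" "s \<in> {0..T}"
  shows "f s (X s) (V s) = f 0 (X 0) (V 0)"
proof -
  have "((\<lambda>s. f s (X s) (V s)) has_derivative (\<lambda>_. 0)) (at r within {0..T})" if r: "r \<in> {0..T}" for r
  proof -
    let ?V1 = "\<lambda>s. fst (V s)" and ?V2 = "\<lambda>s. snd (V s)"
    have "((\<lambda>s. (s, X s, ?V1 s, ?V2 s)) has_derivative
      (\<lambda>h. (h, fst (vhat m (V r)) * h, force1 r (X r) (V r) * h, force2 r (X r) (V r) * h))) (at r within {0..T})"
      using assms(1) r unfolding characteristic_def has_field_derivative_def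
      by (intro has_derivative_Pair has_derivative_ident) auto
    moreover have "((\<lambda>(t, x, v). f t x v) has_derivative
        (\<lambda>(dt, dx, da, db). dt * ft r (X r) (V r) + dx * fx r (X r) (V r) + da * f1 r (X r) (V r) + db * f2 r (X r) (V r)))
      (at (r, X r, ?V1 r, ?V2 r) within (\<lambda>s. (s, X s, ?V1 s, ?V2 s)) ` {0..T})"
      using f_deriv[of r "X r" "?V1 r" "?V2 r"] r
      by (auto intro: has_derivative_subset)
    ultimately have "((\<lambda>s. f s (X s) (V s)) has_derivative
        (\<lambda>h. h * ft r (X r) (V r) + fst (vhat m (V r)) * h * fx r (X r) (V r)
          + force1 r (X r) (V r) * h * f1 r (X r) (V r) + force2 r (X r) (V r) * h * f2 r (X r) (V r))) (at r within {0..T})"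
      using has_derivative_in_compose by (fastforce simp: o_def)
    moreover have "h * ft r (X r) (V r) + fst (vhat m (V r)) * h * fx r (X r) (V r)
          + force1 r (X r) (V r) * h * f1 r (X r) (V r) + force2 r (X r) (V r) * h * f2 r (X r) (V r) = 0" for h
    proof -
      have "h * ft r (X r) (V r) + fst (vhat m (V r)) * h * fx r (X r) (V r)
          + force1 r (X r) (V r) * h * f1 r (X r) (V r) + force2 r (X r) (V r) * h * f2 r (X r) (V r)
        = h * (ft r (X r) (V r) + fst (vhat m (V r)) * fx r (X r) (V r)
          + force1 r (X r) (V r) * f1 r (X r) (V r) + force2 r (X r) (V r) * f2 r (X r) (V r))"
        by (simp add: algebra_simps)
      then show ?thesis using vlasov_eq[of r "X r" "V r"] r by (simp add: force1_def force2_def)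
    qed
    ultimately show ?thesis by simp
  qed
  then obtain c where "\<And>s. s \<in> {0..T} \<Longrightarrow> f s (X s) (V s) = c"
    using has_derivative_zero_constant[of "{0..T}" "\<lambda>s. f s (X s) (V s)"] by auto
  then show ?thesis using assms(2) by auto
qed

section \<open>One species in given fields: velocity moments\<close>

lemma characteristic_subinterval:
  assumes "characteristic T X V" "t \<in> {0..T}"
  shows "characteristic t X V"
  using assms unfolding characteristic_def
  by (auto intro: has_field_derivative_subset[where t = "{0..t}" and s = "{0..T}"])

lemma characteristic_speed:
  assumes "characteristic T X V" "0 \<le> s" "s \<le> r" "r \<le> T"
  shows "\<bar>X r - X s\<bar> \<le> r - s"
proof (rule real_derivative_comparison[of s r X _ "\<lambda>s. s" "\<lambda>_. 1"])
  show "(X has_real_derivative fst (vhat m (V q))) (at q within {s..r})" if "q \<in> {s..r}" for q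
    using assms that unfolding characteristic_def
    by (auto intro: has_field_derivative_subset[where s = "{0..T}"])
  show "\<bar>fst (vhat m (V q))\<bar> \<le> 1" for q
    using abs_vhat_less_1[OF m_pos, of "V q"] by simp
qed (use assms(3) in \<open>auto intro: derivative_eq_intros\<close>)

lemma f_nonneg: "t \<ge> 0 \<Longrightarrow> f t x v \<ge> 0"
proof -
  assume t: "t \<ge> 0"
  obtain X V where "characteristic t X V" "X t = x" "V t = v"
    using characteristic_exists[OF t] by metis
  then show ?thesis
    using constant_along_characteristic[of t X V t] t f0_nonneg by (simp add: f_initial)
qed

lemma backward_characteristic:
  assumes "t \<ge> 0" "f t x v \<noteq> 0"
  obtains X V where "characteristic t X V" "X t = x" "V t = v" "\<bar>X 0\<bar> < C0" "norm (V 0) \<le> P0"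
proof -
  obtain X V where XV: "characteristic t X V" "X t = x" "V t = v"
    using characteristic_exists[OF assms(1)] by metis
  then have "f0 (X 0) (V 0) \<noteq> 0"
    using constant_along_characteristic[of t X V t] assms by (simp add: f_initial)
  then show thesis using f0_support that XV by blast
qed

lemma f_space_support:
  assumes "t \<ge> 0" "\<bar>x\<bar> \<ge> C0 + t"
  shows "f t x v = 0"
proof (rule ccontr)
  assume "f t x v \<noteq> 0"
  then obtain X V where "characteristic t X V" "X t = x" "\<bar>X 0\<bar> < C0"
    using backward_characteristic[OF assms(1)] by metis
  then show False using characteristic_speed[of t X V 0 t] assms by auto
qed

text \<open>
  Trajectories that start in the support of the initial datum stay in a bounded part of space up to the
  time \<open>T\<close>, where the fields are bounded, so the momentum grows at most linearly there. The bound
  depends on the solution; it only serves to make the moments finite and differentiable.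
\<close>
lemma f_velocity_support:
  obtains P where "\<And>t x v. t \<in> {0..T} \<Longrightarrow> norm v > P \<Longrightarrow> f t x v = 0"
proof -
  define R where "R = C0 + T"
  obtain M1 where M1: "M1 \<ge> 0" "\<And>t x. t \<in> {0..T} \<Longrightarrow> \<bar>x\<bar> \<le> R \<Longrightarrow> \<bar>E1 t x\<bar> \<le> M1"
    using bounded_on_strip[OF C1_halfplane_cont[OF E1_C1], of T R] by metis
  obtain M2 where M2: "M2 \<ge> 0" "\<And>t x. t \<in> {0..T} \<Longrightarrow> \<bar>x\<bar> \<le> R \<Longrightarrow> \<bar>E2 t x\<bar> \<le> M2"
    using bounded_on_strip[OF C1_halfplane_cont[OF E2_C1], of T R] by metis
  obtain MB where MB: "MB \<ge> 0" "\<And>t x. t \<in> {0..T} \<Longrightarrow> \<bar>x\<bar> \<le> R \<Longrightarrow> \<bar>B t x\<bar> \<le> MB"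
    using bounded_on_strip[OF C1_halfplane_cont[OF B_C1], of T R] by metis
  define K where "K = \<bar>e\<bar> * (M1 + M2 + MB)"
  show thesis
  proof
    fix t x and v :: "real \<times> real" assume t: "t \<in> {0..T}" and v: "norm v > 2 * P0 + 2 * K * T"
    show "f t x v = 0"
    proof (rule ccontr)
      assume "f t x v \<noteq> 0"
      then obtain X V where c: "characteristic t X V" and XV: "X t = x" "V t = v" "\<bar>X 0\<bar> < C0" "norm (V 0) \<le> P0"
        using backward_characteristic[of t x v] t by auto
      have XR: "\<bar>X s\<bar> \<le> R" if "s \<in> {0..t}" for s
        using characteristic_speed[OF c, of 0 s] that t XV(3) by (auto simp: R_def)
      have vB: "\<bar>a * B s (X s)\<bar> \<le> MB" if "s \<in> {0..t}" "\<bar>a\<bar> < 1" for s a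
      proof -
        have "\<bar>a * B s (X s)\<bar> \<le> 1 * MB"
          unfolding abs_mult using MB that XR[OF that(1)] t by (intro mult_mono) auto
        then show ?thesis by simp
      qed
      have F: "\<bar>force1 s (X s) (V s)\<bar> \<le> K" "\<bar>force2 s (X s) (V s)\<bar> \<le> K" if s: "s \<in> {0..t}" for s
      proof -
        have E: "\<bar>E1 s (X s)\<bar> \<le> M1" "\<bar>E2 s (X s)\<bar> \<le> M2" using M1 M2 s t XR[OF s] by auto
        have "\<bar>E1 s (X s) + snd (vhat m (V s)) * B s (X s)\<bar> \<le> M1 + M2 + MB"
          using E vB[OF s abs_vhat_less_1(2)[OF m_pos], of "V s"] M2(1) by linarith
        then show "\<bar>force1 s (X s) (V s)\<bar> \<le> K"
          unfolding force1_def K_def abs_mult by (rule mult_left_mono) simp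
        have "\<bar>E2 s (X s) - fst (vhat m (V s)) * B s (X s)\<bar> \<le> M1 + M2 + MB"
          using E vB[OF s abs_vhat_less_1(1)[OF m_pos], of "V s"] M1(1) by linarith
        then show "\<bar>force2 s (X s) (V s)\<bar> \<le> K"
          unfolding force2_def K_def abs_mult by (rule mult_left_mono) simp
      qed
      have lin: "((\<lambda>s. K * s) has_real_derivative K) (at s within {0..t})" for s
        by (auto intro!: derivative_eq_intros)
      have "\<bar>fst (V t) - fst (V 0)\<bar> \<le> K * t - K * 0"
        by (rule real_derivative_comparison[of 0 t "\<lambda>s. fst (V s)" _ "\<lambda>s. K * s", OF _ _ lin F(1)])
          (use c t in \<open>auto simp: characteristic_def\<close>)
      moreover have "\<bar>snd (V t) - snd (V 0)\<bar> \<le> K * t - K * 0"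
        by (rule real_derivative_comparison[of 0 t "\<lambda>s. snd (V s)" _ "\<lambda>s. K * s", OF _ _ lin F(2)])
          (use c t in \<open>auto simp: characteristic_def\<close>)
      moreover have "K * t \<le> K * T"
        using t M1(1) M2(1) MB(1) by (intro mult_left_mono) (auto simp: K_def)
      moreover have "norm v \<le> \<bar>fst v\<bar> + \<bar>snd v\<bar>"
        using norm_Pair_le[of "fst v" "snd v"] by simp
      ultimately show False
        using v XV abs_component_le_norm[of "V 0"] by simp
    qed
  qed
qed

lemma velocity_support:
  obtains P where "\<And>t x v. t \<in> {0..T} \<Longrightarrow> norm v > P \<Longrightarrow> f t x v = 0 \<and> ft t x v = 0 \<and> fx t x v = 0"
proof -
  \<comment> \<open>at \<open>t = T\<close> the time derivative involves later times\<close>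
  obtain P where P: "\<And>t x v. t \<in> {0..T+1} \<Longrightarrow> norm v > P \<Longrightarrow> f t x v = 0"
    using f_velocity_support[of "T + 1"] by metis
  show thesis
  proof (rule that[of P], intro conjI)
    fix t x and v :: "real \<times> real" assume t: "t \<in> {0..T}" and v: "norm v > P"
    have Pv: "f s y v = 0" if "s \<in> {0..T+1}" for s y using P that v by blast
    show "f t x v = 0" using Pv t by auto
    have "((\<lambda>s. f s x v) has_real_derivative 0) (at t within {0..})"
      by (rule has_field_derivative_transform_within[OF DERIV_const, of 1 _ _ 0])
        (use t in \<open>auto simp: dist_real_def intro!: Pv\<close>)
    then show "ft t x v = 0"
      using has_field_derivative_unique[OF C1_phase_t[OF f_C1]] at_within_Ici_neq_bot[of 0 t] t by auto
    have "(\<lambda>y. f t y v) = (\<lambda>_. 0)" using t Pv by auto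
    then show "fx t x v = 0"
      using DERIV_unique[OF C1_phase_x[OF f_C1, of t v x]] t by auto
  qed
qed

definition moment :: "(real \<times> real \<Rightarrow> real) \<Rightarrow> real \<Rightarrow> real \<Rightarrow> real" where
  "moment w t x = integral UNIV (\<lambda>v. f t x v * w v)"

definition moment_t :: "(real \<times> real \<Rightarrow> real) \<Rightarrow> real \<Rightarrow> real \<Rightarrow> real" where
  "moment_t w t x = integral UNIV (\<lambda>v. ft t x v * w v)"

definition moment_x :: "(real \<times> real \<Rightarrow> real) \<Rightarrow> real \<Rightarrow> real \<Rightarrow> real" where
  "moment_x w t x = integral UNIV (\<lambda>v. fx t x v * w v)"

lemma continuous_on_moment_aux:
  fixes g :: "real \<Rightarrow> real \<Rightarrow> real \<times> real \<Rightarrow> real"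
  assumes g: "continuous_on ({0..} \<times> UNIV) (\<lambda>(t, x, v). g t x v)"
    and w: "continuous_on UNIV w"
    and supp: "\<And>T. \<exists>P. \<forall>t\<in>{0..T}. \<forall>x v. norm v > P \<longrightarrow> g t x v = 0"
  shows "continuous_on ({0..} \<times> UNIV) (\<lambda>(t, x). integral UNIV (\<lambda>v. g t x v * w v))"
proof -
  have "continuous_on ({0..} \<times> UNIV) (\<lambda>z. integral UNIV (\<lambda>v. g (fst z) (snd z) v * w v))"
  proof (rule continuous_on_velocity_integral)
    show "continuous_on (({0..} \<times> UNIV) \<times> UNIV) (\<lambda>(z, v). g (fst z) (snd z) v * w v)"
      unfolding split_beta
      by (intro continuous_on_mult continuous_on_curried3[OF g] continuous_on_compose2[OF w])
        (auto intro!: continuous_intros)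
    fix z :: "real \<times> real" assume "z \<in> {0..} \<times> UNIV"
    obtain P where P: "\<forall>t\<in>{0..fst z + 1}. \<forall>x v. norm v > P \<longrightarrow> g t x v = 0"
      using supp by blast
    have "open {y :: real \<times> real. fst y < fst z + 1}" by (intro open_Collect_less continuous_intros)
    then show "\<exists>U P. open U \<and> z \<in> U \<and> (\<forall>y\<in>{0..} \<times> UNIV \<inter> U. \<forall>v. norm v > P \<longrightarrow> g (fst y) (snd y) v * w v = 0)"
      using P by (intro exI[of _ "{y. fst y < fst z + 1}"] exI[of _ P]) auto
  qed
  then show ?thesis by (simp add: split_beta)
qed

lemma moment_cont:
  assumes "continuous_on UNIV w"
  shows "continuous_on ({0..} \<times> UNIV) (\<lambda>(t, x). moment w t x)"
  unfolding moment_def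
  by (rule continuous_on_moment_aux[OF f_cont(1) assms]) (metis velocity_support)

lemma moment_t_cont:
  assumes "continuous_on UNIV w"
  shows "continuous_on ({0..} \<times> UNIV) (\<lambda>(t, x). moment_t w t x)"
  unfolding moment_t_def
  by (rule continuous_on_moment_aux[OF f_cont(2) assms]) (metis velocity_support)

lemma f_cont_v: "t \<ge> 0 \<Longrightarrow> continuous_on UNIV (f t x)"
  using continuous_on_curried3[OF f_cont(1), of UNIV "\<lambda>_. t" "\<lambda>_. x" "\<lambda>v. v"]
  by (auto intro!: continuous_intros)

lemma moment_integrable:
  assumes "continuous_on UNIV w" "t \<ge> 0"
  shows "(\<lambda>v. f t x v * w v) integrable_on UNIV"
proof -
  obtain P where "\<And>s x v. s \<in> {0..t} \<Longrightarrow> norm v > P \<Longrightarrow> f s x v = 0 \<and> ft s x v = 0 \<and> fx s x v = 0"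
    using velocity_support[of t] by metis
  then show ?thesis
    using assms by (intro integrable_compact_support[of _ P] continuous_on_mult f_cont_v) auto
qed

lemma moment_has_t_derivative:
  assumes w: "continuous_on UNIV w" and t: "t \<ge> 0"
  shows "((\<lambda>s. moment w s x) has_real_derivative moment_t w t x) (at t within {0..})"
proof -
  obtain P where P: "\<And>s x v. s \<in> {0..t+1} \<Longrightarrow> norm v > P \<Longrightarrow> f s x v = 0 \<and> ft s x v = 0 \<and> fx s x v = 0"
    using velocity_support[of "t + 1"] by metis
  have "((\<lambda>s. moment w s x) has_real_derivative moment_t w t x) (at t within {0..t+1})"
    unfolding moment_def moment_t_def
  proof (rule velocity_integral_has_derivative[where P = P])
    show "((\<lambda>z. f z x v * w v) has_real_derivative ft z x v * w v) (at z within {0..t+1})" if "z \<in> {0..t+1}" for z v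
      using that C1_phase_t[OF f_C1, of z x v]
      by (intro DERIV_cmult_right) (auto intro: has_field_derivative_subset)
    show "continuous_on UNIV (\<lambda>v. f z x v * w v)" if "z \<in> {0..t+1}" for z
      using that by (intro continuous_on_mult f_cont_v w) auto
    show "continuous_on ({0..t+1} \<times> UNIV) (\<lambda>(z, v). ft z x v * w v)"
      unfolding split_beta
      by (intro continuous_on_mult continuous_on_curried3[OF f_cont(2)] continuous_on_compose2[OF w])
        (auto intro!: continuous_intros)
  qed (use t P in auto)
  moreover have "at t within {0..t+1} = at t within {0..}"
    by (rule at_within_nhd[of _ "{..<t+1}"]) auto
  ultimately show ?thesis by simp
qed

lemma moment_has_x_derivative:
  assumes w: "continuous_on UNIV w" and t: "t \<ge> 0"
  shows "(moment w t has_real_derivative moment_x w t x) (at x)"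
proof -
  obtain P where P: "\<And>s x v. s \<in> {0..t} \<Longrightarrow> norm v > P \<Longrightarrow> f s x v = 0 \<and> ft s x v = 0 \<and> fx s x v = 0"
    using velocity_support[of t] by metis
  have "((\<lambda>x. moment w t x) has_real_derivative moment_x w t x) (at x)"
    unfolding moment_def moment_x_def
  proof (rule velocity_integral_has_derivative[where P = P])
    show "((\<lambda>z. f t z v * w v) has_real_derivative fx t z v * w v) (at z)" for z v
      by (intro DERIV_cmult_right C1_phase_x[OF f_C1] t)
    show "continuous_on UNIV (\<lambda>v. f t z v * w v)" for z
      by (intro continuous_on_mult f_cont_v w t)
    show "continuous_on (UNIV \<times> UNIV) (\<lambda>(z, v). fx t z v * w v)"
      unfolding split_beta
      by (intro continuous_on_mult continuous_on_curried3[OF f_cont(3)] continuous_on_compose2[OF w])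
        (auto intro!: continuous_intros simp: t)
  qed (use t P in auto)
  then show ?thesis by simp
qed

text \<open>
  The Vlasov equation is multiplied by \<open>w\<close> and the force terms are integrated by parts in \<open>v\<close>. The
  force itself is divergence free in \<open>v\<close>, because \<open>\<partial>\<^sub>1 (v2 / v0) = \<partial>\<^sub>2 (v1 / v0)\<close>, so that only
  derivatives of \<open>w\<close> remain.
\<close>
lemma moment_balance:
  assumes w: "continuous_on UNIV w" and w1: "continuous_on UNIV w1" and w2: "continuous_on UNIV w2"
    and d1: "\<And>a b. ((\<lambda>a. w (a, b)) has_real_derivative w1 (a, b)) (at a)"
    and d2: "\<And>a b. ((\<lambda>b. w (a, b)) has_real_derivative w2 (a, b)) (at b)"
    and t: "t \<ge> 0"
  shows "moment_t w t x + moment_x (\<lambda>v. fst (vhat m v) * w v) t x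
    = moment (\<lambda>v. force1 t x v * w1 v + force2 t x v * w2 v) t x"
proof -
  obtain P where P: "\<And>s x v. s \<in> {0..t} \<Longrightarrow> norm v > P \<Longrightarrow> f s x v = 0 \<and> ft s x v = 0 \<and> fx s x v = 0"
    using velocity_support[of t] by metis
  have Pt: "norm v > P \<Longrightarrow> f t x v = 0" "norm v > P \<Longrightarrow> ft t x v = 0" "norm v > P \<Longrightarrow> fx t x v = 0" for v
    using P[of t v x] t by auto
  define c where "c v = - (fst v * snd v / v0 m v ^ 3)" for v
  have v0n: "v0 m v \<noteq> 0" for v using v0_pos[OF m_pos] by (metis less_irrefl)
  have vh: "continuous_on UNIV (\<lambda>v. fst (vhat m v))" "continuous_on UNIV (\<lambda>v. snd (vhat m v))"
    by (intro continuous_intros continuous_on_vhat m_pos)+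
  have cc: "continuous_on UNIV c"
    unfolding c_def using v0n by (intro continuous_intros continuous_on_v0) auto
  have slice: "continuous_on UNIV (g t x)" if "continuous_on ({0..} \<times> UNIV) (\<lambda>(t, x, v). g t x v)" for g :: "real \<Rightarrow> real \<Rightarrow> real \<times> real \<Rightarrow> real"
    using continuous_on_curried3[OF that, of UNIV "\<lambda>_. t" "\<lambda>_. x" "\<lambda>v. v"] t
    by (auto intro!: continuous_intros)
  note cf = slice[OF f_cont(1)] slice[OF f_cont(2)] slice[OF f_cont(3)] slice[OF f_cont(4)] slice[OF f_cont(5)]
  have cF: "continuous_on UNIV (force1 t x)" "continuous_on UNIV (force2 t x)"
    unfolding force1_def force2_def by (intro continuous_intros vh)+
  have F1: "((\<lambda>a. force1 t x (a, b)) has_real_derivative e * B t x * c (a, b)) (at a)" for a b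
    unfolding force1_def c_def
    by (auto intro!: derivative_eq_intros vhat_partials m_pos)
  have F2: "((\<lambda>b. force2 t x (a, b)) has_real_derivative - (e * B t x * c (a, b))) (at b)" for a b
    unfolding force2_def c_def
    by (auto intro!: derivative_eq_intros vhat_partials m_pos)
  define u1 where "u1 v = f1 t x v * (force1 t x v * w v) + f t x v * (e * B t x * c v * w v + force1 t x v * w1 v)" for v
  define u2 where "u2 v = f2 t x v * (force2 t x v * w v) + f t x v * (- (e * B t x * c v) * w v + force2 t x v * w2 v)" for v
  have cu: "continuous_on UNIV u1" "continuous_on UNIV u2"
    unfolding u1_def u2_def by (intro continuous_intros cf cF cc w w1 w2)+
  have z1: "(u1 has_integral 0) UNIV"
  proof (rule integral_partial1_zero[OF _ cu(1)])
    show "((\<lambda>a. f t x (a, b) * (force1 t x (a, b) * w (a, b))) has_real_derivative u1 (a, b)) (at a)" for a b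
      unfolding u1_def by (auto intro!: derivative_eq_intros C1_phase_1[OF f_C1, OF t] F1 d1 simp: algebra_simps)
  qed (use Pt in auto)
  have z2: "(u2 has_integral 0) UNIV"
  proof (rule integral_partial2_zero[OF _ cu(2)])
    show "((\<lambda>b. f t x (a, b) * (force2 t x (a, b) * w (a, b))) has_real_derivative u2 (a, b)) (at b)" for a b
      unfolding u2_def by (auto intro!: derivative_eq_intros C1_phase_2[OF f_C1, OF t] F2 d2 simp: algebra_simps)
  qed (use Pt in auto)
  have it: "((\<lambda>v. ft t x v * w v) has_integral moment_t w t x) UNIV"
    unfolding moment_t_def
    by (intro integrable_integral integrable_compact_support[of _ P] continuous_on_mult cf w) (use Pt in auto)
  have ix: "((\<lambda>v. fx t x v * (fst (vhat m v) * w v)) has_integral moment_x (\<lambda>v. fst (vhat m v) * w v) t x) UNIV"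
    unfolding moment_x_def
    by (intro integrable_integral integrable_compact_support[of _ P] continuous_on_mult cf w vh) (use Pt in auto)
  have "ft t x v * w v + fx t x v * (fst (vhat m v) * w v) + u1 v + u2 v
      = f t x v * (force1 t x v * w1 v + force2 t x v * w2 v)" for v
  proof -
    have "ft t x v * w v + fx t x v * (fst (vhat m v) * w v) + u1 v + u2 v
      = (ft t x v + fst (vhat m v) * fx t x v + force1 t x v * f1 t x v + force2 t x v * f2 t x v) * w v
        + f t x v * (force1 t x v * w1 v + force2 t x v * w2 v)"
      by (simp add: u1_def u2_def algebra_simps)
    then show ?thesis using vlasov_eq[OF t, of x v] by (simp add: force1_def force2_def)
  qed
  then have "((\<lambda>v. f t x v * (force1 t x v * w1 v + force2 t x v * w2 v)) has_integral
      moment_t w t x + moment_x (\<lambda>v. fst (vhat m v) * w v) t x + 0 + 0) UNIV"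
    using has_integral_add[OF has_integral_add[OF has_integral_add[OF it ix] z1] z2] by simp
  then show ?thesis by (simp add: moment_def integral_unique)
qed

lemma continuous_on_fst_vhat: "continuous_on S (\<lambda>v. fst (vhat m v))"
  and continuous_on_snd_vhat: "continuous_on S (\<lambda>v. snd (vhat m v))"
  by (intro continuous_intros continuous_on_vhat m_pos)+

lemma charge_balance:
  assumes "t \<ge> 0"
  shows "moment_t (\<lambda>_. 1) t x + moment_x (\<lambda>v. fst (vhat m v)) t x = 0"
proof -
  have "moment_t (\<lambda>_. 1) t x + moment_x (\<lambda>v. fst (vhat m v) * 1) t x
      = moment (\<lambda>v. force1 t x v * 0 + force2 t x v * 0) t x"
    by (rule moment_balance) (use assms in \<open>auto intro: continuous_intros\<close>)
  then show ?thesis by (simp add: moment_def)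
qed

lemma moment_linear:
  assumes "continuous_on UNIV w" "continuous_on UNIV w'" "t \<ge> 0"
  shows "moment (\<lambda>v. a * w v + b * w' v) t x = a * moment w t x + b * moment w' t x"
proof -
  have "((\<lambda>v. a * (f t x v * w v) + b * (f t x v * w' v)) has_integral a * moment w t x + b * moment w' t x) UNIV"
    unfolding moment_def
    by (intro has_integral_add has_integral_mult_right integrable_integral moment_integrable assms)
  then show ?thesis by (simp add: moment_def integral_unique algebra_simps)
qed

text \<open>
  The weight \<open>v0\<close> has the gradient \<open>vhat\<close>, on which the magnetic force does no work.
\<close>
lemma energy_balance:
  assumes t: "t \<ge> 0"
  shows "moment_t (v0 m) t x + moment_x fst t x
    = e * (E1 t x * moment (\<lambda>v. fst (vhat m v)) t x + E2 t x * moment (\<lambda>v. snd (vhat m v)) t x)"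
proof -
  have "fst (vhat m v) * v0 m v = fst v" for v
    using v0_pos[OF m_pos, of v] by (simp add: vhat_eq)
  then have "moment_t (v0 m) t x + moment_x fst t x
      = moment (\<lambda>v. force1 t x v * fst (vhat m v) + force2 t x v * snd (vhat m v)) t x"
    using moment_balance[OF continuous_on_v0 continuous_on_fst_vhat continuous_on_snd_vhat
        v0_partials[OF m_pos] t, of x] by simp
  also have "(\<lambda>v. force1 t x v * fst (vhat m v) + force2 t x v * snd (vhat m v))
      = (\<lambda>v. (e * E1 t x) * fst (vhat m v) + (e * E2 t x) * snd (vhat m v))"
    by (simp add: force1_def force2_def algebra_simps)
  finally show ?thesis
    using moment_linear[OF continuous_on_fst_vhat continuous_on_snd_vhat t, of "e * E1 t x" "e * E2 t x" x]
    by (simp add: algebra_simps)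
qed

lemma moment_outside_cone:
  assumes "t \<ge> 0" "\<bar>x\<bar> \<ge> C0 + t"
  shows "moment w t x = 0"
  using f_space_support[OF assms] by (simp add: moment_def)

lemma abs_moment_le:
  assumes "continuous_on UNIV w" "continuous_on UNIV w'" "t \<ge> 0" "\<And>v. \<bar>w v\<bar> \<le> w' v"
  shows "\<bar>moment w t x\<bar> \<le> moment w' t x"
proof -
  have "norm (moment w t x) \<le> moment w' t x"
    unfolding moment_def
  proof (rule integral_norm_bound_integral)
    show "norm (f t x v * w v) \<le> f t x v * w' v" for v
      using assms(4)[of v] f_nonneg[OF assms(3), of x v] by (simp add: abs_mult mult_left_mono)
  qed (intro moment_integrable assms)+
  then show ?thesis by simp
qed

lemma moment_nonneg:
  assumes "continuous_on UNIV w" "t \<ge> 0" "\<And>v. w v \<ge> 0"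
  shows "moment w t x \<ge> 0"
  unfolding moment_def
  by (rule integral_nonneg) (use assms f_nonneg moment_integrable in auto)

end

section \<open>The coupled system\<close>

locale vlasov_maxwell =
  fixes N :: nat and e m :: "nat \<Rightarrow> real" and C0 P0 F0 :: real
    and f0 :: "nat \<Rightarrow> real \<Rightarrow> real \<times> real \<Rightarrow> real"
    and E20 B0 :: "real \<Rightarrow> real"
    and f ft fx f1 f2 :: "nat \<Rightarrow> real \<Rightarrow> real \<Rightarrow> real \<times> real \<Rightarrow> real"
    and E1 E2 B E1t E1x E2t E2x Bt Bx :: "real \<Rightarrow> real \<Rightarrow> real"
  assumes species: "\<And>\<alpha>. \<alpha> \<in> {1..N} \<Longrightarrow>
      vlasov (e \<alpha>) (m \<alpha>) C0 P0 (f0 \<alpha>) (f \<alpha>) (ft \<alpha>) (fx \<alpha>) (f1 \<alpha>) (f2 \<alpha>) E1 E2 B E1t E1x E2t E2x Bt Bx"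
    and C0_pos: "C0 > 0" and P0_nonneg: "P0 \<ge> 0"
    and E2_C1: "C1_halfplane E2 E2t E2x"
    and B_C1: "C1_halfplane B Bt Bx"
    and charge_integrable: "\<And>t x. t \<ge> 0 \<Longrightarrow> integrable lborel (charge_integrand N e (\<lambda>\<alpha>. f \<alpha> t x))"
    and current_integrable: "\<And>t x. t \<ge> 0 \<Longrightarrow> integrable lborel (current_integrand N e m (\<lambda>\<alpha>. f \<alpha> t x))"
    and density_integrable: "\<And>t. t \<ge> 0 \<Longrightarrow> integrable lborel (charge_density N e f t)"
    and E1_eq: "\<And>t x. t \<ge> 0 \<Longrightarrow> E1 t x = 1/2 * (LINT y:{..x}|lborel. charge_density N e f t y)
                        - 1/2 * (LINT y:{x..}|lborel. charge_density N e f t y)"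
    and E2_eq: "\<And>t x. t \<ge> 0 \<Longrightarrow> E2t t x + Bx t x = - snd (current_density N e m f t x)"
    and B_eq: "\<And>t x. t \<ge> 0 \<Longrightarrow> Bt t x + E2x t x = 0"
    and E2_init: "\<And>x. E2 0 x = E20 x" and B_init: "\<And>x. B 0 x = B0 x"
    and fields_init_support: "\<And>x. \<bar>x\<bar> \<ge> C0 \<Longrightarrow> E20 x = 0 \<and> B0 x = 0"
    and fields_init_bound: "\<And>x. \<bar>E20 x\<bar> \<le> F0 \<and> \<bar>B0 x\<bar> \<le> F0"
    and neutrality: "neutral N e f0"
begin

abbreviation M :: "nat \<Rightarrow> (real \<times> real \<Rightarrow> real) \<Rightarrow> real \<Rightarrow> real \<Rightarrow> real" where
  "M \<alpha> \<equiv> vlasov.moment (f \<alpha>)"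

abbreviation Mt :: "nat \<Rightarrow> (real \<times> real \<Rightarrow> real) \<Rightarrow> real \<Rightarrow> real \<Rightarrow> real" where
  "Mt \<alpha> \<equiv> vlasov.moment_t (ft \<alpha>)"

abbreviation Mx :: "nat \<Rightarrow> (real \<times> real \<Rightarrow> real) \<Rightarrow> real \<Rightarrow> real \<Rightarrow> real" where
  "Mx \<alpha> \<equiv> vlasov.moment_x (fx \<alpha>)"

abbreviation vh1 :: "nat \<Rightarrow> real \<times> real \<Rightarrow> real" where "vh1 \<alpha> \<equiv> \<lambda>v. fst (vhat (m \<alpha>) v)"
abbreviation vh2 :: "nat \<Rightarrow> real \<times> real \<Rightarrow> real" where "vh2 \<alpha> \<equiv> \<lambda>v. snd (vhat (m \<alpha>) v)"

definition rho :: "real \<Rightarrow> real \<Rightarrow> real" where "rho t x = (\<Sum>\<alpha>=1..N. e \<alpha> * M \<alpha> (\<lambda>_. 1) t x)"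
definition j1 :: "real \<Rightarrow> real \<Rightarrow> real" where "j1 t x = (\<Sum>\<alpha>=1..N. e \<alpha> * M \<alpha> (vh1 \<alpha>) t x)"
definition j2 :: "real \<Rightarrow> real \<Rightarrow> real" where "j2 t x = (\<Sum>\<alpha>=1..N. e \<alpha> * M \<alpha> (vh2 \<alpha>) t x)"

lemma cont_vh: "\<alpha> \<in> {1..N} \<Longrightarrow> continuous_on S (vh1 \<alpha>)" "\<alpha> \<in> {1..N} \<Longrightarrow> continuous_on S (vh2 \<alpha>)"
  using vlasov.continuous_on_fst_vhat[OF species] vlasov.continuous_on_snd_vhat[OF species] by auto

lemma moment_has_integral:
  assumes "\<alpha> \<in> {1..N}" "t \<ge> 0" "continuous_on UNIV w"
  shows "((\<lambda>v. f \<alpha> t x v * w v) has_integral M \<alpha> w t x) UNIV"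
  using vlasov.moment_integrable[OF species[OF assms(1)] assms(3,2)]
  by (simp add: vlasov.moment_def[OF species[OF assms(1)]] integrable_integral)

lemma charge_density_eq:
  assumes t: "t \<ge> 0"
  shows "charge_density N e f t x = rho t x"
proof -
  have "(charge_integrand N e (\<lambda>\<alpha>. f \<alpha> t x) has_integral charge_density N e f t x) UNIV"
    unfolding charge_density_def by (rule has_integral_integral_lborel[OF charge_integrable[OF t]])
  moreover have "((\<lambda>v. \<Sum>\<alpha>=1..N. e \<alpha> * (f \<alpha> t x v * 1)) has_integral rho t x) UNIV"
    unfolding rho_def
    by (intro has_integral_sum has_integral_mult_right moment_has_integral t continuous_intros) auto
  ultimately show ?thesis
    by (simp add: charge_integrand_def[abs_def] has_integral_unique)
qed

lemma current_density_eq: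
  assumes t: "t \<ge> 0"
  shows "snd (current_density N e m f t x) = j2 t x"
proof -
  have "(current_integrand N e m (\<lambda>\<alpha>. f \<alpha> t x) has_integral current_density N e m f t x) UNIV"
    unfolding current_density_def by (rule has_integral_integral_lborel[OF current_integrable[OF t]])
  from has_integral_linear[OF this bounded_linear_snd]
  have "((\<lambda>v. \<Sum>\<alpha>=1..N. e \<alpha> * f \<alpha> t x v * vh2 \<alpha> v) has_integral snd (current_density N e m f t x)) UNIV"
    by (simp add: o_def current_integrand_def snd_sum)
  moreover have "((\<lambda>v. \<Sum>\<alpha>=1..N. e \<alpha> * (f \<alpha> t x v * vh2 \<alpha> v)) has_integral j2 t x) UNIV"
    unfolding j2_def
    by (intro has_integral_sum has_integral_mult_right moment_has_integral t cont_vh) auto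
  ultimately show ?thesis
    by (simp add: has_integral_unique mult.assoc)
qed

lemma continuous_on_moment_sum:
  assumes "\<And>\<alpha>. \<alpha> \<in> {1..N} \<Longrightarrow> continuous_on UNIV (w \<alpha>)"
  shows "continuous_on ({0..} \<times> UNIV) (\<lambda>(t, x). \<Sum>\<alpha>=1..N. c \<alpha> * M \<alpha> (w \<alpha>) t x)"
    "continuous_on ({0..} \<times> UNIV) (\<lambda>(t, x). \<Sum>\<alpha>=1..N. c \<alpha> * Mt \<alpha> (w \<alpha>) t x)"
  unfolding split_beta
  using vlasov.moment_cont[OF species assms] vlasov.moment_t_cont[OF species assms]
  by (auto intro!: continuous_on_sum continuous_on_mult_left simp: split_beta)

lemma moment_sum_derivatives:
  assumes "\<And>\<alpha>. \<alpha> \<in> {1..N} \<Longrightarrow> continuous_on UNIV (w \<alpha>)" "t \<ge> 0"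
  shows "((\<lambda>s. \<Sum>\<alpha>=1..N. c \<alpha> * M \<alpha> (w \<alpha>) s x) has_real_derivative (\<Sum>\<alpha>=1..N. c \<alpha> * Mt \<alpha> (w \<alpha>) t x)) (at t within {0..})"
    "((\<lambda>y. \<Sum>\<alpha>=1..N. c \<alpha> * M \<alpha> (w \<alpha>) t y) has_real_derivative (\<Sum>\<alpha>=1..N. c \<alpha> * Mx \<alpha> (w \<alpha>) t x)) (at x)"
  by (intro DERIV_sum DERIV_cmult vlasov.moment_has_t_derivative[OF species] vlasov.moment_has_x_derivative[OF species] assms; simp)+

lemma sources_outside_cone:
  assumes "t \<ge> 0" "\<bar>x\<bar> \<ge> C0 + t"
  shows "rho t x = 0" "j1 t x = 0" "j2 t x = 0"
  using vlasov.moment_outside_cone[OF species assms]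
  by (auto simp: rho_def j1_def j2_def intro!: sum.neutral)

lemma charge_stream:
  obtains \<phi> where "C1_halfplane \<phi> (\<lambda>t x. - j1 t x) rho"
proof (rule stream_function[of rho j1 "\<lambda>t x. \<Sum>\<alpha>=1..N. e \<alpha> * Mt \<alpha> (\<lambda>_. 1) t x"])
  show "continuous_on ({0..} \<times> UNIV) (\<lambda>(t, x). rho t x)"
    unfolding rho_def by (rule continuous_on_moment_sum) (intro continuous_intros)
  show "continuous_on ({0..} \<times> UNIV) (\<lambda>(t, x). \<Sum>\<alpha>=1..N. e \<alpha> * Mt \<alpha> (\<lambda>_. 1) t x)"
    by (rule continuous_on_moment_sum) (intro continuous_intros)
  show "continuous_on ({0..} \<times> UNIV) (\<lambda>(t, x). j1 t x)"
    unfolding j1_def by (rule continuous_on_moment_sum) (rule cont_vh)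
  fix t x :: real assume t: "t \<ge> 0"
  show "((\<lambda>s. rho s x) has_real_derivative (\<Sum>\<alpha>=1..N. e \<alpha> * Mt \<alpha> (\<lambda>_. 1) t x)) (at t within {0..})"
    unfolding rho_def by (rule moment_sum_derivatives) (auto intro: t continuous_intros)
  have "Mx \<alpha> (vh1 \<alpha>) t x = - Mt \<alpha> (\<lambda>_. 1) t x" if "\<alpha> \<in> {1..N}" for \<alpha>
    using vlasov.charge_balance[OF species[OF that] t, of x] by simp
  then have "(\<Sum>\<alpha>=1..N. e \<alpha> * Mx \<alpha> (vh1 \<alpha>) t x) = - (\<Sum>\<alpha>=1..N. e \<alpha> * Mt \<alpha> (\<lambda>_. 1) t x)"
    by (simp add: sum_negf[symmetric])
  moreover have "(j1 t has_real_derivative (\<Sum>\<alpha>=1..N. e \<alpha> * Mx \<alpha> (vh1 \<alpha>) t x)) (at x)"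
    unfolding j1_def[abs_def] by (rule moment_sum_derivatives) (auto intro: t cont_vh)
  ultimately show "(j1 t has_real_derivative - (\<Sum>\<alpha>=1..N. e \<alpha> * Mt \<alpha> (\<lambda>_. 1) t x)) (at x)"
    by simp
qed

text \<open>
  Up to a constant, \<open>E1\<close> is the stream function of charge. It takes opposite values to the left
  and to the right of the cone, whose difference is the total charge, so for neutral data it
  vanishes there. Without this the total energy would be infinite.
\<close>
lemma E1_C1: "C1_halfplane E1 (\<lambda>t x. - j1 t x) rho"
  and E1_outside_cone: "t \<ge> 0 \<Longrightarrow> \<bar>x\<bar> \<ge> C0 + t \<Longrightarrow> E1 t x = 0"
proof -
  obtain \<phi> where \<phi>: "C1_halfplane \<phi> (\<lambda>t x. - j1 t x) rho" by (rule charge_stream)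
  note out = stream_function_outside_cone[OF \<phi>, of C0]
  have zero: "rho t x = 0 \<and> j1 t x = 0" if "t \<ge> 0" "\<bar>x\<bar> \<ge> C0 + t" for t x
    using sources_outside_cone that by auto
  have ft: "(rho t has_integral \<phi> t b - \<phi> t a) {a..b}" if "t \<ge> 0" "a \<le> b" for t a b
    using that C1_halfplane_x[OF \<phi>]
    by (intro fundamental_theorem_of_calculus)
      (auto simp: has_real_derivative_iff_has_vector_derivative[symmetric] intro: has_field_derivative_at_within)
  have left: "(LINT y:{..x}|lborel. charge_density N e f t y) = \<phi> t x - \<phi> 0 (- C0)" 
    and right: "(LINT y:{x..}|lborel. charge_density N e f t y) = \<phi> 0 C0 - \<phi> t x" if t: "t \<ge> 0" for t x
  proof -
    define K where "K = C0 + t + \<bar>x\<bar>"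
    have K: "K \<ge> C0 + t" "- K \<le> x" "x \<le> K" using t C0_pos unfolding K_def by linarith+
    have r0: "rho t y = 0" if "y < - K \<or> y > K" for y
    proof -
      have "\<bar>y\<bar> \<ge> C0 + t" using that K by linarith
      then show ?thesis using zero t by blast
    qed
    have cd: "charge_density N e f t = rho t" using charge_density_eq[OF t] by auto
    have int: "set_integrable lborel S (rho t)" if "S \<in> sets borel" for S
      using density_integrable[OF t] that unfolding cd set_integrable_def
      by (intro integrable_mult_indicator) auto
    have "(rho t has_integral \<phi> t x - \<phi> t (-K)) {..x}"
      using ft[OF t K(2)]
      by (rule has_integral_spike_set_eq[THEN iffD1, rotated 2]) (auto simp: r0 intro!: empty_imp_negligible)
    then show "(LINT y:{..x}|lborel. charge_density N e f t y) = \<phi> t x - \<phi> 0 (- C0)"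
      using set_borel_integral_eq_integral(2)[OF int, of "{..x}"] out(2)[OF zero t, of "-K"] K
      by (simp add: cd integral_unique)
    have "(rho t has_integral \<phi> t K - \<phi> t x) {x..}"
      using ft[OF t K(3)]
      by (rule has_integral_spike_set_eq[THEN iffD1, rotated 2]) (auto simp: r0 intro!: empty_imp_negligible)
    then show "(LINT y:{x..}|lborel. charge_density N e f t y) = \<phi> 0 C0 - \<phi> t x"
      using set_borel_integral_eq_integral(2)[OF int, of "{x..}"] out(1)[OF zero t, of K] K
      by (simp add: cd integral_unique)
  qed
  have total: "\<phi> 0 C0 = \<phi> 0 (- C0)"
  proof -
    have "charge_density N e f 0 x = (LINT v|lborel. charge_integrand N e (\<lambda>\<alpha>. f0 \<alpha> x) v)" for x
      unfolding charge_density_def charge_integrand_def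
      by (intro Bochner_Integration.integral_cong refl sum.cong) (simp add: vlasov.f_initial[OF species])
    then have "(LINT x|lborel. charge_density N e f 0 x) = 0"
      using neutrality by (simp add: neutral_def)
    then have "(charge_density N e f 0 has_integral 0) UNIV"
      using has_integral_integral_lborel[OF density_integrable[of 0]] by simp
    moreover have "charge_density N e f 0 = rho 0" using charge_density_eq[of 0] by auto
    moreover have "(rho 0 has_integral \<phi> 0 C0 - \<phi> 0 (- C0)) UNIV"
      by (rule has_integral_on_superset[OF ft]) (use C0_pos zero[of 0] in auto)
    ultimately have "0 = \<phi> 0 C0 - \<phi> 0 (- C0)" by (metis has_integral_unique)
    then show ?thesis by simp
  qed
  have E1: "E1 t x = \<phi> t x - \<phi> 0 (- C0)" if "t \<ge> 0" for t x
    using E1_eq[OF that, of x] left[OF that] right[OF that] total by (simp add: field_simps)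
  show "E1 t x = 0" if "t \<ge> 0" "\<bar>x\<bar> \<ge> C0 + t"
  proof -
    have "x \<ge> C0 + t \<or> x \<le> - (C0 + t)" using that(2) by linarith
    then have "\<phi> t x = \<phi> 0 (- C0)"
      using out(1)[OF zero that(1), of x] out(2)[OF zero that(1), of x] total by metis
    then show ?thesis using E1[OF that(1)] by simp
  qed
  show "C1_halfplane E1 (\<lambda>t x. - j1 t x) rho"
    by (rule C1_halfplane_diff_const[OF \<phi> E1])
qed

text \<open>
  The combinations \<open>E2 + B\<close> and \<open>E2 - B\<close> are transported to the right and to the left.
\<close>
lemma transverse_field_along_light_line:
  assumes s: "\<bar>\<sigma>\<bar> = 1" and st: "s \<in> {0..t}"
  shows "((\<lambda>s. E2 s (x - \<sigma> * (t - s)) + \<sigma> * B s (x - \<sigma> * (t - s))) has_real_derivative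
    - j2 s (x - \<sigma> * (t - s))) (at s within {0..t})"
proof -
  let ?X = "\<lambda>s. x - \<sigma> * (t - s)"
  have X: "(?X has_real_derivative \<sigma>) (at s within {0..t})"
    by (auto intro!: derivative_eq_intros)
  have s2: "\<sigma> * \<sigma> = 1" using s by (metis abs_mult_self_eq mult_1)
  have "((\<lambda>s. E2 s (?X s) + \<sigma> * B s (?X s)) has_real_derivative
    (E2t s (?X s) + \<sigma> * E2x s (?X s)) + \<sigma> * (Bt s (?X s) + \<sigma> * Bx s (?X s))) (at s within {0..t})"
    by (intro DERIV_add DERIV_cmult C1_halfplane_along_curve[OF E2_C1 X] C1_halfplane_along_curve[OF B_C1 X])
      (use st in auto)
  moreover have "(E2t s (?X s) + \<sigma> * E2x s (?X s)) + \<sigma> * (Bt s (?X s) + \<sigma> * Bx s (?X s))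
     = (E2t s (?X s) + (\<sigma> * \<sigma>) * Bx s (?X s)) + \<sigma> * (Bt s (?X s) + E2x s (?X s))"
    by (simp add: algebra_simps)
  ultimately show ?thesis
    using E2_eq[of s "?X s"] B_eq[of s "?X s"] current_density_eq[of s "?X s"] st s2 by simp
qed

lemma transverse_fields_outside_cone:
  assumes "t \<ge> 0" "\<bar>x\<bar> \<ge> C0 + t"
  shows "E2 t x = 0" "B t x = 0"
proof -
  have "E2 t x + \<sigma> * B t x = 0" if s: "\<bar>\<sigma>\<bar> = 1" for \<sigma>
  proof -
    let ?X = "\<lambda>s. x - \<sigma> * (t - s)"
    have out: "\<bar>?X s\<bar> \<ge> C0 + s" if "s \<in> {0..t}" for s
    proof -
      have "\<bar>\<sigma> * (t - s)\<bar> = t - s" using s that by (simp add: abs_mult)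
      then show ?thesis using assms by linarith
    qed
    have "\<bar>(E2 t (?X t) + \<sigma> * B t (?X t)) - (E2 0 (?X 0) + \<sigma> * B 0 (?X 0))\<bar> \<le> 0 - 0"
      by (rule real_derivative_comparison[OF assms(1) transverse_field_along_light_line[OF s], where k = "\<lambda>_. 0" and k' = "\<lambda>_. 0"])
        (use out sources_outside_cone in auto)
    then show ?thesis
      using fields_init_support[of "?X 0"] out[of 0] assms(1) by (simp add: E2_init B_init)
  qed
  from this[of 1] this[of "-1"] show "E2 t x = 0" "B t x = 0" by auto
qed

definition energy_density :: "real \<Rightarrow> real \<Rightarrow> real" where
  "energy_density t x = (\<Sum>\<alpha>=1..N. M \<alpha> (v0 (m \<alpha>)) t x) + ((E1 t x)\<^sup>2 + (E2 t x)\<^sup>2 + (B t x)\<^sup>2) / 2"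

definition momentum_density :: "real \<Rightarrow> real \<Rightarrow> real" where
  "momentum_density t x = (\<Sum>\<alpha>=1..N. M \<alpha> fst t x) + E2 t x * B t x"

lemma energy_outside_cone:
  assumes "t \<ge> 0" "\<bar>x\<bar> \<ge> C0 + t"
  shows "energy_density t x = 0 \<and> momentum_density t x = 0"
  using vlasov.moment_outside_cone[OF species assms] E1_outside_cone[OF assms]
    transverse_fields_outside_cone[OF assms]
  by (auto simp: energy_density_def momentum_density_def intro!: sum.neutral)

lemma continuous_on_energy_momentum_density:
  "continuous_on ({0..} \<times> UNIV) (\<lambda>(t, x). energy_density t x)"
  "continuous_on ({0..} \<times> UNIV) (\<lambda>(t, x). momentum_density t x)"
proof -
  note F = C1_halfplane_cont[OF E1_C1] C1_halfplane_cont[OF E2_C1] C1_halfplane_cont[OF B_C1]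
  have "continuous_on ({0..} \<times> UNIV) (\<lambda>(t, x). \<Sum>\<alpha>=1..N. 1 * M \<alpha> (v0 (m \<alpha>)) t x)"
    "continuous_on ({0..} \<times> UNIV) (\<lambda>(t, x). \<Sum>\<alpha>=1..N. 1 * M \<alpha> fst t x)"
    by (rule continuous_on_moment_sum, intro continuous_on_v0 continuous_intros)+
  with F show "continuous_on ({0..} \<times> UNIV) (\<lambda>(t, x). energy_density t x)" "continuous_on ({0..} \<times> UNIV) (\<lambda>(t, x). momentum_density t x)"
    unfolding energy_density_def momentum_density_def split_beta by (auto intro!: continuous_intros)
qed

text \<open>
  In the balance of the field energy the work terms \<open>E1 * j1 + E2 * j2\<close> cancel those of the
  particles, and \<open>E2 * B\<close> is the flux of field energy.
\<close>
lemma energy_stream: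
  obtains \<phi> where "C1_halfplane \<phi> (\<lambda>t x. - momentum_density t x) energy_density"
proof -
  define et where "et t x = (\<Sum>\<alpha>=1..N. 1 * Mt \<alpha> (v0 (m \<alpha>)) t x)
    + (E1 t x * - j1 t x + E2 t x * E2t t x + B t x * Bt t x)" for t x
  have v0c: "continuous_on UNIV (v0 (m \<alpha>))" for \<alpha> by (rule continuous_on_v0)
  show thesis
  proof (rule stream_function[OF continuous_on_energy_momentum_density, of et])
    have "continuous_on ({0..} \<times> UNIV) (\<lambda>(t, x). \<Sum>\<alpha>=1..N. 1 * Mt \<alpha> (v0 (m \<alpha>)) t x)"
      by (rule continuous_on_moment_sum(2)[OF v0c])
    then show "continuous_on ({0..} \<times> UNIV) (\<lambda>(t, x). et t x)"
      using C1_halfplane_cont[OF E1_C1] C1_halfplane_cont[OF E2_C1] C1_halfplane_cont[OF B_C1] E1_C1 E2_C1 B_C1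
      unfolding et_def split_beta C1_halfplane_def
      by (intro continuous_on_add continuous_on_mult) simp_all
    fix t x :: real assume t: "t \<ge> 0"
    have "((\<lambda>s. (\<Sum>\<alpha>=1..N. 1 * M \<alpha> (v0 (m \<alpha>)) s x) + ((E1 s x)\<^sup>2 + (E2 s x)\<^sup>2 + (B s x)\<^sup>2) / 2)
        has_real_derivative et t x) (at t within {0..})"
      unfolding et_def
      by (rule DERIV_add[OF moment_sum_derivatives(1)[OF v0c t]])
        (auto intro!: derivative_eq_intros C1_halfplane_t[OF E1_C1 t] C1_halfplane_t[OF E2_C1 t]
          C1_halfplane_t[OF B_C1 t] simp: field_simps)
    then show "((\<lambda>s. energy_density s x) has_real_derivative et t x) (at t within {0..})"
      by (simp add: energy_density_def)
    have "((\<lambda>y. (\<Sum>\<alpha>=1..N. 1 * M \<alpha> fst t y) + E2 t y * B t y) has_real_derivative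
        (\<Sum>\<alpha>=1..N. 1 * Mx \<alpha> fst t x) + (E2x t x * B t x + Bx t x * E2 t x)) (at x)"
      by (intro DERIV_add DERIV_mult moment_sum_derivatives(2) C1_halfplane_x[OF E2_C1 t]
          C1_halfplane_x[OF B_C1 t] t continuous_intros)
    moreover have "(\<Sum>\<alpha>=1..N. 1 * Mx \<alpha> fst t x) + (E2x t x * B t x + Bx t x * E2 t x) = - et t x"
    proof -
      have "(\<Sum>\<alpha>=1..N. Mt \<alpha> (v0 (m \<alpha>)) t x) + (\<Sum>\<alpha>=1..N. Mx \<alpha> fst t x) = E1 t x * j1 t x + E2 t x * j2 t x"
        unfolding j1_def j2_def sum_distrib_left sum.distrib[symmetric]
        by (rule sum.cong) (use vlasov.energy_balance[OF species t] in \<open>auto simp: algebra_simps\<close>)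
      moreover have "E2t t x = - j2 t x - Bx t x" "Bt t x = - E2x t x"
        using E2_eq[OF t, of x] B_eq[OF t, of x] current_density_eq[OF t, of x] by auto
      then have "E2 t x * E2t t x = E2 t x * (- j2 t x - Bx t x)" "B t x * Bt t x = B t x * (- E2x t x)"
        by simp_all
      ultimately show ?thesis by (simp add: et_def algebra_simps)
    qed
    ultimately show "(momentum_density t has_real_derivative - et t x) (at x)"
      by (simp add: momentum_density_def[abs_def])
  qed (rule that)
qed

section \<open>Energy flux along light lines\<close>

text \<open>
  The total energy is expressed by the data alone, because the constant of the theorem must be
  the same for all solutions with the same data.
\<close>
definition initial_E1 :: "real \<Rightarrow> real" where
  "initial_E1 x = 1/2 * (LINT y:{..x}|lborel. charge_density N e (\<lambda>\<alpha> t. f0 \<alpha>) 0 y)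
                - 1/2 * (LINT y:{x..}|lborel. charge_density N e (\<lambda>\<alpha> t. f0 \<alpha>) 0 y)"

definition total_energy :: real where
  "total_energy = integral {- C0..C0} (\<lambda>x. (\<Sum>\<alpha>=1..N. integral UNIV (\<lambda>v. f0 \<alpha> x v * v0 (m \<alpha>) v))
     + ((initial_E1 x)\<^sup>2 + (E20 x)\<^sup>2 + (B0 x)\<^sup>2) / 2)"

text \<open>
  The factor \<open>1 / m \<alpha>\<close> is that of the kinematic estimates \<open>abs_vhat2_le_light_cone_momentum\<close> and
  \<open>one_le_energy_light_cone_momentum\<close>.
\<close>
definition kappa :: real where "kappa = (\<Sum>\<alpha>=1..N. \<bar>e \<alpha>\<bar> / m \<alpha>)"

lemma m_pos: "\<alpha> \<in> {1..N} \<Longrightarrow> m \<alpha> > 0"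
  by (rule vlasov.m_pos[OF species])

lemma kappa_ge: "\<alpha> \<in> {1..N} \<Longrightarrow> \<bar>e \<alpha>\<bar> / m \<alpha> \<le> kappa"
  unfolding kappa_def by (rule member_le_sum) (auto simp: less_imp_le m_pos)

lemma kappa_nonneg: "kappa \<ge> 0"
  unfolding kappa_def by (intro sum_nonneg) (auto simp: less_imp_le m_pos)

definition particle_energy :: "real \<Rightarrow> real \<Rightarrow> real" where
  "particle_energy t x = (\<Sum>\<alpha>=1..N. M \<alpha> (v0 (m \<alpha>)) t x)"

definition particle_flux :: "real \<Rightarrow> real \<Rightarrow> real \<Rightarrow> real" where
  "particle_flux \<sigma> t x = (\<Sum>\<alpha>=1..N. M \<alpha> (\<lambda>v. v0 (m \<alpha>) v - \<sigma> * fst v) t x)"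

text \<open>
  The energy that crosses a light line of direction \<open>\<sigma>\<close>, per unit of time.
\<close>
definition light_flux :: "real \<Rightarrow> real \<Rightarrow> real \<Rightarrow> real" where
  "light_flux \<sigma> t x = energy_density t x - \<sigma> * momentum_density t x"

lemma cont_light_cone_momentum: "continuous_on S (\<lambda>v. v0 (m \<alpha>) v - \<sigma> * fst v)"
  by (intro continuous_intros continuous_on_v0)

lemma particle_energy_nonneg: "t \<ge> 0 \<Longrightarrow> particle_energy t x \<ge> 0"
  unfolding particle_energy_def
  by (intro sum_nonneg vlasov.moment_nonneg[OF species] continuous_on_v0) (auto simp: v0_def)

lemma particle_flux_nonneg:
  assumes "t \<ge> 0" "\<bar>\<sigma>\<bar> = 1"
  shows "particle_flux \<sigma> t x \<ge> 0"
  unfolding particle_flux_def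
proof (intro sum_nonneg vlasov.moment_nonneg[OF species] cont_light_cone_momentum)
  fix \<alpha> v assume "\<alpha> \<in> {1..N}"
  then show "0 \<le> v0 (m \<alpha>) v - \<sigma> * fst v"
    using light_cone_momentum_pos[OF m_pos assms(2), of \<alpha> "fst v" "snd v"] by simp
qed (use assms in auto)

text \<open>
  A sum of nonnegative terms: the field part is a complete square plus \<open>E1\<^sup>2 / 2\<close>.
\<close>
lemma light_flux_eq:
  assumes t: "t \<ge> 0" and s: "\<bar>\<sigma>\<bar> = 1"
  shows "light_flux \<sigma> t x = particle_flux \<sigma> t x + (E1 t x)\<^sup>2 / 2 + (E2 t x - \<sigma> * B t x)\<^sup>2 / 2"
proof -
  have s2: "\<sigma> * \<sigma> = 1" using s by (metis abs_mult_self_eq mult_1)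
  have "M \<alpha> (\<lambda>v. v0 (m \<alpha>) v - \<sigma> * fst v) t x = M \<alpha> (v0 (m \<alpha>)) t x - \<sigma> * M \<alpha> fst t x" if "\<alpha> \<in> {1..N}" for \<alpha>
    using vlasov.moment_linear[OF species[OF that] continuous_on_v0 continuous_on_fst[OF continuous_on_id] t,
        of 1 "m \<alpha>" "- \<sigma>" x] by simp
  then have "particle_flux \<sigma> t x = (\<Sum>\<alpha>=1..N. M \<alpha> (v0 (m \<alpha>)) t x) - \<sigma> * (\<Sum>\<alpha>=1..N. M \<alpha> fst t x)"
    unfolding particle_flux_def by (simp add: sum_subtractf sum_distrib_left)
  moreover have "(E2 t x - \<sigma> * B t x)\<^sup>2 = (E2 t x)\<^sup>2 + (\<sigma> * \<sigma>) * (B t x)\<^sup>2 - 2 * \<sigma> * (E2 t x * B t x)"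
    by (simp add: power2_eq_square algebra_simps)
  ultimately show ?thesis
    using s2 by (simp add: light_flux_def energy_density_def momentum_density_def algebra_simps add_divide_distrib diff_divide_distrib)
qed

lemma light_flux_ge:
  assumes "t \<ge> 0" "\<bar>\<sigma>\<bar> = 1"
  shows "particle_flux \<sigma> t x \<le> light_flux \<sigma> t x" "(E1 t x)\<^sup>2 / 2 \<le> light_flux \<sigma> t x" "0 \<le> light_flux \<sigma> t x"
  using particle_flux_nonneg[OF assms, of x] zero_le_power2[of "E1 t x"] zero_le_power2[of "E2 t x - \<sigma> * B t x"]
  unfolding light_flux_eq[OF assms] by linarith+

lemma energy_density_ge:
  assumes "t \<ge> 0"
  shows "particle_energy t x \<le> energy_density t x" "(B t x)\<^sup>2 / 2 \<le> energy_density t x" "0 \<le> energy_density t x"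
  using particle_energy_nonneg[OF assms, of x] zero_le_power2[of "E1 t x"] zero_le_power2[of "E2 t x"]
    zero_le_power2[of "B t x"]
  unfolding energy_density_def particle_energy_def[symmetric] by (simp_all add: add_divide_distrib)

lemma abs_j2_le:
  assumes t: "t \<ge> 0" and s: "\<bar>\<sigma>\<bar> = 1"
  shows "\<bar>j2 t x\<bar> \<le> kappa * light_flux \<sigma> t x"
proof -
  have "\<bar>j2 t x\<bar> \<le> (\<Sum>\<alpha>=1..N. \<bar>e \<alpha> * M \<alpha> (vh2 \<alpha>) t x\<bar>)"
    unfolding j2_def by (rule sum_abs)
  also have "\<dots> \<le> (\<Sum>\<alpha>=1..N. kappa * M \<alpha> (\<lambda>v. v0 (m \<alpha>) v - \<sigma> * fst v) t x)"
  proof (rule sum_mono)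
    fix \<alpha> assume a: "\<alpha> \<in> {1..N}"
    let ?w = "\<lambda>v. v0 (m \<alpha>) v - \<sigma> * fst v"
    have w0: "?w v > 0" for v
      using light_cone_momentum_pos[OF m_pos[OF a] s, of "fst v" "snd v"] by simp
    have "\<bar>M \<alpha> (vh2 \<alpha>) t x\<bar> \<le> M \<alpha> (\<lambda>v. (1 / m \<alpha>) * ?w v + 0 * ?w v) t x"
    proof (rule vlasov.abs_moment_le[OF species[OF a] cont_vh(2)[OF a] _ t])
      show "\<bar>vh2 \<alpha> v\<bar> \<le> (1 / m \<alpha>) * ?w v + 0 * ?w v" for v
        using abs_vhat2_le_light_cone_momentum[OF m_pos[OF a] s, of "fst v" "snd v"] by simp
    qed (intro continuous_intros continuous_on_v0)
    also have "\<dots> = (1 / m \<alpha>) * M \<alpha> ?w t x"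
      using vlasov.moment_linear[OF species[OF a] cont_light_cone_momentum cont_light_cone_momentum t, of "1 / m \<alpha>" \<alpha> \<sigma> 0 \<alpha> \<sigma> x]
      by simp
    finally have "\<bar>e \<alpha> * M \<alpha> (vh2 \<alpha>) t x\<bar> \<le> \<bar>e \<alpha>\<bar> * ((1 / m \<alpha>) * M \<alpha> ?w t x)"
      unfolding abs_mult by (rule mult_left_mono) simp
    also have "\<dots> = (\<bar>e \<alpha>\<bar> / m \<alpha>) * M \<alpha> ?w t x" by simp
    also have "\<dots> \<le> kappa * M \<alpha> ?w t x"
      by (rule mult_right_mono[OF kappa_ge[OF a]])
        (rule vlasov.moment_nonneg[OF species[OF a] cont_light_cone_momentum t less_imp_le[OF w0]])
    finally show "\<bar>e \<alpha> * M \<alpha> (vh2 \<alpha>) t x\<bar> \<le> kappa * M \<alpha> ?w t x" .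
  qed
  also have "\<dots> = kappa * particle_flux \<sigma> t x"
    by (simp add: particle_flux_def sum_distrib_left)
  also have "\<dots> \<le> kappa * light_flux \<sigma> t x"
    by (rule mult_left_mono[OF light_flux_ge(1)[OF assms] kappa_nonneg])
  finally show ?thesis .
qed

lemma abs_rho_le:
  assumes t: "t \<ge> 0" and s: "\<bar>\<sigma>\<bar> = 1" and l: "l > 0"
  shows "\<bar>rho t x\<bar> \<le> kappa * (l * energy_density t x + light_flux \<sigma> t x / l)"
proof -
  have "\<bar>rho t x\<bar> \<le> (\<Sum>\<alpha>=1..N. \<bar>e \<alpha> * M \<alpha> (\<lambda>_. 1) t x\<bar>)"
    unfolding rho_def by (rule sum_abs)
  also have "\<dots> \<le> (\<Sum>\<alpha>=1..N. kappa * (l * M \<alpha> (v0 (m \<alpha>)) t x + M \<alpha> (\<lambda>v. v0 (m \<alpha>) v - \<sigma> * fst v) t x / l))"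
  proof (rule sum_mono)
    fix \<alpha> assume a: "\<alpha> \<in> {1..N}"
    let ?w = "\<lambda>v. v0 (m \<alpha>) v - \<sigma> * fst v"
    have w0: "?w v > 0" for v
      using light_cone_momentum_pos[OF m_pos[OF a] s, of "fst v" "snd v"] by simp
    let ?S = "l * M \<alpha> (v0 (m \<alpha>)) t x + M \<alpha> ?w t x / l"
    have "\<bar>M \<alpha> (\<lambda>_. 1) t x\<bar> \<le> M \<alpha> (\<lambda>v. (l / m \<alpha>) * v0 (m \<alpha>) v + (1 / (l * m \<alpha>)) * ?w v) t x"
    proof (rule vlasov.abs_moment_le[OF species[OF a] _ _ t])
      show "\<bar>1\<bar> \<le> (l / m \<alpha>) * v0 (m \<alpha>) v + (1 / (l * m \<alpha>)) * ?w v" for v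
        using one_le_energy_light_cone_momentum[OF m_pos[OF a] s l, of "fst v" "snd v"] 
        by (simp add: add_divide_distrib mult.commute)
    qed (intro continuous_intros continuous_on_v0)+
    also have "\<dots> = (l / m \<alpha>) * M \<alpha> (v0 (m \<alpha>)) t x + (1 / (l * m \<alpha>)) * M \<alpha> ?w t x"
      by (rule vlasov.moment_linear[OF species[OF a] continuous_on_v0 cont_light_cone_momentum t])
    also have "\<dots> = ?S / m \<alpha>" by (simp add: add_divide_distrib)
    finally have "\<bar>e \<alpha> * M \<alpha> (\<lambda>_. 1) t x\<bar> \<le> \<bar>e \<alpha>\<bar> * (?S / m \<alpha>)"
      unfolding abs_mult by (rule mult_left_mono) simp
    also have "\<dots> = (\<bar>e \<alpha>\<bar> / m \<alpha>) * ?S" by simp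
    also have "\<dots> \<le> kappa * ?S"
    proof (rule mult_right_mono[OF kappa_ge[OF a]])
      have "M \<alpha> (v0 (m \<alpha>)) t x \<ge> 0" "M \<alpha> ?w t x \<ge> 0"
        using less_imp_le[OF w0]
        by (intro vlasov.moment_nonneg[OF species[OF a]] t continuous_on_v0 cont_light_cone_momentum; simp add: v0_def)+
      then show "0 \<le> ?S" using l by simp
    qed
    finally show "\<bar>e \<alpha> * M \<alpha> (\<lambda>_. 1) t x\<bar> \<le> kappa * ?S" .
  qed
  also have "\<dots> = kappa * (l * particle_energy t x + particle_flux \<sigma> t x / l)"
    by (simp add: particle_energy_def particle_flux_def sum_distrib_left sum.distrib sum_divide_distrib distrib_left)
  also have "\<dots> \<le> kappa * (l * energy_density t x + light_flux \<sigma> t x / l)"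
    by (intro mult_left_mono add_mono divide_right_mono light_flux_ge(1) energy_density_ge(1) kappa_nonneg)
      (use assms in auto)
  finally show ?thesis .
qed

lemma energy_density_init:
  "energy_density 0 x = (\<Sum>\<alpha>=1..N. integral UNIV (\<lambda>v. f0 \<alpha> x v * v0 (m \<alpha>) v))
     + ((initial_E1 x)\<^sup>2 + (E20 x)\<^sup>2 + (B0 x)\<^sup>2) / 2"
proof -
  have "M \<alpha> (v0 (m \<alpha>)) 0 x = integral UNIV (\<lambda>v. f0 \<alpha> x v * v0 (m \<alpha>) v)" if "\<alpha> \<in> {1..N}" for \<alpha>
    by (simp add: vlasov.moment_def[OF species[OF that]] vlasov.f_initial[OF species[OF that]])
  moreover have "charge_density N e f 0 y = charge_density N e (\<lambda>\<alpha> t. f0 \<alpha>) 0 y" for y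
    unfolding charge_density_def charge_integrand_def
    by (intro Bochner_Integration.integral_cong refl sum.cong) (simp add: vlasov.f_initial[OF species])
  then have "E1 0 x = initial_E1 x" using E1_eq[of 0 x] by (simp add: initial_E1_def)
  ultimately show ?thesis by (simp add: energy_density_def E2_init B_init)
qed

text \<open>
  The potential increases in \<open>x\<close> because the energy density is nonnegative, and it is constant
  on both sides of the cone. Its range therefore is the same at all times, and its length is the
  energy of the data.
\<close>
lemma energy_potential:
  obtains \<phi> where "C1_halfplane \<phi> (\<lambda>t x. - momentum_density t x) energy_density"
    "\<And>t x. t \<ge> 0 \<Longrightarrow> 0 \<le> \<phi> t x" "\<And>t x. t \<ge> 0 \<Longrightarrow> \<phi> t x \<le> total_energy"
    "\<And>t x y. t \<ge> 0 \<Longrightarrow> x \<le> y \<Longrightarrow> \<phi> t x \<le> \<phi> t y"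
proof -
  obtain \<psi> where \<psi>: "C1_halfplane \<psi> (\<lambda>t x. - momentum_density t x) energy_density" by (rule energy_stream)
  define \<phi> where "\<phi> t x = \<psi> t x - \<psi> 0 (- C0)" for t x
  note out = stream_function_outside_cone[OF \<psi>, of C0, OF energy_outside_cone]
  have mono: "\<psi> t x \<le> \<psi> t y" if "t \<ge> 0" "x \<le> y" for t x y
    by (rule real_derivative_nonneg_mono[OF that(2), of "\<psi> t" "energy_density t"])
      (use C1_halfplane_x[OF \<psi> that(1)] energy_density_ge(3)[OF that(1)] in \<open>auto intro: has_field_derivative_at_within\<close>)
  have lo: "\<psi> t x \<ge> \<psi> 0 (- C0)" if "t \<ge> 0" for t x
    using mono[OF that, of "min x (- (C0 + t))" x] out(2)[of t "min x (- (C0 + t))"] that by simp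
  have hi: "\<psi> t x \<le> \<psi> 0 C0" if "t \<ge> 0" for t x
    using mono[OF that, of x "max x (C0 + t)"] out(1)[of t "max x (C0 + t)"] that by simp
  have "(energy_density 0 has_integral \<psi> 0 C0 - \<psi> 0 (- C0)) {- C0..C0}"
    using C1_halfplane_x[OF \<psi>] C0_pos
    by (intro fundamental_theorem_of_calculus)
      (auto simp: has_real_derivative_iff_has_vector_derivative[symmetric] intro: has_field_derivative_at_within)
  then have tot: "total_energy = \<psi> 0 C0 - \<psi> 0 (- C0)"
    unfolding total_energy_def energy_density_init[symmetric] by (simp add: integral_unique)
  show thesis
  proof
    show "C1_halfplane \<phi> (\<lambda>t x. - momentum_density t x) energy_density"
      by (rule C1_halfplane_diff_const[OF \<psi>]) (simp add: \<phi>_def)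
  qed (use lo hi mono tot in \<open>auto simp: \<phi>_def\<close>)
qed

lemma potential_along_light_line:
  assumes \<phi>: "C1_halfplane \<phi> (\<lambda>t x. - momentum_density t x) energy_density" and s: "\<bar>\<sigma>\<bar> = 1" and st: "s \<in> A" "A \<subseteq> {0..}"
  shows "((\<lambda>s. \<sigma> * \<phi> s (x - \<sigma> * (t - s))) has_real_derivative light_flux \<sigma> s (x - \<sigma> * (t - s))) (at s within A)"
proof -
  have X: "((\<lambda>s. x - \<sigma> * (t - s)) has_real_derivative \<sigma>) (at s within A)"
    by (auto intro!: derivative_eq_intros)
  have s2: "\<sigma> * \<sigma> = 1" using s by (metis abs_mult_self_eq mult_1)
  have "\<sigma> * (- momentum_density s (x - \<sigma> * (t - s)) + \<sigma> * energy_density s (x - \<sigma> * (t - s)))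
      = (\<sigma> * \<sigma>) * energy_density s (x - \<sigma> * (t - s)) - \<sigma> * momentum_density s (x - \<sigma> * (t - s))"
    by (simp add: algebra_simps)
  then show ?thesis
    using DERIV_cmult[OF C1_halfplane_along_curve[OF \<phi> X st(2,1)], of \<sigma>] s2
    by (simp add: light_flux_def)
qed

definition B_sup :: real where "B_sup = 2 * F0 + kappa * total_energy"

text \<open>
  The sources of \<open>E2 + \<sigma> * B\<close> along a light line are dominated by \<open>kappa\<close> times the derivative of
  \<open>\<sigma> * \<phi>\<close>, and \<open>\<phi>\<close> varies by at most the total energy.
\<close>
lemma B_bound:
  assumes t: "t \<ge> 0"
  shows "\<bar>B t x\<bar> \<le> B_sup"
proof -
  obtain \<phi> where \<phi>: "C1_halfplane \<phi> (\<lambda>t x. - momentum_density t x) energy_density"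
    and rng: "\<And>t x. t \<ge> 0 \<Longrightarrow> 0 \<le> \<phi> t x" "\<And>t x. t \<ge> 0 \<Longrightarrow> \<phi> t x \<le> total_energy"
    using energy_potential by metis
  have "\<bar>E2 t x + \<sigma> * B t x\<bar> \<le> B_sup" if s: "\<bar>\<sigma>\<bar> = 1" for \<sigma>
  proof -
    let ?X = "\<lambda>s. x - \<sigma> * (t - s)"
    let ?k = "\<lambda>s. kappa * (\<sigma> * \<phi> s (?X s))"
    have "\<bar>(E2 t (?X t) + \<sigma> * B t (?X t)) - (E2 0 (?X 0) + \<sigma> * B 0 (?X 0))\<bar> \<le> ?k t - ?k 0"
      by (rule real_derivative_comparison[OF t transverse_field_along_light_line[OF s]
            DERIV_cmult[OF potential_along_light_line[OF \<phi> s]]])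
        (use abs_j2_le[OF _ s] in auto)
    also have "\<dots> = kappa * (\<sigma> * (\<phi> t (?X t) - \<phi> 0 (?X 0)))" by (simp add: algebra_simps)
    also have "\<dots> \<le> kappa * total_energy"
    proof (rule mult_left_mono[OF _ kappa_nonneg])
      have "\<bar>\<sigma> * (\<phi> t (?X t) - \<phi> 0 (?X 0))\<bar> \<le> total_energy"
        unfolding abs_mult s using rng(1)[OF t, of "?X t"] rng(2)[OF t, of "?X t"] rng[of 0 "?X 0"] by auto
      then show "\<sigma> * (\<phi> t (?X t) - \<phi> 0 (?X 0)) \<le> total_energy" by linarith
    qed
    finally have "\<bar>(E2 t x + \<sigma> * B t x) - (E2 0 (?X 0) + \<sigma> * B 0 (?X 0))\<bar> \<le> kappa * total_energy" by simp
    moreover have "\<bar>E2 0 (?X 0) + \<sigma> * B 0 (?X 0)\<bar> \<le> 2 * F0"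
    proof -
      have "\<bar>\<sigma> * B 0 (?X 0)\<bar> \<le> F0" unfolding abs_mult s using fields_init_bound by (simp add: B_init)
      then show ?thesis using fields_init_bound[of "?X 0"] by (simp add: E2_init) linarith
    qed
    ultimately show ?thesis unfolding B_sup_def by linarith
  qed
  from this[of 1] this[of "-1"] show ?thesis by simp
qed

text \<open>
  The function \<open>A\<close> is a potential of the transverse fields. At time \<open>t\<close> the point \<open>x\<close> is joined to
  the left or to the right boundary of the cone, and \<open>\<bar>B\<bar>\<close> is integrated over that segment, of length at most \<open>L\<close>.
  The square integrability of \<open>B\<close> enters in the form \<open>2 * \<bar>B\<bar> \<le> sqrt L * B\<^sup>2 + 1 / sqrt L\<close>.
\<close>
lemma vector_potential_bound:
  assumes A: "C1_halfplane A (\<lambda>t x. - E2 t x) B"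
    and t: "t \<ge> 0" and x: "\<bar>x\<bar> \<le> C0 + t" and L: "L > 0"
  shows "x + C0 + t \<le> L \<Longrightarrow> \<bar>A t x - A 0 (- C0)\<bar> \<le> sqrt L * (total_energy + 1 / 2)"
    "C0 + t - x \<le> L \<Longrightarrow> \<bar>A t x - A 0 C0\<bar> \<le> sqrt L * (total_energy + 1 / 2)"
proof -
  obtain \<phi> where \<phi>: "C1_halfplane \<phi> (\<lambda>t x. - momentum_density t x) energy_density"
    and rng: "\<And>t x. t \<ge> 0 \<Longrightarrow> 0 \<le> \<phi> t x" "\<And>t x. t \<ge> 0 \<Longrightarrow> \<phi> t x \<le> total_energy"
    using energy_potential by metis
  have zero: "B t x = 0 \<and> E2 t x = 0" if "t \<ge> 0" "\<bar>x\<bar> \<ge> C0 + t" for t x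
    using transverse_fields_outside_cone that by auto
  let ?l = "sqrt L"
  have l: "?l > 0" "?l * ?l = L" using L by auto
  have seg: "\<bar>A t b - A t a\<bar> \<le> ?l * (total_energy + 1 / 2)" if ab: "a \<le> b" "b - a \<le> L" for a b
  proof -
    let ?k = "\<lambda>y. ?l * \<phi> t y + y / (2 * ?l)"
    have "\<bar>A t b - A t a\<bar> \<le> ?k b - ?k a"
    proof (rule real_derivative_comparison[OF ab(1), of "A t" "B t" ?k "\<lambda>y. ?l * energy_density t y + 1 / (2 * ?l)"])
      fix y
      show "(A t has_real_derivative B t y) (at y within {a..b})"
        using C1_halfplane_x[OF A t] by (rule has_field_derivative_at_within)
      have "(\<phi> t has_real_derivative energy_density t y) (at y within {a..b})"
        using C1_halfplane_x[OF \<phi> t] by (rule has_field_derivative_at_within)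
      then show "(?k has_real_derivative ?l * energy_density t y + 1 / (2 * ?l)) (at y within {a..b})"
        by (intro DERIV_add DERIV_cmult DERIV_cdivide DERIV_ident)
      have "\<bar>B t y\<bar> \<le> ?l * ((B t y)\<^sup>2 / 2) + 1 / (2 * ?l)"
      proof -
        have "2 * (?l * \<bar>B t y\<bar>) * 1 \<le> (?l * \<bar>B t y\<bar>)\<^sup>2 + 1\<^sup>2" by (rule sum_squares_bound)
        then show ?thesis using l(1) by (simp add: field_simps power2_eq_square)
      qed
      also have "\<dots> \<le> ?l * energy_density t y + 1 / (2 * ?l)"
        using energy_density_ge(2)[OF t, of y] l(1) by simp
      finally show "\<bar>B t y\<bar> \<le> ?l * energy_density t y + 1 / (2 * ?l)" .
    qed
    also have "\<dots> = ?l * (\<phi> t b - \<phi> t a) + (b - a) / (2 * ?l)"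
      by (simp add: algebra_simps diff_divide_distrib)
    also have "\<dots> \<le> ?l * total_energy + L / (2 * ?l)"
      using rng(1)[OF t, of a] rng(2)[OF t, of b] ab l(1)
      by (intro add_mono mult_left_mono divide_right_mono) auto
    also have "L / (2 * ?l) = ?l / 2" using l by (simp add: field_simps)
    finally show ?thesis by (simp add: algebra_simps)
  qed
  show "\<bar>A t x - A 0 (- C0)\<bar> \<le> ?l * (total_energy + 1 / 2)" if "x + C0 + t \<le> L"
    using seg[of "- (C0 + t)" x] stream_function_outside_cone(2)[OF A, of C0, OF zero t, of "- (C0 + t)"] x that by simp
  show "\<bar>A t x - A 0 C0\<bar> \<le> ?l * (total_energy + 1 / 2)" if "C0 + t - x \<le> L"
    using seg[of x "C0 + t"] stream_function_outside_cone(1)[OF A, of C0, OF zero t, of "C0 + t"] x that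
    by (simp add: abs_minus_commute)
qed

section \<open>Growth of momentum\<close>

abbreviation trajectory :: "nat \<Rightarrow> real \<Rightarrow> (real \<Rightarrow> real) \<Rightarrow> (real \<Rightarrow> real \<times> real) \<Rightarrow> bool" where
  "trajectory \<alpha> \<equiv> vlasov.characteristic (e \<alpha>) (m \<alpha>) E1 E2 B"

definition charge_sum :: real where "charge_sum = (\<Sum>\<alpha>=1..N. \<bar>e \<alpha>\<bar>)"
definition mass_sum :: real where "mass_sum = (\<Sum>\<alpha>=1..N. m \<alpha>)"

lemma abs_charge_le: "\<alpha> \<in> {1..N} \<Longrightarrow> \<bar>e \<alpha>\<bar> \<le> charge_sum"
  unfolding charge_sum_def by (rule member_le_sum) auto

lemma mass_le: "\<alpha> \<in> {1..N} \<Longrightarrow> m \<alpha> \<le> mass_sum"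
  unfolding mass_sum_def by (rule member_le_sum) (auto simp: less_imp_le m_pos)

lemma charge_sum_nonneg: "charge_sum \<ge> 0"
  unfolding charge_sum_def by (intro sum_nonneg) auto

lemma total_energy_nonneg: "total_energy \<ge> 0"
proof -
  obtain \<phi> where "C1_halfplane \<phi> (\<lambda>t x. - momentum_density t x) energy_density"
    and rng: "\<And>t x. t \<ge> 0 \<Longrightarrow> 0 \<le> \<phi> t x" "\<And>t x. t \<ge> 0 \<Longrightarrow> \<phi> t x \<le> total_energy"
    using energy_potential by metis
  from rng[of 0 0] show ?thesis by linarith
qed

lemma B_sup_nonneg: "B_sup \<ge> 0"
  using B_bound[of 0 0] abs_ge_zero[of "B 0 0"] by linarith

definition transverse_constant :: real where
  "transverse_constant = P0 / sqrt C0 + 2 * charge_sum * sqrt 2 * (total_energy + 1 / 2)"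

text \<open>
  Conservation of the canonical momentum \<open>v2 + e * A\<close>. The side of the cone to which the potential
  is compared is chosen by the sign of the position, which produces \<open>\<bar>X s\<bar>\<close> in the bound. The
  initial point lies in \<open>[- C0, C0]\<close> and is within \<open>2 * C0\<close> of either side.
\<close>
lemma v2_bound:
  assumes a: "\<alpha> \<in> {1..N}" and c: "trajectory \<alpha> T X V" and X0: "\<bar>X 0\<bar> < C0" and V0: "norm (V 0) \<le> P0"
    and s: "s \<in> {0..T}"
  shows "\<bar>snd (V s)\<bar> \<le> transverse_constant * sqrt (s - \<bar>X s\<bar> + 2 * C0)"
proof -
  obtain A where A: "C1_halfplane A (\<lambda>t x. - E2 t x) B"
  proof (rule stream_function[of B E2 Bt])
    show "(E2 t has_real_derivative - Bt t x) (at x)" if "t \<ge> 0" for t x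
      using C1_halfplane_x[OF E2_C1 that, of x] B_eq[OF that, of x] by (metis add_eq_0_iff)
  qed (use C1_halfplane_cont[OF B_C1] C1_halfplane_cont[OF E2_C1] B_C1 C1_halfplane_t[OF B_C1] in
      \<open>auto simp: C1_halfplane_def\<close>)
  let ?D = "s - \<bar>X s\<bar> + 2 * C0"
  have Xs: "\<bar>X s\<bar> < C0 + s"
    using vlasov.characteristic_speed[OF species[OF a] c, of 0 s] X0 s by auto
  have D: "?D > C0" using Xs by simp
  have "\<bar>(snd (V s) + e \<alpha> * A s (X s)) - (snd (V 0) + e \<alpha> * A 0 (X 0))\<bar> \<le> 0 - 0"
  proof (rule real_derivative_comparison[of 0 s "\<lambda>r. snd (V r) + e \<alpha> * A r (X r)" "\<lambda>_. 0" "\<lambda>_. 0" "\<lambda>_. 0"])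
    fix r assume r: "r \<in> {0..s}"
    have X: "(X has_real_derivative fst (vhat (m \<alpha>) (V r))) (at r within {0..s})"
      and V2: "((\<lambda>s. snd (V s)) has_real_derivative e \<alpha> * (E2 r (X r) - fst (vhat (m \<alpha>) (V r)) * B r (X r))) (at r within {0..s})"
      using vlasov.characteristic_subinterval[OF species[OF a] c s] r
      unfolding vlasov.characteristic_def[OF species[OF a]] vlasov.force2_def[OF species[OF a]] by auto
    show "((\<lambda>r. snd (V r) + e \<alpha> * A r (X r)) has_real_derivative 0) (at r within {0..s})"
      using DERIV_add[OF V2 DERIV_cmult[OF C1_halfplane_along_curve[OF A X], of "e \<alpha>"]] r
      by (simp add: algebra_simps)
  qed (use s in auto)
  then have cons: "snd (V s) = snd (V 0) - e \<alpha> * (A s (X s) - A 0 (X 0))" by (simp add: algebra_simps)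
  \<comment> \<open>the doubled length covers both the final and the initial point, since \<open>C0 < ?D\<close>\<close>
  let ?b = "sqrt (2 * ?D) * (total_energy + 1 / 2)"
  have dA: "\<bar>A s (X s) - A 0 (X 0)\<bar> \<le> 2 * ?b"
  proof (cases "X s \<le> 0")
    case True
    have "\<bar>A s (X s) - A 0 (- C0)\<bar> \<le> ?b"
      by (rule vector_potential_bound(1)[OF A]) (use s Xs D C0_pos True in auto)
    moreover have "\<bar>A 0 (X 0) - A 0 (- C0)\<bar> \<le> ?b"
      by (rule vector_potential_bound(1)[OF A]) (use X0 D C0_pos in auto)
    ultimately show ?thesis by linarith
  next
    case False
    have "\<bar>A s (X s) - A 0 C0\<bar> \<le> ?b"
      by (rule vector_potential_bound(2)[OF A]) (use s Xs D C0_pos False in auto)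
    moreover have "\<bar>A 0 (X 0) - A 0 C0\<bar> \<le> ?b"
      by (rule vector_potential_bound(2)[OF A]) (use X0 D C0_pos in auto)
    ultimately show ?thesis by linarith
  qed
  have "\<bar>snd (V s)\<bar> \<le> \<bar>snd (V 0)\<bar> + \<bar>e \<alpha>\<bar> * \<bar>A s (X s) - A 0 (X 0)\<bar>"
    unfolding cons abs_mult[symmetric] by linarith
  also have "\<dots> \<le> P0 + charge_sum * (2 * ?b)"
    using abs_component_le_norm(2)[of "V 0"] V0 dA
    by (intro add_mono mult_mono abs_charge_le a charge_sum_nonneg) auto
  also have "P0 \<le> P0 / sqrt C0 * sqrt ?D"
  proof -
    have "P0 / sqrt C0 * sqrt C0 \<le> P0 / sqrt C0 * sqrt ?D"
      using D P0_nonneg C0_pos by (intro mult_left_mono) auto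
    then show ?thesis using C0_pos by simp
  qed
  finally show ?thesis
    by (simp only: transverse_constant_def real_sqrt_mult) (simp add: algebra_simps)
qed

text \<open>
  The difference of the values of \<open>E1\<close> is an integral of the charge density, which
  \<open>abs_rho_le\<close> splits into energy with the weight \<open>l\<close> and flux with the weight \<open>1 / l\<close>. The energy in
  the window is at most the total energy; the flux is kept, to be integrated in time.
\<close>
lemma E1_near_light_line:
  assumes \<phi>: "C1_halfplane \<phi> (\<lambda>t x. - momentum_density t x) energy_density"
    and rng: "\<And>t x. t \<ge> 0 \<Longrightarrow> 0 \<le> \<phi> t x" "\<And>t x. t \<ge> 0 \<Longrightarrow> \<phi> t x \<le> total_energy"
    and s: "s \<ge> 0" and \<sigma>: "\<bar>\<sigma>\<bar> = 1" and d: "0 \<le> d" "d \<le> w" and l: "l > 0"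
  shows "\<bar>E1 s (y + \<sigma> * d) - E1 s y\<bar>
    \<le> kappa * (l * total_energy + integral {0..w} (\<lambda>a. light_flux \<sigma> s (y + \<sigma> * a)) / l)"
proof -
  have s2: "\<sigma> * \<sigma> = 1" using \<sigma> by (metis abs_mult_self_eq mult_1)
  have clf: "continuous_on {0..w} (\<lambda>a. light_flux \<sigma> s (y + \<sigma> * a))"
    unfolding light_flux_def
    by (intro continuous_on_diff continuous_on_mult_left continuous_on_curried[OF continuous_on_energy_momentum_density(1)]
        continuous_on_curried[OF continuous_on_energy_momentum_density(2)] continuous_intros) (use s in auto)
  have line: "((\<lambda>a. u s (y + \<sigma> * a)) has_real_derivative \<sigma> * ux s (y + \<sigma> * a)) (at a within S)"
    if "C1_halfplane u ut ux" for u ut ux a S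
  proof -
    have "((\<lambda>a. y + \<sigma> * a) has_real_derivative \<sigma>) (at a within S)"
      by (auto intro!: derivative_eq_intros)
    from DERIV_chain2[OF C1_halfplane_x[OF that s] this] show ?thesis
      by (simp only: mult.commute[of \<sigma> "ux s (y + \<sigma> * a)"])
  qed
  let ?I = "\<lambda>c. integral {0..c} (\<lambda>a. light_flux \<sigma> s (y + \<sigma> * a))"
  let ?k = "\<lambda>a. kappa * (l * (\<sigma> * \<phi> s (y + \<sigma> * a)) + ?I a / l)"
  have "\<bar>E1 s (y + \<sigma> * d) - E1 s (y + \<sigma> * 0)\<bar> \<le> ?k d - ?k 0"
  proof (rule real_derivative_comparison[OF d(1), of "\<lambda>a. E1 s (y + \<sigma> * a)" "\<lambda>a. \<sigma> * rho s (y + \<sigma> * a)"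
        ?k "\<lambda>a. kappa * (l * (\<sigma> * (\<sigma> * energy_density s (y + \<sigma> * a))) + light_flux \<sigma> s (y + \<sigma> * a) / l)"])
    fix a assume a: "a \<in> {0..d}"
    show "((\<lambda>a. E1 s (y + \<sigma> * a)) has_real_derivative \<sigma> * rho s (y + \<sigma> * a)) (at a within {0..d})"
      by (rule line[OF E1_C1])
    have "(?I has_real_derivative light_flux \<sigma> s (y + \<sigma> * a)) (at a within {0..w})"
      by (rule integral_has_real_derivative[OF clf]) (use a d in auto)
    then have "(?I has_real_derivative light_flux \<sigma> s (y + \<sigma> * a)) (at a within {0..d})"
      by (rule has_field_derivative_subset) (use d in auto)
    then show "(?k has_real_derivative kappa * (l * (\<sigma> * (\<sigma> * energy_density s (y + \<sigma> * a))) + light_flux \<sigma> s (y + \<sigma> * a) / l))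
        (at a within {0..d})"
      by (intro DERIV_cmult DERIV_add DERIV_cdivide line[OF \<phi>])
    show "\<bar>\<sigma> * rho s (y + \<sigma> * a)\<bar> \<le> kappa * (l * (\<sigma> * (\<sigma> * energy_density s (y + \<sigma> * a))) + light_flux \<sigma> s (y + \<sigma> * a) / l)"
      using abs_rho_le[OF s \<sigma> l, of "y + \<sigma> * a"] \<sigma> s2 by (simp add: abs_mult mult.assoc[symmetric])
  qed
  also have "?k d - ?k 0 = kappa * (l * (\<sigma> * (\<phi> s (y + \<sigma> * d) - \<phi> s y)) + ?I d / l)"
    by (simp add: algebra_simps)
  also have "\<dots> \<le> kappa * (l * total_energy + ?I w / l)"
  proof (intro mult_left_mono add_mono divide_right_mono kappa_nonneg)
    have "\<bar>\<sigma> * (\<phi> s (y + \<sigma> * d) - \<phi> s y)\<bar> \<le> total_energy"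
      unfolding abs_mult \<sigma> using rng(1)[OF s, of y] rng(2)[OF s, of y] rng(1)[OF s, of "y + \<sigma> * d"]
        rng(2)[OF s, of "y + \<sigma> * d"] by auto
    then show "\<sigma> * (\<phi> s (y + \<sigma> * d) - \<phi> s y) \<le> total_energy" by linarith
    show "?I d \<le> ?I w"
    proof (rule integral_subset_le)
      show "(\<lambda>a. light_flux \<sigma> s (y + \<sigma> * a)) integrable_on {0..w}"
        by (rule integrable_continuous_real[OF clf])
      show "(\<lambda>a. light_flux \<sigma> s (y + \<sigma> * a)) integrable_on {0..d}"
        by (rule integrable_continuous_real) (rule continuous_on_subset[OF clf], use d in auto)
    qed (use d light_flux_ge(3)[OF s \<sigma>] in auto)
  qed (use l in auto)
  finally show ?thesis by simp
qed

text \<open>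
  The flux through all light lines that meet a window of width \<open>w\<close> has the antiderivative
  \<open>\<sigma> * \<integral> \<phi>\<close> over the window, which varies by at most \<open>w\<close> times the energy.
\<close>
lemma window_potential:
  assumes \<phi>: "C1_halfplane \<phi> (\<lambda>t x. - momentum_density t x) energy_density"
    and rng: "\<And>t x. t \<ge> 0 \<Longrightarrow> 0 \<le> \<phi> t x" "\<And>t x. t \<ge> 0 \<Longrightarrow> \<phi> t x \<le> total_energy"
    and \<sigma>: "\<bar>\<sigma>\<bar> = 1" and w: "w \<ge> 0" and t1: "0 \<le> t1" "t1 \<le> t"
  obtains \<Phi> where
    "\<And>s. s \<in> {t1..t} \<Longrightarrow> (\<Phi> has_real_derivative
       integral {0..w} (\<lambda>a. light_flux \<sigma> s (x - \<sigma> * (t - s) + \<sigma> * a))) (at s within {t1..t})"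
    "\<Phi> t - \<Phi> t1 \<le> w * total_energy"
proof
  let ?g = "\<lambda>s a. \<sigma> * \<phi> s (x - \<sigma> * (t - s) + \<sigma> * a)"
  let ?\<Phi> = "\<lambda>s. integral {0..w} (?g s)"
  have cont: "continuous_on {0..w} (\<lambda>a. \<phi> s (x - \<sigma> * (t - s) + \<sigma> * a))" if "s \<in> {t1..t}" for s
    by (rule continuous_on_curried[OF C1_halfplane_cont[OF \<phi>], of "{0..w}" "\<lambda>_. s" "\<lambda>a. x - \<sigma> * (t - s) + \<sigma> * a"])
      (use that t1 in \<open>auto intro!: continuous_intros\<close>)
  show "(?\<Phi> has_real_derivative integral {0..w} (\<lambda>a. light_flux \<sigma> s (x - \<sigma> * (t - s) + \<sigma> * a))) (at s within {t1..t})"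
    if s: "s \<in> {t1..t}" for s
    unfolding interval_cbox
  proof (rule leibniz_rule_field_derivative)
    show "((\<lambda>s. ?g s a) has_real_derivative light_flux \<sigma> r (x - \<sigma> * (t - r) + \<sigma> * a)) (at r within cbox t1 t)"
      if "r \<in> cbox t1 t" for r a
      using potential_along_light_line[OF \<phi> \<sigma>, of r "cbox t1 t" "x + \<sigma> * a" t] that t1
      by (simp add: algebra_simps subset_iff)
    show "?g r integrable_on cbox 0 w" if "r \<in> cbox t1 t" for r
      using cont[of r] that
      by (intro integrable_continuous continuous_on_mult_left) auto
    have "continuous_on (cbox t1 t \<times> cbox 0 w) (\<lambda>p. light_flux \<sigma> (fst p) (x - \<sigma> * (t - fst p) + \<sigma> * snd p))"
      unfolding light_flux_def
      by (intro continuous_on_diff continuous_on_mult_left continuous_on_curried[OF continuous_on_energy_momentum_density(1)]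
          continuous_on_curried[OF continuous_on_energy_momentum_density(2)] continuous_intros) (use t1 in auto)
    then show "continuous_on (cbox t1 t \<times> cbox 0 w) (\<lambda>(s, a). light_flux \<sigma> s (x - \<sigma> * (t - s) + \<sigma> * a))"
      by (simp add: split_beta)
  qed (use s in auto)
  let ?J = "\<lambda>s. integral {0..w} (\<lambda>a. \<phi> s (x - \<sigma> * (t - s) + \<sigma> * a))"
  have J: "0 \<le> ?J s \<and> ?J s \<le> w * total_energy" if s: "s \<in> {t1..t}" for s
  proof
    have int: "(\<lambda>a. \<phi> s (x - \<sigma> * (t - s) + \<sigma> * a)) integrable_on {0..w}"
      by (rule integrable_continuous_real[OF cont[OF s]])
    show "0 \<le> ?J s"
      by (rule integral_nonneg[OF int]) (use rng(1) s t1 in auto)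
    have "?J s \<le> integral {0..w} (\<lambda>_. total_energy)"
      by (rule integral_le[OF int]) (use rng(2) s t1 in auto)
    then show "?J s \<le> w * total_energy" using w by simp
  qed
  have "\<bar>?\<Phi> t - ?\<Phi> t1\<bar> = \<bar>\<sigma> * (?J t - ?J t1)\<bar>"
    by (simp add: right_diff_distrib)
  also have "\<dots> \<le> w * total_energy"
    unfolding abs_mult \<sigma> using J[of t] J[of t1] t1 by auto
  finally show "?\<Phi> t - ?\<Phi> t1 \<le> w * total_energy" by linarith
qed

definition deviation_constant :: real where "deviation_constant = mass_sum\<^sup>2 / C0 + transverse_constant\<^sup>2"

definition growth_constant :: real where
  "growth_constant = charge_sum * ((total_energy + 1 / 2) / sqrt (sqrt C0)
     + kappa * (total_energy + deviation_constant * total_energy) + transverse_constant * B_sup)"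

text \<open>
  The force is compared with the derivative of the function \<open>?k\<close> below. Its terms belong to \<open>E1\<close> on
  the light line through the final position, to the difference of \<open>E1\<close> between this line and the
  particle, and to the magnetic force. The weight \<open>r / T\<close> in the second one, with \<open>T = sqrt t\<close> and
  \<open>r = sqrt (sqrt D)\<close>, is the square root of the ratio of the window width to \<open>t\<close>, up to a constant.
\<close>
lemma momentum_growth_along_light_line:
  assumes a: "\<alpha> \<in> {1..N}" and c: "trajectory \<alpha> t X V" and X0: "\<bar>X 0\<bar> < C0" and V0: "norm (V 0) \<le> P0"
    and t: "t > 0" and \<sigma>: "\<bar>\<sigma>\<bar> = 1"
    and D: "D = t - \<bar>X t\<bar> + 2 * C0" and R: "R = sqrt t * sqrt (sqrt D)"
    and t1: "0 \<le> t1" "t1 \<le> t" and fast: "\<And>s. s \<in> {t1..t} \<Longrightarrow> R \<le> \<sigma> * fst (V s)"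
  shows "\<bar>fst (V t) - fst (V t1)\<bar> \<le> growth_constant * R"
proof -
  obtain \<phi> where \<phi>: "C1_halfplane \<phi> (\<lambda>t x. - momentum_density t x) energy_density"
    and rng: "\<And>t x. t \<ge> 0 \<Longrightarrow> 0 \<le> \<phi> t x" "\<And>t x. t \<ge> 0 \<Longrightarrow> \<phi> t x \<le> total_energy"
    using energy_potential by metis
  note sp = species[OF a]
  have s2: "\<sigma> * \<sigma> = 1" using \<sigma> by (metis abs_mult_self_eq mult_1)
  have speed: "\<bar>X r - X s\<bar> \<le> r - s" if "0 \<le> s" "s \<le> r" "r \<le> t" for s r
    by (rule vlasov.characteristic_speed[OF sp c that])
  have DC: "D > C0" using speed[of 0 t] X0 t unfolding D by auto
  define T where "T = sqrt t"
  define r where "r = sqrt (sqrt D)"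
  define c4 where "c4 = sqrt (sqrt C0)"
  have T: "T > 0" "t = T * T" using t by (auto simp: T_def)
  have r: "r > 0" "sqrt D = r * r" using DC C0_pos by (auto simp: r_def)
  have c4: "c4 > 0" "c4 \<le> r" using DC C0_pos by (auto simp: c4_def r_def)
  have RT: "R = T * r" by (simp add: R T_def r_def)
  have Rpos: "R > 0" using T r by (simp add: RT)
  have DD: "D = (r * r) * (r * r)" using DC C0_pos by (simp add: r(2)[symmetric])
  have K2n: "transverse_constant \<ge> 0"
    unfolding transverse_constant_def using P0_nonneg charge_sum_nonneg total_energy_nonneg C0_pos by simp
  have v2: "\<bar>snd (V s)\<bar> \<le> transverse_constant * (r * r)" if s: "s \<in> {t1..t}" for s
  proof -
    have "s - \<bar>X s\<bar> + 2 * C0 \<le> D" using speed[of s t] s t1 unfolding D by auto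
    then have "transverse_constant * sqrt (s - \<bar>X s\<bar> + 2 * C0) \<le> transverse_constant * sqrt D" by (intro mult_left_mono K2n) simp
    then show ?thesis using v2_bound[OF a c X0 V0, of s] s t1 r(2) by simp
  qed
  define w where "w = deviation_constant * (r * r)"
  have K3n: "deviation_constant \<ge> 0" unfolding deviation_constant_def using C0_pos by simp
  have w0: "w \<ge> 0" unfolding w_def using K3n by simp
  have deficit: "1 - \<sigma> * fst (vhat (m \<alpha>) (V s)) \<le> w / t" "\<bar>snd (vhat (m \<alpha>) (V s))\<bar> \<le> transverse_constant * r / T"
    if s: "s \<in> {t1..t}" for s
  proof -
    note L = light_speed_deficit[OF m_pos[OF a] \<sigma> Rpos, of "fst (V s)" "snd (V s)", OF fast[OF s], unfolded prod.collapse]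
    have "(m \<alpha>)\<^sup>2 \<le> mass_sum\<^sup>2" using mass_le[OF a] m_pos[OF a] by (intro power_mono) auto
    also have "\<dots> \<le> mass_sum\<^sup>2 / C0 * D"
      using mult_left_mono[of C0 D "mass_sum\<^sup>2"] DC C0_pos by (simp add: field_simps)
    finally have m2: "(m \<alpha>)\<^sup>2 \<le> mass_sum\<^sup>2 / C0 * D" .
    have "(snd (V s))\<^sup>2 \<le> (transverse_constant * (r * r))\<^sup>2" using v2[OF s] by (metis abs_ge_zero power2_abs power_mono)
    also have "\<dots> = transverse_constant\<^sup>2 * D" by (simp add: DD power2_eq_square)
    finally have "(m \<alpha>)\<^sup>2 + (snd (V s))\<^sup>2 \<le> deviation_constant * D" using m2 by (simp add: deviation_constant_def distrib_right)
    then have "((m \<alpha>)\<^sup>2 + (snd (V s))\<^sup>2) / (R * R) \<le> deviation_constant * D / (R * R)" by (rule divide_right_mono) simp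
    also have "\<dots> = w / t" using T r by (simp add: DD RT w_def field_simps)
    finally show "1 - \<sigma> * fst (vhat (m \<alpha>) (V s)) \<le> w / t" using L(1) by linarith
    have "\<bar>snd (V s)\<bar> / R \<le> transverse_constant * (r * r) / R" using v2[OF s] Rpos by (intro divide_right_mono) auto
    also have "\<dots> = transverse_constant * r / T" using T r by (simp add: RT)
    finally show "\<bar>snd (vhat (m \<alpha>) (V s))\<bar> \<le> transverse_constant * r / T" using L(2) by linarith
  qed
  \<comment> \<open>the distance of the particle from the light line through its final position\<close>
  define d where "d s = \<sigma> * (X s - X t) + (t - s)" for s
  have X_eq: "X s = X t - \<sigma> * (t - s) + \<sigma> * d s" for s
    using s2 by (simp add: d_def algebra_simps mult.assoc[symmetric])
  have dX: "(X has_real_derivative fst (vhat (m \<alpha>) (V s))) (at s within S)"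
    and dV: "((\<lambda>s. fst (V s)) has_real_derivative e \<alpha> * (E1 s (X s) + snd (vhat (m \<alpha>) (V s)) * B s (X s))) (at s within S)"
    if "s \<in> {0..t}" "S \<subseteq> {0..t}" for s S
    using c that unfolding vlasov.characteristic_def[OF sp] vlasov.force1_def[OF sp]
    by (auto intro: has_field_derivative_subset)
  have d_range: "0 \<le> d s" "d s \<le> w" if s: "s \<in> {t1..t}" for s
  proof -
    have "\<bar>\<sigma> * (X s - X t)\<bar> \<le> t - s"
      unfolding abs_mult \<sigma> using speed[of s t] s t1 by (simp add: abs_minus_commute)
    then show "0 \<le> d s" unfolding d_def by linarith
    have "\<bar>d t - d s\<bar> \<le> w / t * t - w / t * s"
    proof (rule real_derivative_comparison[of s t d "\<lambda>q. \<sigma> * fst (vhat (m \<alpha>) (V q)) - 1" "\<lambda>q. w / t * q" "\<lambda>_. w / t"])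
      fix q assume q: "q \<in> {s..t}"
      have X: "(X has_real_derivative fst (vhat (m \<alpha>) (V q))) (at q within {s..t})"
        by (rule dX) (use q s t1 in auto)
      show "(d has_real_derivative \<sigma> * fst (vhat (m \<alpha>) (V q)) - 1) (at q within {s..t})"
        unfolding d_def by (auto intro!: derivative_eq_intros X)
      show "((\<lambda>q. w / t * q) has_real_derivative w / t) (at q within {s..t})"
        using t by (auto intro!: derivative_eq_intros)
      have "\<bar>\<sigma> * fst (vhat (m \<alpha>) (V q))\<bar> \<le> 1"
        unfolding abs_mult \<sigma> using abs_vhat_less_1(1)[OF m_pos[OF a], of "V q"] by simp
      then show "\<bar>\<sigma> * fst (vhat (m \<alpha>) (V q)) - 1\<bar> \<le> w / t"
        using deficit(1)[of q] q s by auto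
    qed (use s in auto)
    also have "\<dots> \<le> w"
      using t w0 s t1 by (simp add: field_simps)
    finally show "d s \<le> w" by (simp add: d_def)
  qed
  let ?l = "r / T" and ?y = "\<lambda>s. X t - \<sigma> * (t - s)"
  obtain \<Phi> where \<Phi>: "\<And>s. s \<in> {t1..t} \<Longrightarrow> (\<Phi> has_real_derivative
       integral {0..w} (\<lambda>a. light_flux \<sigma> s (?y s + \<sigma> * a))) (at s within {t1..t})"
    and \<Phi>_range: "\<Phi> t - \<Phi> t1 \<le> w * total_energy"
    using window_potential[OF \<phi> rng \<sigma> w0 t1, of "X t"] by blast
  let ?G = "\<lambda>s. integral {0..w} (\<lambda>a. light_flux \<sigma> s (?y s + \<sigma> * a))"
  let ?k' = "\<lambda>s. charge_sum * ((T * light_flux \<sigma> s (?y s) + 1 / (2 * T))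
      + kappa * (?l * total_energy + ?G s / ?l) + transverse_constant * r / T * B_sup)"
  let ?k = "\<lambda>s. charge_sum * ((T * (\<sigma> * \<phi> s (?y s)) + s / (2 * T))
      + kappa * (?l * total_energy * s + \<Phi> s / ?l) + transverse_constant * r / T * B_sup * s)"
  have "\<bar>fst (V t) - fst (V t1)\<bar> \<le> ?k t - ?k t1"
  proof (rule real_derivative_comparison[OF t1(2), of "\<lambda>s. fst (V s)" _ ?k ?k'])
    fix s assume s: "s \<in> {t1..t}"
    then have s0: "s \<ge> 0" using t1 by simp
    show "((\<lambda>s. fst (V s)) has_real_derivative e \<alpha> * (E1 s (X s) + snd (vhat (m \<alpha>) (V s)) * B s (X s))) (at s within {t1..t})"
      by (rule dV) (use s t1 in auto)
    have pot: "((\<lambda>s. \<sigma> * \<phi> s (?y s)) has_real_derivative light_flux \<sigma> s (?y s)) (at s within {t1..t})"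
      by (rule potential_along_light_line[OF \<phi> \<sigma> s]) (use t1 in auto)
    have "((\<lambda>s. b * s) has_real_derivative b) (at s within {t1..t})" for b
      by (auto intro!: derivative_eq_intros)
    then show "(?k has_real_derivative ?k' s) (at s within {t1..t})"
      by (intro DERIV_cmult DERIV_add DERIV_cdivide DERIV_ident pot \<Phi> s)
    have "\<bar>E1 s (?y s)\<bar> \<le> T * ((E1 s (?y s))\<^sup>2 / 2) + 1 / (2 * T)"
    proof -
      have "2 * (T * \<bar>E1 s (?y s)\<bar>) * 1 \<le> (T * \<bar>E1 s (?y s)\<bar>)\<^sup>2 + 1\<^sup>2" by (rule sum_squares_bound)
      then show ?thesis using T(1) by (simp add: field_simps power2_eq_square)
    qed
    also have "\<dots> \<le> T * light_flux \<sigma> s (?y s) + 1 / (2 * T)"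
      using light_flux_ge(2)[OF s0 \<sigma>, of "?y s"] T(1) by (intro add_mono mult_left_mono) auto
    finally have E: "\<bar>E1 s (?y s)\<bar> \<le> T * light_flux \<sigma> s (?y s) + 1 / (2 * T)" .
    have dE: "\<bar>E1 s (X s) - E1 s (?y s)\<bar> \<le> kappa * (?l * total_energy + ?G s / ?l)"
      using E1_near_light_line[OF \<phi> rng s0 \<sigma> d_range[OF s], of ?l "?y s"] T r unfolding X_eq[of s, symmetric] by simp
    have vB: "\<bar>snd (vhat (m \<alpha>) (V s)) * B s (X s)\<bar> \<le> transverse_constant * r / T * B_sup"
      unfolding abs_mult using deficit(2)[OF s] B_bound[OF s0] K2n r T
      by (intro mult_mono) auto
    have "\<bar>E1 s (X s) + snd (vhat (m \<alpha>) (V s)) * B s (X s)\<bar> \<le> (T * light_flux \<sigma> s (?y s) + 1 / (2 * T))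
      + kappa * (?l * total_energy + ?G s / ?l) + transverse_constant * r / T * B_sup"
      using E dE vB by linarith
    then show "\<bar>e \<alpha> * (E1 s (X s) + snd (vhat (m \<alpha>) (V s)) * B s (X s))\<bar> \<le> ?k' s"
      unfolding abs_mult by (intro mult_mono abs_charge_le a charge_sum_nonneg) auto
  qed
  also have "\<dots> = charge_sum * ((T * (\<sigma> * (\<phi> t (?y t) - \<phi> t1 (?y t1))) + (t - t1) / (2 * T))
      + kappa * (?l * total_energy * (t - t1) + (\<Phi> t - \<Phi> t1) / ?l) + transverse_constant * r / T * B_sup * (t - t1))"
    by (simp add: algebra_simps diff_divide_distrib)
  also have "\<dots> \<le> charge_sum * ((T * total_energy + t / (2 * T))
      + kappa * (?l * total_energy * t + w * total_energy / ?l) + transverse_constant * r / T * B_sup * t)"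
  proof (intro mult_left_mono add_mono divide_right_mono charge_sum_nonneg kappa_nonneg \<Phi>_range)
    have "\<bar>\<sigma> * (\<phi> t (?y t) - \<phi> t1 (?y t1))\<bar> \<le> total_energy"
      unfolding abs_mult \<sigma> using rng[of t "?y t"] rng[of t1 "?y t1"] t1 t by auto
    then show "\<sigma> * (\<phi> t (?y t) - \<phi> t1 (?y t1)) \<le> total_energy" by linarith
  qed (use T r t1 K2n B_sup_nonneg total_energy_nonneg in auto)
  also have "\<dots> = charge_sum * (T * (total_energy + 1 / 2)
      + kappa * (total_energy + deviation_constant * total_energy) * R + transverse_constant * B_sup * R)"
    using T r by (simp add: RT w_def field_simps)
  also have "\<dots> \<le> charge_sum * ((total_energy + 1 / 2) / c4 * R
      + kappa * (total_energy + deviation_constant * total_energy) * R + transverse_constant * B_sup * R)"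
  proof (intro mult_left_mono add_right_mono charge_sum_nonneg)
    have "T * (total_energy + 1 / 2) * c4 \<le> T * (total_energy + 1 / 2) * r"
      using T c4 total_energy_nonneg by (intro mult_left_mono) auto
    then show "T * (total_energy + 1 / 2) \<le> (total_energy + 1 / 2) / c4 * R"
      using c4 by (simp add: RT field_simps)
  qed
  also have "\<dots> = growth_constant * R" by (simp add: growth_constant_def c4_def algebra_simps)
  finally show ?thesis .
qed

definition momentum_constant :: real where "momentum_constant = P0 + 1 + growth_constant"

text \<open>
  The bound for \<open>\<sigma> * v1\<close> follows from the growth after the last time at which it was at most \<open>R\<close>;
  the two signs of \<open>\<sigma>\<close> together bound \<open>\<bar>v1\<bar>\<close>.
\<close>
lemma momentum_bound:
  assumes a: "\<alpha> \<in> {1..N}" and t: "t \<ge> 0" and f: "f \<alpha> t x v \<noteq> 0"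
  shows "\<bar>fst v\<bar> \<le> momentum_constant + momentum_constant * (sqrt t * sqrt (sqrt (t - \<bar>x\<bar> + 2 * C0)))"
proof -
  note sp = species[OF a]
  obtain X V where c: "trajectory \<alpha> t X V" and XV: "X t = x" "V t = v" "\<bar>X 0\<bar> < C0" "norm (V 0) \<le> P0"
    using vlasov.backward_characteristic[OF sp t f] by metis
  define R where "R = sqrt t * sqrt (sqrt (t - \<bar>x\<bar> + 2 * C0))"
  have x: "\<bar>x\<bar> < C0 + t"
    using vlasov.f_space_support[OF sp t] f by (meson not_le)
  have R0: "R \<ge> 0" using x t C0_pos by (simp add: R_def)
  have K4n: "growth_constant \<ge> 0"
    unfolding growth_constant_def deviation_constant_def transverse_constant_def using P0_nonneg charge_sum_nonneg total_energy_nonneg C0_pos kappa_nonneg B_sup_nonneg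
    by simp
  have V0: "\<bar>fst (V 0)\<bar> \<le> P0" using abs_component_le_norm(1)[of "V 0"] XV(4) by linarith
  have bound: "\<sigma> * fst v \<le> P0 + (1 + growth_constant) * R" if \<sigma>: "\<bar>\<sigma>\<bar> = 1" for \<sigma>
  proof (cases "t = 0")
    case True
    have "\<bar>\<sigma> * fst v\<bar> \<le> P0" unfolding abs_mult \<sigma> using V0 XV True by simp
    then show ?thesis using R0 K4n by (smt (verit) mult_nonneg_nonneg)
  next
    case False
    have cont: "continuous_on {0..t} (\<lambda>s. \<sigma> * fst (V s))"
      using c unfolding vlasov.characteristic_def[OF sp]
      by (intro continuous_on_mult_left) (auto intro!: DERIV_continuous_on)
    have s0: "\<sigma> * fst (V 0) \<le> P0"
      using V0 \<sigma> abs_le_D1[of "\<sigma> * fst (V 0)" "\<bar>fst (V 0)\<bar>"] by (simp add: abs_mult)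
    show ?thesis
      using t cont
    proof (rule last_crossing[of t _ R])
      assume "\<sigma> * fst (V t) \<le> R"
      moreover have "0 \<le> growth_constant * R" using K4n R0 by simp
      ultimately show ?thesis using XV(2) P0_nonneg by (simp add: distrib_right)
    next
      fix t1 assume t1: "t1 \<in> {0..t}" "\<sigma> * fst (V t1) \<le> max (\<sigma> * fst (V 0)) R"
        "\<And>s. s \<in> {t1..t} \<Longrightarrow> R \<le> \<sigma> * fst (V s)"
      have "\<bar>fst (V t) - fst (V t1)\<bar> \<le> growth_constant * R"
        by (rule momentum_growth_along_light_line[OF a c XV(3,4) _ \<sigma> refl, of R t1])
          (use t t1 False XV in \<open>auto simp: R_def\<close>)
      then have "\<bar>\<sigma> * (fst (V t) - fst (V t1))\<bar> \<le> growth_constant * R" unfolding abs_mult \<sigma> by simp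
      then have "\<sigma> * fst v \<le> \<sigma> * fst (V t1) + growth_constant * R" using XV(2) by (simp add: right_diff_distrib)
      also have "\<dots> \<le> P0 + R + growth_constant * R" using t1(2) s0 R0 P0_nonneg by auto
      finally show ?thesis by (simp add: distrib_right)
    qed
  qed
  have "\<bar>fst v\<bar> \<le> P0 + (1 + growth_constant) * R"
    using bound[of 1] bound[of "-1"] by simp
  also have "\<dots> \<le> momentum_constant + momentum_constant * R"
    unfolding momentum_constant_def using K4n R0 P0_nonneg
    by (intro add_mono mult_right_mono) auto
  finally show ?thesis by (simp add: R_def)
qed

end

section \<open>Solutions and their partial derivatives\<close>

lemma C1_on_halfplaneE:
  assumes "C1_on ({0..} \<times> UNIV) (\<lambda>(t, x). u t x)"
  obtains ut ux where "C1_halfplane u ut ux"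
proof -
  obtain u' where u': "\<forall>z\<in>{0..} \<times> UNIV. ((\<lambda>(t, x). u t x) has_derivative blinfun_apply (u' z)) (at z within {0..} \<times> UNIV)"
    and cont: "continuous_on ({0..} \<times> UNIV) u'"
    using assms unfolding C1_on_def by blast
  define ut where "ut t x = blinfun_apply (u' (t, x)) (1, 0)" for t x
  define ux where "ux t x = blinfun_apply (u' (t, x)) (0, 1)" for t x
  have lin: "blinfun_apply (u' (t, x)) = (\<lambda>(dt, dx). dt * ut t x + dx * ux t x)" for t x
  proof
    fix h :: "real \<times> real"
    have "h = fst h *\<^sub>R (1, 0) + snd h *\<^sub>R (0, 1)" by (cases h) simp
    then have "blinfun_apply (u' (t, x)) h = blinfun_apply (u' (t, x)) (fst h *\<^sub>R (1, 0) + snd h *\<^sub>R (0, 1))"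
      by (rule arg_cong)
    then show "blinfun_apply (u' (t, x)) h = (case h of (dt, dx) \<Rightarrow> dt * ut t x + dx * ux t x)"
      by (simp only: blinfun.add_right blinfun.scaleR_right) (simp add: ut_def ux_def split_beta)
  qed
  have "C1_halfplane u ut ux"
    unfolding C1_halfplane_def
  proof (intro conjI allI impI)
    fix t x :: real assume "t \<ge> 0"
    then show "((\<lambda>(t, x). u t x) has_derivative (\<lambda>(dt, dx). dt * ut t x + dx * ux t x)) (at (t, x) within {0..} \<times> UNIV)"
      using u' unfolding lin[symmetric] by auto
  qed (auto simp: ut_def ux_def split_beta intro!: continuous_intros cont)
  then show thesis by (rule that)
qed

lemma C1_on_phaseE:
  assumes "C1_on ({0..} \<times> UNIV) (\<lambda>(t, x, v). u t x v)"
  obtains ut ux u1 u2 where "C1_phase u ut ux u1 u2"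
proof -
  obtain u' where u': "\<forall>z\<in>{0..} \<times> UNIV. ((\<lambda>(t, x, v). u t x v) has_derivative blinfun_apply (u' z)) (at z within {0..} \<times> UNIV)"
    and cont: "continuous_on ({0..} \<times> UNIV) u'"
    using assms unfolding C1_on_def by blast
  define ut where "ut t x v = blinfun_apply (u' (t, x, v)) (1, 0, 0, 0)" for t x v
  define ux where "ux t x v = blinfun_apply (u' (t, x, v)) (0, 1, 0, 0)" for t x v
  define u1 where "u1 t x v = blinfun_apply (u' (t, x, v)) (0, 0, 1, 0)" for t x v
  define u2 where "u2 t x v = blinfun_apply (u' (t, x, v)) (0, 0, 0, 1)" for t x v
  have lin: "blinfun_apply (u' (t, x, v)) = (\<lambda>(dt, dx, da, db). dt * ut t x v + dx * ux t x v + da * u1 t x v + db * u2 t x v)" for t x v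
  proof
    fix h :: "real \<times> real \<times> real \<times> real"
    obtain dt dx da db where h: "h = (dt, dx, da, db)" by (metis surj_pair)
    have "h = dt *\<^sub>R (1, 0, 0, 0) + dx *\<^sub>R (0, 1, 0, 0) + da *\<^sub>R (0, 0, 1, 0) + db *\<^sub>R (0, 0, 0, 1)" by (simp add: h)
    then have "blinfun_apply (u' (t, x, v)) h
        = blinfun_apply (u' (t, x, v)) (dt *\<^sub>R (1, 0, 0, 0) + dx *\<^sub>R (0, 1, 0, 0) + da *\<^sub>R (0, 0, 1, 0) + db *\<^sub>R (0, 0, 0, 1))"
      by (rule arg_cong)
    then show "blinfun_apply (u' (t, x, v)) h
        = (case h of (dt, dx, da, db) \<Rightarrow> dt * ut t x v + dx * ux t x v + da * u1 t x v + db * u2 t x v)"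
      by (simp only: blinfun.add_right blinfun.scaleR_right) (simp add: h ut_def ux_def u1_def u2_def)
  qed
  have "C1_phase u ut ux u1 u2"
    unfolding C1_phase_def
  proof (intro conjI allI impI)
    fix t x a b :: real assume "t \<ge> 0"
    then show "((\<lambda>(t, x, v). u t x v) has_derivative
        (\<lambda>(dt, dx, da, db). dt * ut t x (a, b) + dx * ux t x (a, b) + da * u1 t x (a, b) + db * u2 t x (a, b)))
        (at (t, x, a, b) within {0..} \<times> UNIV)"
      using u' unfolding lin[symmetric] by auto
  qed (auto simp: ut_def ux_def u1_def u2_def split_beta intro!: continuous_intros cont)
  then show thesis by (rule that)
qed

lemma vanishing_outside_ball:
  fixes g :: "'a::real_normed_vector \<Rightarrow> 'b::real_normed_vector"
  assumes "compact (closure {z. g z \<noteq> 0})"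
  obtains R where "R \<ge> 0" "\<And>z. norm z > R \<Longrightarrow> g z = 0"
proof -
  obtain R where R: "\<forall>z\<in>closure {z. g z \<noteq> 0}. norm z \<le> R"
    using compact_imp_bounded[OF assms] unfolding bounded_iff by blast
  have "g z = 0" if "norm z > max R 0" for z
  proof (rule ccontr)
    assume "g z \<noteq> 0"
    then have "z \<in> closure {z. g z \<noteq> 0}" using closure_subset by fast
    then show False using R that by auto
  qed
  then show thesis by (rule that[OF max.cobounded2])
qed

lemma bounded_if_compact_support:
  fixes g :: "real \<Rightarrow> real"
  assumes "continuous_on UNIV g" "compact (closure {x. g x \<noteq> 0})"
  obtains K where "\<And>x. \<bar>g x\<bar> \<le> K"
proof -
  have "bounded (g ` closure {x. g x \<noteq> 0})"
    by (intro compact_imp_bounded compact_continuous_image assms continuous_on_subset[OF assms(1)]) auto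
  then obtain K where K: "\<forall>y\<in>g ` closure {x. g x \<noteq> 0}. norm y \<le> K"
    unfolding bounded_iff by blast
  show thesis
  proof (rule that[of "max K 0"])
    fix x
    show "\<bar>g x\<bar> \<le> max K 0"
    proof (cases "g x = 0")
      case False
      then have "g x \<in> g ` closure {x. g x \<noteq> 0}" using closure_subset by fast
      then show ?thesis using K by fastforce
    qed simp
  qed
qed

lemma C1_on_imp_continuous_on: "C1_on S g \<Longrightarrow> continuous_on S g"
  unfolding C1_on_def by (meson continuous_on_eq_continuous_within has_derivative_continuous)

lemma admissible_data_bounds:
  assumes "admissible_data N C0 f0 E20 B0"
  obtains P0 F0 where "P0 \<ge> 0" "\<And>\<alpha> x v. \<alpha> \<in> {1..N} \<Longrightarrow> f0 \<alpha> x v \<noteq> 0 \<Longrightarrow> \<bar>x\<bar> < C0 \<and> norm v \<le> P0"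
    "\<And>x. \<bar>E20 x\<bar> \<le> F0 \<and> \<bar>B0 x\<bar> \<le> F0"
proof -
  have "\<exists>R\<ge>0. \<forall>x v. f0 \<alpha> x v \<noteq> 0 \<longrightarrow> norm v \<le> R" if "\<alpha> \<in> {1..N}" for \<alpha>
  proof -
    have "compact (closure {z. (\<lambda>(x, v). f0 \<alpha> x v) z \<noteq> 0})"
      using assms that by (simp add: admissible_data_def case_prod_unfold)
    then obtain R where R: "R \<ge> 0" "\<And>z. norm z > R \<Longrightarrow> (\<lambda>(x, v). f0 \<alpha> x v) z = 0"
      using vanishing_outside_ball by blast
    have "norm v \<le> R" if "f0 \<alpha> x v \<noteq> 0" for x v
      using R(2)[of "(x, v)"] that norm_snd_le[of v x] by force
    then show ?thesis using R(1) by blast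
  qed
  then obtain R where R: "\<And>\<alpha>. \<alpha> \<in> {1..N} \<Longrightarrow> R \<alpha> \<ge> 0" "\<And>\<alpha> x v. \<alpha> \<in> {1..N} \<Longrightarrow> f0 \<alpha> x v \<noteq> 0 \<Longrightarrow> norm v \<le> R \<alpha>"
    by metis
  obtain KE where KE: "\<And>x. \<bar>E20 x\<bar> \<le> KE"
    using bounded_if_compact_support[of E20] assms C1_on_imp_continuous_on
    unfolding admissible_data_def by metis
  obtain KB where KB: "\<And>x. \<bar>B0 x\<bar> \<le> KB"
    using bounded_if_compact_support[of B0] assms C1_on_imp_continuous_on
    unfolding admissible_data_def by metis
  show thesis
  proof (rule that[of "\<Sum>\<alpha>=1..N. R \<alpha>" "max KE KB"])
    show "0 \<le> (\<Sum>\<alpha>=1..N. R \<alpha>)" by (intro sum_nonneg R)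
    fix \<alpha> x v assume a: "\<alpha> \<in> {1..N}" "f0 \<alpha> x v \<noteq> 0"
    have "norm v \<le> R \<alpha>" by (rule R(2)[OF a])
    also have "R \<alpha> \<le> (\<Sum>\<alpha>=1..N. R \<alpha>)" by (rule member_le_sum) (use a R(1) in auto)
    finally show "\<bar>x\<bar> < C0 \<and> norm v \<le> (\<Sum>\<alpha>=1..N. R \<alpha>)"
      using assms a unfolding admissible_data_def by (metis not_le)
  qed (use KE KB in \<open>auto simp: le_max_iff_disj\<close>)
qed

text \<open>
  The system is stated with partial derivatives of unspecified existence; continuous
  differentiability identifies them with components of the total derivatives.
\<close>
lemma global_C1_solution_vlasov_maxwell:
  assumes sol: "global_C1_solution N e m f0 E20 B0 f E1 E2 B"
    and mass: "\<And>\<alpha>. \<alpha> \<in> {1..N} \<Longrightarrow> m \<alpha> > 0"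
    and data: "admissible_data N C0 f0 E20 B0"
    and neutral: "neutral N e f0"
    and P0: "P0 \<ge> 0" "\<And>\<alpha> x v. \<alpha> \<in> {1..N} \<Longrightarrow> f0 \<alpha> x v \<noteq> 0 \<Longrightarrow> \<bar>x\<bar> < C0 \<and> norm v \<le> P0"
    and F0: "\<And>x. \<bar>E20 x\<bar> \<le> F0 \<and> \<bar>B0 x\<bar> \<le> F0"
  obtains ft fx f1 f2 E1t E1x E2t E2x Bt Bx where
    "vlasov_maxwell N e m C0 P0 F0 f0 E20 B0 f ft fx f1 f2 E1 E2 B E1t E1x E2t E2x Bt Bx"
proof -
  note S = sol[unfolded global_C1_solution_def]
  have C1: "\<forall>\<alpha>\<in>{1..N}. C1_on ({0..} \<times> UNIV) (\<lambda>(t, x, v). f \<alpha> t x v)"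
    "C1_on ({0..} \<times> UNIV) (\<lambda>(t, x). E1 t x)" "C1_on ({0..} \<times> UNIV) (\<lambda>(t, x). E2 t x)"
    "C1_on ({0..} \<times> UNIV) (\<lambda>(t, x). B t x)"
    using S by - (elim conjE, assumption)+
  have pde: "\<forall>\<alpha>\<in>{1..N}. \<forall>t\<ge>0. \<forall>x v1 v2.
        vector_derivative (\<lambda>s. f \<alpha> s x (v1, v2)) (at t within {0..})
        + fst (vhat (m \<alpha>) (v1, v2)) * deriv (\<lambda>y. f \<alpha> t y (v1, v2)) x
        + e \<alpha> * (E1 t x + snd (vhat (m \<alpha>) (v1, v2)) * B t x) * deriv (\<lambda>w. f \<alpha> t x (w, v2)) v1
        + e \<alpha> * (E2 t x - fst (vhat (m \<alpha>) (v1, v2)) * B t x) * deriv (\<lambda>w. f \<alpha> t x (v1, w)) v2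
        = 0"
    using S by - (elim conjE, assumption)
  have int: "\<forall>t\<ge>0. \<forall>x. integrable lborel (charge_integrand N e (\<lambda>\<alpha>. f \<alpha> t x)) \<and>
                 integrable lborel (current_integrand N e m (\<lambda>\<alpha>. f \<alpha> t x))"
    "\<forall>t\<ge>0. integrable lborel (charge_density N e f t)"
    using S by - (elim conjE, assumption)+
  have gauss: "\<forall>t\<ge>0. \<forall>x. E1 t x = 1/2 * (LINT y:{..x}|lborel. charge_density N e f t y)
                        - 1/2 * (LINT y:{x..}|lborel. charge_density N e f t y)"
    and ampere: "\<forall>t\<ge>0. \<forall>x. vector_derivative (\<lambda>s. E2 s x) (at t within {0..}) + deriv (B t) x
                 = - snd (current_density N e m f t x)"
    and faraday: "\<forall>t\<ge>0. \<forall>x. vector_derivative (\<lambda>s. B s x) (at t within {0..}) + deriv (E2 t) x = 0"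
    and init: "\<forall>\<alpha>\<in>{1..N}. \<forall>x v. f \<alpha> 0 x v = f0 \<alpha> x v" "\<forall>x. E2 0 x = E20 x" "\<forall>x. B 0 x = B0 x"
    using S by - (elim conjE, assumption)+
  have "\<forall>\<alpha>\<in>{1..N}. \<exists>ft fx f1 f2. C1_phase (f \<alpha>) ft fx f1 f2"
    using C1(1) C1_on_phaseE by metis
  then obtain ft fx f1 f2 where f: "\<And>\<alpha>. \<alpha> \<in> {1..N} \<Longrightarrow> C1_phase (f \<alpha>) (ft \<alpha>) (fx \<alpha>) (f1 \<alpha>) (f2 \<alpha>)"
    by metis
  obtain E1t E1x where E1: "C1_halfplane E1 E1t E1x" using C1_on_halfplaneE[OF C1(2)] .
  obtain E2t E2x where E2: "C1_halfplane E2 E2t E2x" using C1_on_halfplaneE[OF C1(3)] .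
  obtain Bt Bx where B: "C1_halfplane B Bt Bx" using C1_on_halfplaneE[OF C1(4)] .
  have vd: "vector_derivative g (at t within {0..}) = g'"
    if "(g has_real_derivative g') (at t within {0..})" "t \<ge> 0" for g :: "real \<Rightarrow> real" and g' t
    using that at_within_Ici_neq_bot[OF that(2)]
    by (intro vector_derivative_within) (auto simp: has_real_derivative_iff_has_vector_derivative)
  have "vlasov_maxwell N e m C0 P0 F0 f0 E20 B0 f ft fx f1 f2 E1 E2 B E1t E1x E2t E2x Bt Bx"
  proof (rule vlasov_maxwell.intro)
    fix \<alpha> assume a: "\<alpha> \<in> {1..N}"
    show "vlasov (e \<alpha>) (m \<alpha>) C0 P0 (f0 \<alpha>) (f \<alpha>) (ft \<alpha>) (fx \<alpha>) (f1 \<alpha>) (f2 \<alpha>) E1 E2 B E1t E1x E2t E2x Bt Bx"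
    proof (rule vlasov.intro)
      fix t x :: real and v :: "real \<times> real" assume t: "t \<ge> 0"
      obtain v1 v2 where v: "v = (v1, v2)" by force
      have "vector_derivative (\<lambda>s. f \<alpha> s x (v1, v2)) (at t within {0..}) = ft \<alpha> t x (v1, v2)"
        by (rule vd[OF C1_phase_t[OF f[OF a] t] t])
      moreover have "deriv (\<lambda>y. f \<alpha> t y (v1, v2)) x = fx \<alpha> t x (v1, v2)"
        by (rule DERIV_imp_deriv[OF C1_phase_x[OF f[OF a] t]])
      moreover have "deriv (\<lambda>w. f \<alpha> t x (w, v2)) v1 = f1 \<alpha> t x (v1, v2)"
        by (rule DERIV_imp_deriv[OF C1_phase_1[OF f[OF a] t]])
      moreover have "deriv (\<lambda>w. f \<alpha> t x (v1, w)) v2 = f2 \<alpha> t x (v1, v2)"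
        by (rule DERIV_imp_deriv[OF C1_phase_2[OF f[OF a] t]])
      ultimately show "ft \<alpha> t x v + fst (vhat (m \<alpha>) v) * fx \<alpha> t x v
        + e \<alpha> * (E1 t x + snd (vhat (m \<alpha>) v) * B t x) * f1 \<alpha> t x v
        + e \<alpha> * (E2 t x - fst (vhat (m \<alpha>) v) * B t x) * f2 \<alpha> t x v = 0"
        using pde[rule_format, OF a t, of x v1 v2] by (simp add: v)
    qed (use a mass f E1 E2 B init P0 data in \<open>auto simp: admissible_data_def\<close>)
  next
    fix t x :: real assume t: "t \<ge> 0"
    show "E2t t x + Bx t x = - snd (current_density N e m f t x)"
      using ampere[rule_format, OF t, of x] vd[OF C1_halfplane_t[OF E2 t, of x] t]
        DERIV_imp_deriv[OF C1_halfplane_x[OF B t, of x]] by simp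
    show "Bt t x + E2x t x = 0"
      using faraday[rule_format, OF t, of x] vd[OF C1_halfplane_t[OF B t, of x] t]
        DERIV_imp_deriv[OF C1_halfplane_x[OF E2 t, of x]] by simp
    show "E1 t x = 1/2 * (LINT y:{..x}|lborel. charge_density N e f t y)
                        - 1/2 * (LINT y:{x..}|lborel. charge_density N e f t y)"
      using gauss t by blast
  qed (use data neutral P0 F0 E1 E2 B int init in \<open>auto simp: admissible_data_def\<close>)
  then show thesis by (rule that)
qed

section \<open>The momentum bound\<close>

theorem theorem1p4:
  fixes N :: nat and e m :: "nat \<Rightarrow> real" and C0 :: real
    and f0 :: "nat \<Rightarrow> real \<Rightarrow> real \<times> real \<Rightarrow> real"
    and E20 B0 :: "real \<Rightarrow> real"
  assumes mass_pos: "\<And>\<alpha>. \<alpha> \<in> {1..N} \<Longrightarrow> m \<alpha> > 0"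
    and data: "admissible_data N C0 f0 E20 B0"
    and neutral: "neutral N e f0"
  shows "\<exists>C. \<forall>f E1 E2 B. global_C1_solution N e m f0 E20 B0 f E1 E2 B \<longrightarrow>
           (\<forall>\<alpha>\<in>{1..N}. \<forall>t x v1 v2. (t, x, v1, v2) \<in> phase_support (f \<alpha>) \<longrightarrow>
              \<bar>v1\<bar> \<le> C + C * t powr (1/2) * (t - \<bar>x\<bar> + 2 * C0) powr (1/4))"
proof -
  obtain P0 F0 where P0: "P0 \<ge> 0" "\<And>\<alpha> x v. \<alpha> \<in> {1..N} \<Longrightarrow> f0 \<alpha> x v \<noteq> 0 \<Longrightarrow> \<bar>x\<bar> < C0 \<and> norm v \<le> P0"
    and F0: "\<And>x. \<bar>E20 x\<bar> \<le> F0 \<and> \<bar>B0 x\<bar> \<le> F0"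
    using admissible_data_bounds[OF data] by metis
  have C0: "C0 > 0" using data by (simp add: admissible_data_def)
  define C where "C = vlasov_maxwell.momentum_constant N e m C0 P0 F0 f0 E20 B0"
  show ?thesis
  proof (intro exI[of _ C] allI impI ballI)
    fix f E1 E2 B \<alpha> t x v1 v2
    assume sol: "global_C1_solution N e m f0 E20 B0 f E1 E2 B" and a: "\<alpha> \<in> {1..N}"
      and supp: "(t, x, v1, v2) \<in> phase_support (f \<alpha>)"
    obtain ft fx f1 f2 E1t E1x E2t E2x Bt Bx where
      "vlasov_maxwell N e m C0 P0 F0 f0 E20 B0 f ft fx f1 f2 E1 E2 B E1t E1x E2t E2x Bt Bx"
      by (rule global_C1_solution_vlasov_maxwell[OF sol mass_pos data neutral])
        (assumption | rule P0 F0 that)+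
    then interpret vlasov_maxwell N e m C0 P0 F0 f0 E20 B0 f ft fx f1 f2 E1 E2 B E1t E1x E2t E2x Bt Bx .
    let ?S = "{z :: real \<times> real \<times> real \<times> real. 0 \<le> fst z \<and> \<bar>fst (snd z)\<bar> \<le> C0 + fst z \<and>
      \<bar>fst (snd (snd z))\<bar> \<le> C + C * (sqrt (fst z) * sqrt (sqrt (fst z - \<bar>fst (snd z)\<bar> + 2 * C0)))}"
    \<comment> \<open>the bound extends from \<open>f \<noteq> 0\<close> to the support, since both sides are continuous for \<open>t \<ge> 0\<close>\<close>
    have "closed ?S"
      by (intro closed_Collect_conj closed_Collect_le continuous_intros)
    moreover have "{(t, x, v). t \<ge> 0 \<and> f \<alpha> t x v \<noteq> 0} \<subseteq> ?S"
    proof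
      fix z assume "z \<in> {(t, x, v). t \<ge> 0 \<and> f \<alpha> t x v \<noteq> 0}"
      then obtain t x a b where z: "z = (t, x, a, b)" and t: "0 \<le> t" and f: "f \<alpha> t x (a, b) \<noteq> 0"
        by (cases z) auto
      have "\<bar>x\<bar> \<le> C0 + t"
        using vlasov.f_space_support[OF species[OF a] t, of x "(a, b)"] f by linarith
      then show "z \<in> ?S"
        using momentum_bound[OF a t f] t by (simp add: C_def z)
    qed
    ultimately have "(t, x, v1, v2) \<in> ?S"
      using supp closure_minimal unfolding phase_support_def by blast
    then have t: "t \<ge> 0" and x: "\<bar>x\<bar> \<le> C0 + t"
      and bound: "\<bar>v1\<bar> \<le> C + C * (sqrt t * sqrt (sqrt (t - \<bar>x\<bar> + 2 * C0)))" by auto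
    have "t - \<bar>x\<bar> + 2 * C0 > 0" using x C0 by linarith
    then have "sqrt (sqrt (t - \<bar>x\<bar> + 2 * C0)) = (t - \<bar>x\<bar> + 2 * C0) powr (1/4)"
      by (simp add: powr_half_sqrt[symmetric] powr_powr)
    moreover have "sqrt t = t powr (1/2)" using t by (simp add: powr_half_sqrt)
    ultimately show "\<bar>v1\<bar> \<le> C + C * t powr (1/2) * (t - \<bar>x\<bar> + 2 * C0) powr (1/4)"
      using bound by (simp add: mult.assoc)
  qed
qed

end
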